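(* Let $\alpha,\beta$ be reals with $2>\alpha>\beta\geq 1$ and let $\mathcal{F}$ be an $(\alpha,\beta)$-smooth family of bipartite graphs. Then there exist $k_0$ such that for every odd $k\geq k_0$ there are constants $c_1,c_2>0$ with the following property: for all sufficiently large $n$, every $n$-vertex $\mathcal{F}\cup\{C_k\}$-free graph $G$ with exactly $\mathrm{ex}(n,\mathcal{F}\cup\{C_k\})$ edges can be made bipartite by deleting a set of at most $c_1 n^{1+\beta-\alpha}$ vertices which together are incident to at most $c_2 n^{\beta}$ edges. Consequently, $\mathrm{ex}(n,\mathcal{F}\cup\{C_k\})=z(n,\mathcal{F})+O(n^{\beta})$.
   Context: A graph is $\mathcal{H}$-free if it contains no member of the family $\mathcal{H}$ as a subgraph; $C_k$ is the cycle of length $k$. $\mathrm{ex}(n,\mathcal{H})$ is the maximum number of edges in an $n$-vertex $\mathcal{H}$-free graph. For a family $\mathcal{F}$ of bipartite graphs, $z(m,n,\mathcal{F})$ is the maximum number of edges in an $\mathcal{F}$-free bipartite graph with parts of sizes $m$ and $n$, and $z(n,\mathcal{F})$ is the maximum number of edges in an $n$-vertex $\mathcal{F}$-free bipartite graph. For reals $2>\alpha>\beta\geq 1$, $\mathcal{F}$ is $(\alpha,\beta)$-smooth (with relative density $\rho$) if there is $\rho>0$ such that for all $m\leq n$, $z(m,n,\mathcal{F})=\rho m n^{\alpha-1}+O(n^{\beta})$. *)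

theory Defs
  imports Complex_Main
begin

text \<open>A finite simple graph is a pair (V, E) of a finite vertex set and a set of
  2-element subsets of V. Vertices are natural numbers (every finite graph is
  isomorphic to one of these).\<close>

type_synonym graph = "nat set \<times> nat set set"

definition verts :: "graph \<Rightarrow> nat set" where "verts G = fst G"
definition edges :: "graph \<Rightarrow> nat set set" where "edges G = snd G"

definition is_graph :: "graph \<Rightarrow> bool" where
  "is_graph G \<longleftrightarrow> finite (verts G) \<and> (\<forall>e\<in>edges G. e \<subseteq> verts G \<and> card e = 2)"

definition contains :: "graph \<Rightarrow> graph \<Rightarrow> bool" where
  "contains G H \<longleftrightarrow> (\<exists>f. inj_on f (verts H) \<and> f ` verts H \<subseteq> verts G \<and>
      (\<forall>e\<in>edges H. f ` e \<in> edges G))"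

definition free :: "graph set \<Rightarrow> graph \<Rightarrow> bool" where
  "free \<H> G \<longleftrightarrow> (\<forall>H\<in>\<H>. \<not> contains G H)"

definition bipartite :: "graph \<Rightarrow> bool" where
  "bipartite G \<longleftrightarrow> (\<exists>A. \<forall>e\<in>edges G. card (e \<inter> A) = 1)"

definition cycle :: "nat \<Rightarrow> graph" where
  "cycle k = ({0..<k}, {{i, (i + 1) mod k} | i. i < k})"

definition ex :: "nat \<Rightarrow> graph set \<Rightarrow> nat" where
  "ex n \<H> = Sup {card (edges G) | G. is_graph G \<and> card (verts G) = n \<and> free \<H> G}"

definition zmn :: "nat \<Rightarrow> nat \<Rightarrow> graph set \<Rightarrow> nat" where
  "zmn m n \<F> = Sup {card (edges G) | G. is_graph G \<and> free \<F> G \<and>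
      (\<exists>A B. verts G = A \<union> B \<and> A \<inter> B = {} \<and> card A = m \<and> card B = n \<and>
        (\<forall>e\<in>edges G. \<exists>a\<in>A. \<exists>b\<in>B. e = {a, b}))}"

definition zn :: "nat \<Rightarrow> graph set \<Rightarrow> nat" where
  "zn n \<F> = Sup {card (edges G) | G. is_graph G \<and> card (verts G) = n \<and> bipartite G \<and> free \<F> G}"

definition smooth :: "real \<Rightarrow> real \<Rightarrow> graph set \<Rightarrow> bool" where
  "smooth \<alpha> \<beta> \<F> \<longleftrightarrow> (\<exists>\<rho>>0. \<exists>C. \<forall>m n. m \<le> n \<and> 1 \<le> n \<longrightarrow>
      \<bar>real (zmn m n \<F>) - \<rho> * real m * real n powr (\<alpha> - 1)\<bar> \<le> C * real n powr \<beta>)"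

definition delete_verts :: "graph \<Rightarrow> nat set \<Rightarrow> graph" where
  "delete_verts G S = (verts G - S, {e \<in> edges G. e \<inter> S = {}})"

definition incident_edges :: "graph \<Rightarrow> nat set \<Rightarrow> nat set set" where
  "incident_edges G S = {e \<in> edges G. e \<inter> S \<noteq> {}}"

end

theory Submission
  imports Defs "HOL-Analysis.Convex" "HOL-Real_Asymp.Real_Asymp"
begin

text \<open>
  Put \<open>\<gamma> = \<alpha> - 1\<close>. From an extremal graph delete a maximal vertex set \<open>S\<close> incident to at most
  \<open>\<delta> n\<^sup>\<gamma> |S|\<close> edges, with \<open>\<delta>\<close> half the edge density of a balanced bipartite extremal graph; the
  rest has minimum degree \<open>\<delta> n\<^sup>\<gamma>\<close>. The upper bound on \<open>z(m,n)\<close> makes every vertex set grow by a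
  power of \<open>n\<close> per step, so balls of a bounded radius have linear size and the breadth-first levels
  have bounded depth. Without a \<open>C\<^sub>k\<close> only \<open>O(n)\<close> edges lie inside levels, hence parity of the level
  is a bipartition up to \<open>O(n)\<close> edges. As the edge count is almost maximal, any two linear-sized
  subsets of opposite sides span an edge, so trees grown in two disjoint halves of the vertex set
  from the same vertex, or from the two ends of an edge, can be joined by paths of every large
  length of the right parity. Hence a graph without \<open>C\<^sub>k\<close> is exactly bipartite, and comparing its
  edge count with the bipartite maximum shows \<open>|S| = O(n\<^bsup>\<beta>-\<gamma>\<^esup>)\<close>.
\<close>

section \<open>Cores, cuts and splittings\<close>

text \<open>Counting alone cannot finish: parity of levels leaves O(n) edges inside the two sides,
  and an edge count within O(n^\<beta>) of the maximum tolerates them. Exact bipartiteness comes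
  from a second colouring, the parity with which a vertex reaches a linear-sized layer on a known
  side. It is well defined, and differs at the two ends of an edge, because otherwise a cycle of
  length \<open>k\<close> could be closed; the disjoint halves keep the two trees from meeting.
  Growth per step is of order n^(1+\<gamma>-\<beta>): minimum degree n^\<gamma> against an error of
  relative size n^(\<beta>-1). Radius and depth thus depend on \<rho>, \<alpha>, \<beta> only, so
  the threshold for \<open>k\<close> can be fixed before \<open>k\<close>. An edgeless pair of
  linear-sized sets costs order n^(1+\<gamma>) edges, more than the error n^\<beta> because \<beta>
  < \<alpha>. The half in \<delta>: deleting \<open>S\<close> lowers the main term of the bipartite
  maximum by at least 2 \<delta> n^\<gamma> |S|, but the edge count by at most half of that, so a
  surplus \<delta> n^\<gamma> |S| must fit into the error.\<close>

lemma is_graph_iff: "is_graph (V, E) \<longleftrightarrow> finite V \<and> (\<forall>e\<in>E. e \<subseteq> V \<and> card e = 2)"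
  by (simp add: is_graph_def verts_def edges_def)

lemma is_graph_finite_edges: "is_graph (V, E) \<Longrightarrow> finite E"
  unfolding is_graph_iff by (metis PowI finite_Pow_iff finite_subset subsetI)

lemma is_graph_edgeD:
  assumes "is_graph (V, E)" "{u, v} \<in> E"
  shows "u \<in> V" "v \<in> V" "u \<noteq> v"
  using assms unfolding is_graph_iff by auto

lemma is_graph_edgeE:
  assumes "is_graph (V, E)" "e \<in> E"
  obtains u v where "e = {u, v}" "u \<noteq> v" "u \<in> V" "v \<in> V"
  using assms unfolding is_graph_iff by (metis card_2_iff insert_subset)

lemma is_graph_subset: "is_graph (V, E) \<Longrightarrow> E' \<subseteq> E \<Longrightarrow> is_graph (V, E')"
  unfolding is_graph_iff by auto

definition nbrs :: "nat set set \<Rightarrow> nat \<Rightarrow> nat set" where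
  "nbrs E v = {u. {v, u} \<in> E}"

lemma nbrs_subset: "is_graph (V, E) \<Longrightarrow> nbrs E v \<subseteq> V"
  unfolding nbrs_def using is_graph_edgeD by blast

lemma finite_nbrs: "is_graph (V, E) \<Longrightarrow> finite (nbrs E v)"
  using nbrs_subset finite_subset is_graph_iff by metis

definition btw :: "nat set set \<Rightarrow> nat set \<Rightarrow> nat set \<Rightarrow> nat set set" where
  "btw E P Q = {e \<in> E. \<exists>a\<in>P. \<exists>b\<in>Q. e = {a, b}}"

lemma card_edges_at:
  assumes "is_graph (V, E)"
  shows "card {e \<in> E. v \<in> e \<and> e \<inter> S = {}} \<le> card (nbrs E v - S)"
proof -
  have sub: "{e \<in> E. v \<in> e \<and> e \<inter> S = {}} \<subseteq> (\<lambda>u. {v, u}) ` (nbrs E v - S)"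
  proof
    fix e assume e: "e \<in> {e \<in> E. v \<in> e \<and> e \<inter> S = {}}"
    then have "e \<in> E" "v \<in> e" by auto
    then obtain a b where "e = {a, b}" using is_graph_edgeE[OF assms] by metis
    then have "e = {v, a} \<or> e = {v, b}" using \<open>v \<in> e\<close> by auto
    then obtain u where "e = {v, u}" by blast
    then show "e \<in> (\<lambda>u. {v, u}) ` (nbrs E v - S)" using e by (auto simp: nbrs_def)
  qed
  have "finite (nbrs E v - S)" using finite_nbrs[OF assms] by simp
  then show ?thesis using sub by (rule surj_card_le)
qed

text \<open>A vertex outside a largest admissible \<open>S\<close> with fewer than \<open>d\<close>
  neighbours left could be added, since it brings fewer than \<open>d\<close> new incident edges.
  With an integer \<open>d\<close> the same fact also supplies the subgraph of large minimum degree
  for long paths.\<close>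

lemma core_exists:
  fixes d :: real
  assumes G: "is_graph (V, E)"
  shows "\<exists>S\<subseteq>V. real (card {e \<in> E. e \<inter> S \<noteq> {}}) \<le> d * real (card S) \<and>
    (\<forall>v\<in>V - S. d \<le> real (card (nbrs E v - S)))"
proof -
  define P where "P S \<longleftrightarrow> S \<subseteq> V \<and> real (card {e \<in> E. e \<inter> S \<noteq> {}}) \<le> d * real (card S)" for S
  have fV: "finite V" using G by (simp add: is_graph_iff)
  have fE: "finite E" using G by (rule is_graph_finite_edges)
  have 0: "P {}" by (simp add: P_def)
  have bd: "\<forall>S. P S \<longrightarrow> card S < Suc (card V)" using fV by (auto intro: card_mono simp: less_Suc_eq_le P_def)
  have "\<exists>S. P S \<and> (\<forall>T. P T \<longrightarrow> card T \<le> card S)"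
    by (rule ex_has_greatest_nat[OF 0 bd])
  then obtain S where S: "P S" and mx: "\<forall>T. P T \<longrightarrow> card T \<le> card S"
    by blast
  have "d \<le> real (card (nbrs E v - S))" if v: "v \<in> V - S" for v
  proof (rule ccontr)
    assume "\<not> d \<le> real (card (nbrs E v - S))"
    then have lt: "real (card (nbrs E v - S)) < d" by simp
    have fS: "finite S" using S[unfolded P_def] fV finite_subset by blast
    have "{e \<in> E. e \<inter> insert v S \<noteq> {}} = {e \<in> E. e \<inter> S \<noteq> {}} \<union> {e \<in> E. v \<in> e \<and> e \<inter> S = {}}"
      by auto
    then have "card {e \<in> E. e \<inter> insert v S \<noteq> {}} \<le> card {e \<in> E. e \<inter> S \<noteq> {}} + card (nbrs E v - S)"
      using card_Un_le[of "{e \<in> E. e \<inter> S \<noteq> {}}" "{e \<in> E. v \<in> e \<and> e \<inter> S = {}}"]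
        card_edges_at[OF G, of v S] by simp
    then have "real (card {e \<in> E. e \<inter> insert v S \<noteq> {}}) \<le> d * real (card S) + d"
      using S[unfolded P_def] lt by linarith
    also have "\<dots> = d * real (card (insert v S))"
      using v fS by (simp add: algebra_simps)
    finally have "P (insert v S)" using v S by (auto simp: P_def)
    then have "card (insert v S) \<le> card S" using mx by blast
    then show False using v fS by simp
  qed
  then show ?thesis using S unfolding P_def by blast
qed

section \<open>Long paths in graphs with many edges\<close>

text \<open>Greedy extension at the head: its \<open>t\<close> neighbours in \<open>T\<close> cannot
  all lie among the \<open>s < t\<close> other vertices already used.\<close>

lemma path_in_min_degree:
  assumes G: "is_graph (V, E)" and T: "T \<noteq> {}"
    and deg: "\<And>v. v \<in> T \<Longrightarrow> t \<le> card (nbrs E v \<inter> T)"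
  shows "s \<le> t \<Longrightarrow> \<exists>xs. distinct xs \<and> length xs = Suc s \<and> set xs \<subseteq> T \<and>
    successively (\<lambda>u v. {u, v} \<in> E) xs"
proof (induction s)
  case 0
  obtain v where "v \<in> T" using T by blast
  then show ?case by (intro exI[of _ "[v]"]) auto
next
  case (Suc s)
  then obtain xs where xs: "distinct xs" "length xs = Suc s" "set xs \<subseteq> T"
    "successively (\<lambda>u v. {u, v} \<in> E) xs" by auto
  then obtain v ys where vys: "xs = v # ys" by (cases xs) auto
  have "t \<le> card (nbrs E v \<inter> T)" using deg xs vys by auto
  moreover have "card (set ys) = s" using xs vys by (auto simp: distinct_card)
  ultimately have "card (set ys) < card (nbrs E v \<inter> T)" using Suc.prems by linarith
  then have "\<not> nbrs E v \<inter> T \<subseteq> set ys" by (meson card_mono List.finite_set not_le)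
  then obtain u where u: "u \<in> nbrs E v" "u \<in> T" "u \<notin> set ys" by blast
  have "u \<noteq> v" using u(1) is_graph_edgeD(3)[OF G] by (auto simp: nbrs_def)
  then show ?case using u xs vys
    by (intro exI[of _ "u # xs"]) (auto simp: nbrs_def insert_commute)
qed

text \<open>More than \<open>t\<close> edges per vertex leave a nonempty subgraph of minimum degree
  \<open>t\<close>: if the deleted set were all of \<open>V\<close>, every edge would meet it and
  there would be at most \<open>t * card V\<close> edges.\<close>

lemma path_exists:
  assumes G: "is_graph (V, E)" and big: "t * card V < card E"
  shows "\<exists>xs. distinct xs \<and> length xs = Suc t \<and> set xs \<subseteq> V \<and> successively (\<lambda>u v. {u, v} \<in> E) xs"
proof -
  obtain S where S: "S \<subseteq> V" "real (card {e \<in> E. e \<inter> S \<noteq> {}}) \<le> real t * real (card S)"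
    "\<forall>v\<in>V - S. real t \<le> real (card (nbrs E v - S))"
    using core_exists[OF G, of "real t"] by blast
  have "V - S \<noteq> {}"
  proof
    assume "V - S = {}"
    then have [simp]: "S = V" using S by auto
    have "e \<inter> V \<noteq> {}" if "e \<in> E" for e using is_graph_edgeE[OF G that] by auto
    then have "{e \<in> E. e \<inter> V \<noteq> {}} = E" by blast
    then show False using S(2) big by (simp flip: of_nat_mult)
  qed
  moreover have "nbrs E v - S = nbrs E v \<inter> (V - S)" for v
    using nbrs_subset[OF G] by blast
  ultimately show ?thesis
    using path_in_min_degree[OF G, of "V - S" t t] S(3) by (simp add: le_infI2) blast
qed

section \<open>Cuts compatible with a colouring\<close>

text \<open>Colours are placed one at a time, each on the side that cuts at least half of its edges
  to earlier colours. Cutting by colour instead of by vertex makes the cut a union of prescribed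
  classes, as the cut by ancestors needs.\<close>

lemma max_cut_aux:
  assumes "finite C"
  shows "finite E \<Longrightarrow> \<forall>e\<in>E. a e \<in> C \<and> b e \<in> C \<and> a e \<noteq> b e \<Longrightarrow>
    \<exists>Z\<subseteq>C. card E \<le> 2 * card {e \<in> E. (a e \<in> Z) \<noteq> (b e \<in> Z)}"
  using assms
proof (induction C arbitrary: E rule: finite_induct)
  case empty
  then have "E = {}" by auto
  then show ?case by auto
next
  case (insert c C)
  let ?E1 = "{e \<in> E. a e \<noteq> c \<and> b e \<noteq> c}" and ?E2 = "{e \<in> E. a e = c \<or> b e = c}"
  obtain Z where Z: "Z \<subseteq> C" "card ?E1 \<le> 2 * card {e \<in> ?E1. (a e \<in> Z) \<noteq> (b e \<in> Z)}"
    using insert.IH[of ?E1] insert.prems by auto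
  have cZ: "c \<notin> Z" using Z insert by auto
  let ?M = "\<lambda>Z. {e \<in> ?E2. (a e \<in> Z) \<noteq> (b e \<in> Z)}"
  \<comment> \<open>An edge with one end of colour \<open>c\<close> has its other end coloured in
    \<open>C\<close>, so exactly one of the two placements of \<open>c\<close> cuts it.\<close>
  have "?E2 = ?M Z \<union> ?M (insert c Z)" using cZ insert.prems by auto
  then have "card ?E2 \<le> card (?M Z) + card (?M (insert c Z))" by (metis (no_types, lifting) card_Un_le)
  then obtain W where W: "W = Z \<or> W = insert c Z" "card ?E2 \<le> 2 * card (?M W)"
    by (cases "card (?M Z) \<le> card (?M (insert c Z))") force+
  have "E = ?E1 \<union> ?E2" by auto
  then have 1: "card E \<le> card ?E1 + card ?E2" by (metis (no_types, lifting) card_Un_le)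
  have "{e \<in> E. (a e \<in> W) \<noteq> (b e \<in> W)} = {e \<in> ?E1. (a e \<in> Z) \<noteq> (b e \<in> Z)} \<union> ?M W"
    using W(1) by auto
  moreover have "{e \<in> ?E1. (a e \<in> Z) \<noteq> (b e \<in> Z)} \<inter> ?M W = {}" by auto
  ultimately have "card {e \<in> E. (a e \<in> W) \<noteq> (b e \<in> W)}
      = card {e \<in> ?E1. (a e \<in> Z) \<noteq> (b e \<in> Z)} + card (?M W)"
    using insert.prems by (simp add: card_Un_disjoint)
  then show ?case using 1 Z W by (intro exI[of _ W]) auto
qed

text \<open>With the identity as colouring this is an ordinary maximum cut; with the
  \<open>i\<close>-th ancestor as colouring, vertices with the same \<open>i\<close>-th ancestor
  stay on one side.\<close>

lemma max_cut:
  assumes G: "is_graph (V, E)" and E: "\<And>u v. {u, v} \<in> E \<Longrightarrow> c u \<noteq> c v"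
  shows "\<exists>Z. card E \<le> 2 * card {e \<in> E. \<exists>u v. e = {u, v} \<and> c u \<in> Z \<and> c v \<notin> Z}"
proof -
  have "\<forall>e\<in>E. \<exists>x y. e = {x, y}" using is_graph_edgeE[OF G] by metis
  then obtain x y where xy: "\<And>e. e \<in> E \<Longrightarrow> e = {x e, y e}" by metis
  have fE: "finite E" using G by (rule is_graph_finite_edges)
  have "\<forall>e\<in>E. c (x e) \<in> c ` x ` E \<union> c ` y ` E \<and> c (y e) \<in> c ` x ` E \<union> c ` y ` E \<and> c (x e) \<noteq> c (y e)"
    using xy E by (metis UnCI imageI)
  then obtain Z where Z: "card E \<le> 2 * card {e \<in> E. (c (x e) \<in> Z) \<noteq> (c (y e) \<in> Z)}"
    using max_cut_aux[of "c ` x ` E \<union> c ` y ` E" E "\<lambda>e. c (x e)" "\<lambda>e. c (y e)"] fE by blast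
  have "{e \<in> E. (c (x e) \<in> Z) \<noteq> (c (y e) \<in> Z)} \<subseteq> {e \<in> E. \<exists>u v. e = {u, v} \<and> c u \<in> Z \<and> c v \<notin> Z}"
  proof
    fix e assume e: "e \<in> {e \<in> E. (c (x e) \<in> Z) \<noteq> (c (y e) \<in> Z)}"
    then have "e = {x e, y e}" "e = {y e, x e}" using xy by auto
    then show "e \<in> {e \<in> E. \<exists>u v. e = {u, v} \<and> c u \<in> Z \<and> c v \<notin> Z}" using e by blast
  qed
  then have "card {e \<in> E. (c (x e) \<in> Z) \<noteq> (c (y e) \<in> Z)} \<le> card {e \<in> E. \<exists>u v. e = {u, v} \<and> c u \<in> Z \<and> c v \<notin> Z}"
    using fE by (intro card_mono) auto
  then show ?thesis using Z by (intro exI[of _ Z]) linarith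
qed

text \<open>A derandomised fair colouring of \<open>V\<close>: the weighted sum is the conditional expectation, and
  arbitrary weights make the induction over the vertices go through.\<close>

lemma split_weighted:
  fixes x y :: "'i \<Rightarrow> real"
  assumes "finite V" "finite I" "\<And>i. i \<in> I \<Longrightarrow> 0 \<le> x i" "\<And>i. i \<in> I \<Longrightarrow> 0 \<le> y i"
  shows "\<exists>A\<subseteq>V. (\<Sum>i\<in>I. x i * (1/2) ^ card (N i \<inter> A) + y i * (1/2) ^ card (N i \<inter> (V - A)))
     \<le> (\<Sum>i\<in>I. (x i + y i) * (3/4) ^ card (N i \<inter> V))"
  using assms(1,3,4)
proof (induction V arbitrary: x y rule: finite_induct)
  case empty
  show ?case by (intro exI[of _ "{}"]) simp
next
  case (insert v V)
  \<comment> \<open>\<open>h\<close> is the factor by which placing \<open>v\<close> on a side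
    changes the terms of that side; \<open>s = (1 + h) / 2\<close> is its mean over the two
    placements, hence 3/4 when \<open>v\<close> lies in \<open>N i\<close>.\<close>
  define s where "s i = (if v \<in> N i then 3/4 else 1 :: real)" for i
  define h where "h i = (if v \<in> N i then 1/2 else 1 :: real)" for i
  obtain A where A: "A \<subseteq> V" and le: "(\<Sum>i\<in>I. (x i * s i) * (1/2) ^ card (N i \<inter> A) + (y i * s i) * (1/2) ^ card (N i \<inter> (V - A)))
     \<le> (\<Sum>i\<in>I. (x i * s i + y i * s i) * (3/4) ^ card (N i \<inter> V))"
    using insert.IH[of "\<lambda>i. x i * s i" "\<lambda>i. y i * s i"] insert.prems by (auto simp: s_def)
  have fA: "finite A" using A insert finite_subset by blast
  have vA: "v \<notin> A" using A insert by auto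
  have r: "(\<Sum>i\<in>I. (x i * s i + y i * s i) * (3/4) ^ card (N i \<inter> V)) = (\<Sum>i\<in>I. (x i + y i) * (3/4) ^ card (N i \<inter> insert v V))"
    using insert by (intro sum.cong) (auto simp: s_def Int_insert_right algebra_simps)
  let ?F = "\<lambda>A. \<Sum>i\<in>I. x i * (1/2) ^ card (N i \<inter> A) + y i * (1/2) ^ card (N i \<inter> (insert v V - A))"
  have 1: "?F (insert v A) = (\<Sum>i\<in>I. h i * (x i * (1/2) ^ card (N i \<inter> A)) + y i * (1/2) ^ card (N i \<inter> (V - A)))"
  proof (intro sum.cong refl)
    fix i
    have "insert v V - insert v A = V - A" using insert by auto
    then show "x i * (1/2) ^ card (N i \<inter> insert v A) + y i * (1/2) ^ card (N i \<inter> (insert v V - insert v A)) =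
       h i * (x i * (1/2) ^ card (N i \<inter> A)) + y i * (1/2) ^ card (N i \<inter> (V - A))"
      using fA vA by (auto simp: h_def Int_insert_right)
  qed
  have 2: "?F A = (\<Sum>i\<in>I. x i * (1/2) ^ card (N i \<inter> A) + h i * (y i * (1/2) ^ card (N i \<inter> (V - A))))"
  proof (intro sum.cong refl)
    fix i
    have "insert v V - A = insert v (V - A)" using vA by auto
    then show "x i * (1/2) ^ card (N i \<inter> A) + y i * (1/2) ^ card (N i \<inter> (insert v V - A)) =
       x i * (1/2) ^ card (N i \<inter> A) + h i * (y i * (1/2) ^ card (N i \<inter> (V - A)))"
      using insert by (auto simp: h_def Int_insert_right)
  qed
  have hs: "1 + h i = 2 * s i" for i by (simp add: h_def s_def)
  have "?F (insert v A) + ?F A = (\<Sum>i\<in>I. (1 + h i) * (x i * (1/2) ^ card (N i \<inter> A)) + (1 + h i) * (y i * (1/2) ^ card (N i \<inter> (V - A))))"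
    unfolding 1 2 by (simp add: sum.distrib[symmetric] algebra_simps)
  also have "\<dots> = 2 * (\<Sum>i\<in>I. (x i * s i) * (1/2) ^ card (N i \<inter> A) + (y i * s i) * (1/2) ^ card (N i \<inter> (V - A)))"
    unfolding hs sum_distrib_left by (intro sum.cong) (auto simp: algebra_simps)
  finally have "?F (insert v A) + ?F A \<le> 2 * (\<Sum>i\<in>I. (x i + y i) * (3/4) ^ card (N i \<inter> insert v V))"
    using le r by linarith
  then have "?F (insert v A) \<le> (\<Sum>i\<in>I. (x i + y i) * (3/4) ^ card (N i \<inter> insert v V)) \<or>
     ?F A \<le> (\<Sum>i\<in>I. (x i + y i) * (3/4) ^ card (N i \<inter> insert v V))" by linarith
  moreover have "insert v A \<subseteq> insert v V" "A \<subseteq> insert v V" using A by auto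
  ultimately show ?case by blast
qed

text \<open>A first moment argument in which \<open>(1/2) ^ m\<close> replaces the indicator of a
  small intersection; its mean over all colourings is \<open>(3/4) ^ card (N i)\<close>. Once the
  sum of all terms is below \<open>(1/2) powr (D / 10)\<close>, no intersection can have fewer than
  \<open>D / 10\<close> elements.\<close>

lemma split_exists:
  fixes D :: real
  assumes "finite V" "finite I" "\<And>i. i \<in> I \<Longrightarrow> N i \<subseteq> V" "\<And>i. i \<in> I \<Longrightarrow> D \<le> real (card (N i))"
    and small: "2 * real (card I) * (3/4) powr D * 2 powr (D / 10) < 1" and D: "0 \<le> D"
  shows "\<exists>A\<subseteq>V. \<forall>i\<in>I. D / 10 \<le> real (card (N i \<inter> A)) \<and> D / 10 \<le> real (card (N i \<inter> (V - A)))"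
proof -
  obtain A where A: "A \<subseteq> V" and
    le: "(\<Sum>i\<in>I. 1 * (1/2) ^ card (N i \<inter> A) + 1 * (1/2) ^ card (N i \<inter> (V - A)))
     \<le> (\<Sum>i\<in>I. (1 + 1 :: real) * (3/4) ^ card (N i \<inter> V))"
    using split_weighted[OF assms(1,2), of "\<lambda>_. 1" "\<lambda>_. 1" N] by auto
  have "(\<Sum>i\<in>I. (1 + 1 :: real) * (3/4) ^ card (N i \<inter> V)) \<le> (\<Sum>i\<in>I. 2 * (3/4) powr D)"
  proof (intro sum_mono)
    fix i assume i: "i \<in> I"
    then have "N i \<inter> V = N i" using assms(3) by blast
    moreover have "(3/4 :: real) ^ card (N i) = (3/4) powr (real (card (N i)))" by (simp add: powr_realpow)
    moreover have "(3/4 :: real) powr (real (card (N i))) \<le> (3/4) powr D"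
      using assms(4)[OF i] by (intro powr_mono') auto
    ultimately show "(1 + 1 :: real) * (3/4) ^ card (N i \<inter> V) \<le> 2 * (3/4) powr D" by simp
  qed
  also have "\<dots> = 2 * real (card I) * (3/4) powr D" by simp
  finally have le2: "(\<Sum>i\<in>I. (1/2) ^ card (N i \<inter> A) + (1/2) ^ card (N i \<inter> (V - A))) \<le> 2 * real (card I) * (3/4) powr D"
    using le by simp
  have small2: "2 * real (card I) * (3/4) powr D < (1/2) powr (D / 10)"
  proof -
    have "(1/2 :: real) powr (D/10) = 1 / 2 powr (D/10)" by (simp add: powr_divide)
    then show ?thesis using small by (simp only: pos_less_divide_eq powr_gt_zero)
  qed
  have key: "D / 10 \<le> real m" if "(1/2 :: real) ^ m < (1/2) powr (D/10)" for m
  proof (rule ccontr)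
    assume "\<not> D / 10 \<le> real m"
    then have "(1/2 :: real) powr (D/10) \<le> (1/2) powr real m" by (intro powr_mono') auto
    then show False using that by (simp add: powr_realpow)
  qed
  have "D / 10 \<le> real (card (N i \<inter> A)) \<and> D / 10 \<le> real (card (N i \<inter> (V - A)))" if i: "i \<in> I" for i
  proof -
    have "(1/2 :: real) ^ card (N i \<inter> A) + (1/2) ^ card (N i \<inter> (V - A)) \<le>
       (\<Sum>i\<in>I. (1/2) ^ card (N i \<inter> A) + (1/2) ^ card (N i \<inter> (V - A)))"
      using i assms(2) by (intro member_le_sum) auto
    then have *: "(1/2 :: real) ^ card (N i \<inter> A) + (1/2) ^ card (N i \<inter> (V - A)) < (1/2) powr (D/10)"
      using le2 small2 by linarith
    have pos: "0 < (1/2 :: real) ^ card (N i \<inter> A)" "0 < (1/2 :: real) ^ card (N i \<inter> (V - A))" by auto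
    show ?thesis using key[of "card (N i \<inter> A)"] key[of "card (N i \<inter> (V - A))"] * pos by linarith
  qed
  then show ?thesis using A by blast
qed

lemma is_graph_finite_chain:
  assumes "is_graph (V, E)" "U \<subseteq> W" "W \<subseteq> V"
  shows "finite V \<and> finite W \<and> finite U"
proof -
  have V: "finite V" using assms(1) by (simp add: is_graph_iff)
  have W: "finite W" using assms(3) V by (rule finite_subset)
  have "finite U" using assms(2) W by (rule finite_subset)
  then show ?thesis using V W by simp
qed

section \<open>Expansion of sparse graphs\<close>

text \<open>This upper half of smoothness, with \<gamma> for \<alpha> - 1, is the form in which
  \<F>-freeness enters the structural argument. Quantifying over all disjoint pairs in
  \<open>V\<close> makes it pass to subgraphs.\<close>

definition sparse :: "real \<Rightarrow> real \<Rightarrow> real \<Rightarrow> real \<Rightarrow> nat set \<Rightarrow> nat set set \<Rightarrow> bool" where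
  "sparse \<rho> C \<gamma> \<beta> V E \<longleftrightarrow> (\<forall>P Q. P \<subseteq> V \<longrightarrow> Q \<subseteq> V \<longrightarrow> P \<inter> Q = {} \<longrightarrow> card P \<le> card Q \<longrightarrow> Q \<noteq> {} \<longrightarrow>
     real (card (btw E P Q)) \<le> \<rho> * real (card P) * real (card Q) powr \<gamma> + C * real (card Q) powr \<beta>)"

lemma btw_commute: "btw E P Q = btw E Q P"
  unfolding btw_def by (auto simp: insert_commute)

lemma finite_btw: "is_graph (V, E) \<Longrightarrow> finite (btw E P Q)"
  using is_graph_finite_edges unfolding btw_def by auto

text \<open>When \<open>P\<close> is the larger part the roles swap, and
  \<open>q * p powr \<gamma> \<le> p * q powr \<gamma>\<close> for \<open>q \<le> p\<close> because
  \<gamma> \<le> 1. One bound therefore serves without comparing the parts, provided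
  \<open>w\<close> dominates both sizes.\<close>

lemma sparse_le:
  assumes G: "is_graph (V, E)" and sp: "sparse \<rho> C \<gamma> \<beta> V E"
    and c: "0 \<le> \<rho>" "0 \<le> C" "0 \<le> \<gamma>" "\<gamma> \<le> 1" "0 \<le> \<beta>"
    and PQ: "P \<subseteq> V" "Q \<subseteq> V" "P \<inter> Q = {}"
    and sz: "real (card P) \<le> u" "real (card P) \<le> w" "real (card Q) \<le> w"
  shows "real (card (btw E P Q)) \<le> \<rho> * u * w powr \<gamma> + C * w powr \<beta>"
proof -
  have fin: "finite P" "finite Q" using G PQ finite_subset by (auto simp: is_graph_iff)
  have wu: "0 \<le> w" "0 \<le> u" using sz by linarith+
  show ?thesis
  proof (cases "P = {} \<or> Q = {}")
    case True
    then have "btw E P Q = {}" by (auto simp: btw_def)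
    then show ?thesis using c wu by simp
  next
    case False
    then have pos: "0 < card P" "0 < card Q" using fin by (auto simp: card_gt_0_iff)
    have mon: "real (card Q) powr \<beta> \<le> w powr \<beta>" "real (card P) powr \<beta> \<le> w powr \<beta>"
      "real (card Q) powr \<gamma> \<le> w powr \<gamma>"
      using sz c by (auto intro: powr_mono2)
    show ?thesis
    proof (cases "card P \<le> card Q")
      case True
      have "real (card (btw E P Q)) \<le> \<rho> * real (card P) * real (card Q) powr \<gamma> + C * real (card Q) powr \<beta>"
        using sp PQ True False unfolding sparse_def by blast
      also have "\<dots> \<le> \<rho> * u * w powr \<gamma> + C * w powr \<beta>"
        using mon c sz wu by (intro add_mono mult_mono) auto
      finally show ?thesis .
    next
      case 2: False
      let ?p = "real (card P)" and ?q = "real (card Q)"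
      have "real (card (btw E P Q)) \<le> \<rho> * ?q * ?p powr \<gamma> + C * ?p powr \<beta>"
        using sp PQ 2 False unfolding sparse_def btw_commute[of E P Q] by (auto simp: Int_commute)
      moreover have "?q * ?p powr \<gamma> \<le> ?p * ?q powr \<gamma>"
      proof -
        \<comment> \<open>Splitting off \<open>?q powr (1 - \<gamma>)\<close> isolates the factor
          that grows when \<open>?q\<close> is replaced by \<open>?p\<close>.\<close>
        have "?q * ?p powr \<gamma> = ?q powr \<gamma> * ?q powr (1 - \<gamma>) * ?p powr \<gamma>"
          using pos by (simp flip: powr_add)
        also have "\<dots> \<le> ?q powr \<gamma> * ?p powr (1 - \<gamma>) * ?p powr \<gamma>"
          using 2 c by (intro mult_mono powr_mono2) auto
        also have "\<dots> = ?p * ?q powr \<gamma>"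
          using pos by (simp add: mult.assoc flip: powr_add)
        finally show ?thesis .
      qed
      moreover have "?p * ?q powr \<gamma> \<le> u * w powr \<gamma>"
        using mon sz wu by (intro mult_mono) auto
      ultimately have "real (card (btw E P Q)) \<le> \<rho> * (u * w powr \<gamma>) + C * ?p powr \<beta>"
        using c by (smt (verit) mult.assoc mult_left_mono)
      also have "\<dots> \<le> \<rho> * u * w powr \<gamma> + C * w powr \<beta>"
        using mon c by (simp add: mult.assoc mult_left_mono)
      finally show ?thesis .
    qed
  qed
qed

text \<open>Sparsity speaks only about bipartite pieces, and the graph on \<open>W\<close> need not
  be bipartite. A cut \<open>Z\<close> keeps at least half of the edges, and those run between
  \<open>U \<inter> Z\<close> and \<open>W - Z\<close> or between \<open>U - Z\<close> and
  \<open>W \<inter> Z\<close>; the factor 4 is twice two.\<close>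

lemma sparse_meeting:
  assumes G: "is_graph (V, E)" and sp: "sparse \<rho> C \<gamma> \<beta> V E"
    and c: "0 \<le> \<rho>" "0 \<le> C" "0 \<le> \<gamma>" "\<gamma> \<le> 1" "0 \<le> \<beta>"
    and UW: "U \<subseteq> W" "W \<subseteq> V"
  shows "real (card {e \<in> E. e \<subseteq> W \<and> e \<inter> U \<noteq> {}}) \<le>
    4 * (\<rho> * real (card U) * real (card W) powr \<gamma> + C * real (card W) powr \<beta>)"
proof -
  let ?M = "{e \<in> E. e \<subseteq> W \<and> e \<inter> U \<noteq> {}}"
  have fV: "finite V" "finite W" "finite U" using is_graph_finite_chain[OF G UW(1,2)] by auto
  have gM: "is_graph (V, ?M)" by (rule is_graph_subset[OF G]) simp
  have "\<exists>Z. card ?M \<le> 2 * card {e \<in> ?M. \<exists>u v. e = {u, v} \<and> u \<in> Z \<and> v \<notin> Z}"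
    by (rule max_cut[OF gM, of "\<lambda>x. x"]) (rule is_graph_edgeD(3)[OF gM])
  then obtain Z where Z: "card ?M \<le> 2 * card {e \<in> ?M. \<exists>u v. e = {u, v} \<and> u \<in> Z \<and> v \<notin> Z}"
    by (rule exE)
  have sub: "{e \<in> ?M. \<exists>u v. e = {u, v} \<and> u \<in> Z \<and> v \<notin> Z} \<subseteq> btw E (U \<inter> Z) (W - Z) \<union> btw E (U - Z) (W \<inter> Z)"
  proof
    fix e assume "e \<in> {e \<in> ?M. \<exists>u v. e = {u, v} \<and> u \<in> Z \<and> v \<notin> Z}"
    then obtain u v where e: "e \<in> E" "e = {u, v}" "u \<in> Z" "v \<notin> Z" "u \<in> W" "v \<in> W" "u \<in> U \<or> v \<in> U" by auto
    show "e \<in> btw E (U \<inter> Z) (W - Z) \<union> btw E (U - Z) (W \<inter> Z)"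
    proof (cases "u \<in> U")
      case True
      then have "e \<in> btw E (U \<inter> Z) (W - Z)" using e by (auto simp: btw_def)
      then show ?thesis by simp
    next
      case False
      then have "e = {v, u}" "v \<in> U - Z" "u \<in> W \<inter> Z" using e by auto
      then have "e \<in> btw E (U - Z) (W \<inter> Z)" using e(1) unfolding btw_def by blast
      then show ?thesis by simp
    qed
  qed
  have le: "real (card (btw E P Q)) \<le> \<rho> * real (card U) * real (card W) powr \<gamma> + C * real (card W) powr \<beta>"
    if "P \<subseteq> U" "Q \<subseteq> W" "P \<inter> Q = {}" for P Q
  proof (rule sparse_le[OF G sp c])
    show "P \<subseteq> V" "Q \<subseteq> V" "P \<inter> Q = {}" using that UW by blast+
    have "card P \<le> card U" "card Q \<le> card W" "card U \<le> card W" using that fV UW by (auto intro: card_mono)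
    then show "real (card P) \<le> real (card U)" "real (card P) \<le> real (card W)" "real (card Q) \<le> real (card W)"
      by auto
  qed
  have "card {e \<in> ?M. \<exists>u v. e = {u, v} \<and> u \<in> Z \<and> v \<notin> Z} \<le> card (btw E (U \<inter> Z) (W - Z) \<union> btw E (U - Z) (W \<inter> Z))"
    by (rule card_mono[OF _ sub]) (simp add: finite_btw[OF G])
  also have "\<dots> \<le> card (btw E (U \<inter> Z) (W - Z)) + card (btw E (U - Z) (W \<inter> Z))" by (rule card_Un_le)
  finally have "2 * card {e \<in> ?M. \<exists>u v. e = {u, v} \<and> u \<in> Z \<and> v \<notin> Z} \<le>
      2 * (card (btw E (U \<inter> Z) (W - Z)) + card (btw E (U - Z) (W \<inter> Z)))" by (rule mult_le_mono2)
  with Z have "card ?M \<le> 2 * (card (btw E (U \<inter> Z) (W - Z)) + card (btw E (U - Z) (W \<inter> Z)))"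
    by (rule order_trans)
  then have "real (card ?M) \<le> real (2 * (card (btw E (U \<inter> Z) (W - Z)) + card (btw E (U - Z) (W \<inter> Z))))"
    by (rule of_nat_mono)
  then have "real (card ?M) \<le> 2 * (real (card (btw E (U \<inter> Z) (W - Z))) + real (card (btw E (U - Z) (W \<inter> Z))))"
    by simp
  moreover have "real (card (btw E (U \<inter> Z) (W - Z))) \<le> \<rho> * real (card U) * real (card W) powr \<gamma> + C * real (card W) powr \<beta>"
    by (rule le) auto
  moreover have "real (card (btw E (U - Z) (W \<inter> Z))) \<le> \<rho> * real (card U) * real (card W) powr \<gamma> + C * real (card W) powr \<beta>"
    by (rule le) (use UW in auto)
  moreover have "m \<le> 4 * x" if "m \<le> 2 * (p + q)" "p \<le> x" "q \<le> x" for m p q x :: real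
    using that by simp
  ultimately show ?thesis by blast
qed

lemma degree_sum_le:
  assumes G: "is_graph (V, E)" and UW: "U \<subseteq> W" "W \<subseteq> V"
    and deg: "\<And>v. v \<in> U \<Longrightarrow> d \<le> real (card (nbrs E v \<inter> W))"
  shows "real (card U) * d \<le> 2 * real (card {e \<in> E. e \<subseteq> W \<and> e \<inter> U \<noteq> {}})"
proof -
  let ?M = "{e \<in> E. e \<subseteq> W \<and> e \<inter> U \<noteq> {}}"
  let ?S = "Sigma U (\<lambda>v. nbrs E v \<inter> W)"
  have fV: "finite V" "finite W" "finite U" using is_graph_finite_chain[OF G UW(1,2)] by auto
  have "real (card U) * d \<le> (\<Sum>v\<in>U. real (card (nbrs E v \<inter> W)))"
    using sum_mono[of U "\<lambda>_. d" "\<lambda>v. real (card (nbrs E v \<inter> W))"] deg by simp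
  also have "\<dots> = real (card ?S)" using fV by (subst card_SigmaI) auto
  also have "\<dots> \<le> real (card (?M \<times> (UNIV :: bool set)))"
  proof -
    \<comment> \<open>An ordered adjacent pair is its edge together with an orientation, recorded by
      \<open>v < u\<close>; hence no edge is counted more than twice.\<close>
    let ?f = "\<lambda>(v, u). ({v, u}, v < u)"
    have "inj_on ?f ?S"
      by (auto simp: inj_on_def doubleton_eq_iff nbrs_def)
    moreover have "?f ` ?S \<subseteq> ?M \<times> UNIV" using UW by (auto simp: nbrs_def)
    moreover have "finite (?M \<times> (UNIV :: bool set))" using is_graph_finite_edges[OF G] by auto
    ultimately have "card ?S \<le> card (?M \<times> (UNIV :: bool set))" by (rule card_inj_on_le)
    then show ?thesis by (rule of_nat_mono)
  qed
  also have "\<dots> = 2 * real (card ?M)" by (simp add: card_cartesian_product)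
  finally show ?thesis .
qed

text \<open>The degree sum over \<open>U\<close> is at most twice the number of edges in
  \<open>W\<close> that meet \<open>U\<close>. While \<open>W\<close> is smaller than
  \<open>\<epsilon> * n\<close> the main term pays at most half of it, so the error term must pay
  the rest: \<open>card U * \<delta> * n powr \<gamma>\<close> is at most
  \<open>16 * C * card W * n powr (\<beta> - 1)\<close>.\<close>

lemma expansion_step:
  fixes n :: real
  assumes G: "is_graph (V, E)" and sp: "sparse \<rho> C \<gamma> \<beta> V E"
    and c: "0 \<le> \<rho>" "0 < C" "0 \<le> \<gamma>" "\<gamma> \<le> 1" "1 \<le> \<beta>"
    and UW: "U \<subseteq> W" "W \<subseteq> V" "U \<noteq> {}" and n: "real (card V) \<le> n"
    and deg: "\<And>v. v \<in> U \<Longrightarrow> \<delta> * n powr \<gamma> \<le> real (card (nbrs E v \<inter> W))"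
    and \<epsilon>: "0 < \<epsilon>" "16 * \<rho> * \<epsilon> powr \<gamma> \<le> \<delta>" and \<delta>: "0 < \<delta>"
    and \<theta>: "n powr \<theta> \<le> \<delta> / (16 * C) * n powr (\<gamma> + 1 - \<beta>)"
    and small: "real (card W) < \<epsilon> * n"
  shows "real (card U) * n powr \<theta> \<le> real (card W)"
proof -
  let ?u = "real (card U)" and ?w = "real (card W)"
  have fV: "finite V" "finite W" "finite U" using is_graph_finite_chain[OF G UW(1,2)] by auto
  have u: "1 \<le> ?u" using UW fV by (simp add: Suc_leI card_gt_0_iff)
  have uw: "?u \<le> ?w" using fV UW by (simp add: card_mono)
  have wn: "?w \<le> n" using n card_mono[OF fV(1) UW(2)] by linarith
  have n0: "0 < n" using u uw wn by linarith
  have "?u * (\<delta> * n powr \<gamma>) \<le> 8 * (\<rho> * ?u * ?w powr \<gamma> + C * ?w powr \<beta>)"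
  proof -
    have "?u * (\<delta> * n powr \<gamma>) \<le> 2 * real (card {e \<in> E. e \<subseteq> W \<and> e \<inter> U \<noteq> {}})"
      by (rule degree_sum_le[OF G UW(1,2) deg])
    moreover have "real (card {e \<in> E. e \<subseteq> W \<and> e \<inter> U \<noteq> {}}) \<le> 4 * (\<rho> * ?u * ?w powr \<gamma> + C * ?w powr \<beta>)"
      by (rule sparse_meeting[OF G sp _ _ _ _ _ UW(1,2)]) (use c in auto)
    ultimately show ?thesis by simp
  qed
  moreover have "8 * (\<rho> * ?u * ?w powr \<gamma>) \<le> ?u * (\<delta> * n powr \<gamma>) / 2"
  proof -
    have "?w powr \<gamma> \<le> (\<epsilon> * n) powr \<gamma>" using small c by (intro powr_mono2) auto
    also have "\<dots> = \<epsilon> powr \<gamma> * n powr \<gamma>" using \<epsilon> n0 by (simp add: powr_mult)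
    finally have "16 * \<rho> * ?w powr \<gamma> \<le> 16 * \<rho> * (\<epsilon> powr \<gamma> * n powr \<gamma>)" using c by (intro mult_left_mono) auto
    also have "\<dots> \<le> \<delta> * n powr \<gamma>" using mult_right_mono[OF \<epsilon>(2), of "n powr \<gamma>"] by (simp add: mult.assoc)
    finally have "?u * (16 * \<rho> * ?w powr \<gamma>) \<le> ?u * (\<delta> * n powr \<gamma>)" by (intro mult_left_mono) auto
    then show ?thesis by (simp add: algebra_simps)
  qed
  ultimately have "?u * (\<delta> * n powr \<gamma>) \<le> 16 * C * ?w powr \<beta>" by (simp add: algebra_simps)
  also have "?w powr \<beta> = ?w * ?w powr (\<beta> - 1)"
    using u uw by (simp add: powr_mult_base)
  also have "16 * C * (?w * ?w powr (\<beta> - 1)) \<le> 16 * C * (?w * n powr (\<beta> - 1))"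
    using c wn by (intro mult_left_mono powr_mono2) auto
  finally have "?u * (\<delta> * n powr \<gamma>) \<le> 16 * C * (?w * n powr (\<beta> - 1))" .
  then have 1: "?u * (\<delta> * n powr \<gamma>) / (16 * C * n powr (\<beta> - 1)) \<le> ?w"
    using c n0 by (simp add: field_simps)
  have "n powr (\<gamma> + 1 - \<beta>) = n powr \<gamma> / n powr (\<beta> - 1)"
    by (simp add: powr_diff[symmetric] algebra_simps)
  then have "?u * (\<delta> / (16 * C) * n powr (\<gamma> + 1 - \<beta>)) = ?u * (\<delta> * n powr \<gamma>) / (16 * C * n powr (\<beta> - 1))"
    by simp
  moreover have "?u * n powr \<theta> \<le> ?u * (\<delta> / (16 * C) * n powr (\<gamma> + 1 - \<beta>))" using \<theta> by (intro mult_left_mono) auto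
  ultimately show ?thesis using 1 by linarith
qed

text \<open>If the sets stayed below \<open>\<epsilon> * n\<close> for \<open>r\<close> steps,
  growth by \<open>n powr \<theta>\<close> each time would yield more than \<open>n\<close>
  vertices. The chain is abstract because it serves both for balls and for trees confined to half of
  the vertices.\<close>

lemma expansion:
  fixes n :: real
  assumes G: "is_graph (V, E)" and sp: "sparse \<rho> C \<gamma> \<beta> V E"
    and c: "0 \<le> \<rho>" "0 < C" "0 \<le> \<gamma>" "\<gamma> \<le> 1" "1 \<le> \<beta>"
    and n: "real (card V) \<le> n" "1 < n"
    and U: "\<And>i. U i \<subseteq> U (Suc i)" "\<And>i. U i \<subseteq> V" "U 0 \<noteq> {}"
    and deg: "\<And>i v. v \<in> U i \<Longrightarrow> \<delta> * n powr \<gamma> \<le> real (card (nbrs E v \<inter> U (Suc i)))"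
    and \<epsilon>: "0 < \<epsilon>" "16 * \<rho> * \<epsilon> powr \<gamma> \<le> \<delta>" and \<delta>: "0 < \<delta>"
    and \<theta>: "n powr \<theta> \<le> \<delta> / (16 * C) * n powr (\<gamma> + 1 - \<beta>)" and r: "1 < real r * \<theta>"
  shows "\<epsilon> * n \<le> real (card (U r))"
proof (rule ccontr)
  assume neg: "\<not> \<epsilon> * n \<le> real (card (U r))"
  have mono: "U i \<subseteq> U j" if "i \<le> j" for i j using lift_Suc_mono_le[of U, OF U(1) that] .
  have fV: "finite V" using G by (simp add: is_graph_iff)
  have fU: "finite (U i)" for i using U(2) fV finite_subset by blast
  have "n powr (real i * \<theta>) \<le> real (card (U i))" if "i \<le> r" for i using that
  proof (induction i)
    case 0
    have "0 < card (U 0)" using U(3) fU card_gt_0_iff by blast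
    then show ?case using n by simp
  next
    case (Suc i)
    have "real (card (U (Suc i))) \<le> real (card (U r))" using mono[OF Suc.prems] fU by (simp add: card_mono)
    then have "real (card (U (Suc i))) < \<epsilon> * n" using neg by linarith
    moreover have "U i \<noteq> {}" using mono[of 0 i] U(3) by auto
    ultimately have "real (card (U i)) * n powr \<theta> \<le> real (card (U (Suc i)))"
      by (intro expansion_step[OF G sp c U(1) U(2) _ n(1) deg \<epsilon> \<delta> \<theta>]) auto
    moreover have "n powr (real i * \<theta>) * n powr \<theta> \<le> real (card (U i)) * n powr \<theta>"
      using Suc by (intro mult_right_mono) auto
    ultimately show ?case by (simp add: algebra_simps powr_add)
  qed
  then have "n powr (real r * \<theta>) \<le> real (card (U r))" by simp
  also have "\<dots> \<le> n" using card_mono[OF fV U(2)] n by (meson dual_order.trans of_nat_mono)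
  finally have "n powr (real r * \<theta>) \<le> n powr 1" using n by simp
  then have "real r * \<theta> \<le> 1" by (simp only: powr_le_cancel_iff[OF n(2)])
  then show False using r by simp
qed

section \<open>Breadth-first levels\<close>

lemma cycle_of_list:
  assumes xs: "distinct xs" "length xs = k" "set xs \<subseteq> V" "successively (\<lambda>u v. {u, v} \<in> E) xs"
    and cl: "{last xs, hd xs} \<in> E" and k: "2 < k"
  shows "contains (V, E) (cycle k)"
proof -
  let ?f = "\<lambda>i. xs ! i"
  have "inj_on ?f {0..<k}" using xs by (auto simp: inj_on_def nth_eq_iff_index_eq)
  moreover have "?f ` {0..<k} \<subseteq> V" using xs by auto
  moreover have "?f ` {i, (i + 1) mod k} \<in> E" if "i < k" for i
  proof (cases "i + 1 = k")
    case True
    have "xs \<noteq> []" using xs k by auto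
    then have "last xs = xs ! i" "hd xs = xs ! 0" using True xs by (auto simp: last_conv_nth hd_conv_nth)
    then show ?thesis using True cl by auto
  next
    case False
    then have "i + 1 < k" using that by simp
    then show ?thesis using xs(2,4) by (auto simp: successively_conv_nth)
  qed
  ultimately show ?thesis
    unfolding contains_def cycle_def verts_def edges_def by (intro exI[of _ ?f]) auto
qed

text \<open>The graph may be disconnected, so every component is searched from its least vertex.
  Adjacent vertices then share a root, and on a common level their tree paths are bound to
  meet.\<close>

lemma levels_exist:
  fixes E :: "nat set set"
  shows "\<exists>(l :: nat \<Rightarrow> nat) par rt. (\<forall>u v. {u, v} \<in> E \<longrightarrow> rt u = (rt v :: nat) \<and> l u \<le> Suc (l v)) \<and>
    (\<forall>v. 0 < l v \<longrightarrow> {par v, v} \<in> E \<and> Suc (l (par v)) = l v) \<and> (\<forall>v. l v = 0 \<longrightarrow> v = rt v)"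
proof -
  define R where "R = {(u, v). {u, v} \<in> E}"
  define rt where "rt v = (LEAST u. (u, v) \<in> R\<^sup>*)" for v
  define l where "l v = (LEAST m. (rt v, v) \<in> R ^^ m)" for v
  have rt: "(rt v, v) \<in> R\<^sup>*" for v unfolding rt_def by (rule LeastI[of _ v]) simp
  have lv: "(rt v, v) \<in> R ^^ l v" for v
    unfolding l_def by (rule LeastI_ex) (use rt rtrancl_imp_relpow in blast)
  have lmin: "l v \<le> m" if "(rt v, v) \<in> R ^^ m" for v m
    unfolding l_def by (rule Least_le) (rule that)
  have rteq: "rt u = rt v" if "{u, v} \<in> E" for u v
  proof -
    have "(u, v) \<in> R" "(v, u) \<in> R" using that by (auto simp: R_def insert_commute)
    then have "(\<lambda>w. (w, u) \<in> R\<^sup>*) = (\<lambda>w. (w, v) \<in> R\<^sup>*)" by (meson rtrancl.rtrancl_into_rtrancl)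
    then show ?thesis by (simp add: rt_def)
  qed
  have lE: "l u \<le> Suc (l v)" if "{u, v} \<in> E" for u v
  proof -
    have "(v, u) \<in> R" using that by (auto simp: R_def insert_commute)
    then have "(rt v, u) \<in> R ^^ Suc (l v)" using lv[of v] by auto
    then show ?thesis using lmin rteq[OF that] by simp
  qed
  have "\<exists>p. {p, v} \<in> E \<and> Suc (l p) = l v" if pos: "0 < l v" for v
  proof -
    obtain m where m: "l v = Suc m" using pos gr0_implies_Suc by blast
    then obtain p where p: "(rt v, p) \<in> R ^^ m" "(p, v) \<in> R" using lv[of v] by auto
    then have pv: "{p, v} \<in> E" by (simp add: R_def)
    then have "l p \<le> m" using lmin[of p m] p rteq by simp
    moreover have "l v \<le> Suc (l p)" using lE[of v p] pv by (simp add: insert_commute)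
    ultimately show ?thesis using pv m by auto
  qed
  then obtain par where "\<forall>v. 0 < l v \<longrightarrow> {par v, v} \<in> E \<and> Suc (l (par v)) = l v" by metis
  moreover have "v = rt v" if "l v = 0" for v using lv[of v] that by simp
  ultimately show ?thesis using rteq lE by blast
qed

fun ball_at :: "nat set set \<Rightarrow> nat \<Rightarrow> nat \<Rightarrow> nat set" where
  "ball_at E w 0 = {w}"
| "ball_at E w (Suc i) = ball_at E w i \<union> (\<Union>v\<in>ball_at E w i. nbrs E v)"

lemma ball_at_subset: "is_graph (V, E) \<Longrightarrow> w \<in> V \<Longrightarrow> ball_at E w i \<subseteq> V"
proof (induction i)
  case (Suc i)
  have "nbrs E v \<subseteq> V" for v using nbrs_subset[OF Suc.prems(1)] .
  then show ?case using Suc by auto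
qed simp

text \<open>A vertex of level \<open>M * (2 * r + 1)\<close> or more would have ancestors or itself
  on \<open>M + 1\<close> levels spaced \<open>2 * r + 1\<close> apart. Since a step changes the
  level by at most one, their balls of radius \<open>r\<close> are disjoint, and together they would
  not fit into \<open>V\<close>.\<close>

lemma level_bound:
  fixes l :: "nat \<Rightarrow> nat" and b :: real
  assumes G: "is_graph (V, E)"
    and lE: "\<And>u v. {u, v} \<in> E \<Longrightarrow> l u \<le> Suc (l v)"
    and par: "\<And>v. 0 < l v \<Longrightarrow> {par v, v} \<in> E \<and> Suc (l (par v)) = l v"
    and ball: "\<And>w. w \<in> V \<Longrightarrow> b \<le> real (card (ball_at E w r))"
    and M: "real (card V) < real (Suc M) * b" and v: "v \<in> V"
  shows "l v < M * (2 * r + 1)"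
proof (rule ccontr)
  assume neg: "\<not> l v < M * (2 * r + 1)"
  have desc: "\<exists>w\<in>V. l w = m" if "m \<le> l v" for m
    using that
  proof (induction rule: inc_induct)
    case base
    then show ?case using v by blast
  next
    case (step m)
    then obtain w where w: "w \<in> V" "l w = Suc m" by blast
    then have "{par w, w} \<in> E" "Suc (l (par w)) = l w" using par[of w] by auto
    then show ?case using w is_graph_edgeD(1)[OF G] by (intro bexI[of _ "par w"]) auto
  qed
  have "\<forall>j\<in>{..M}. \<exists>w\<in>V. l w = j * (2 * r + 1)"
  proof
    fix j assume "j \<in> {..M}"
    then have "j * (2 * r + 1) \<le> M * (2 * r + 1)" by (intro mult_right_mono) auto
    then show "\<exists>w\<in>V. l w = j * (2 * r + 1)" using neg desc by simp
  qed
  then obtain w where w: "\<And>j. j \<le> M \<Longrightarrow> w j \<in> V \<and> l (w j) = j * (2 * r + 1)"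
    by (metis atMost_iff)
  have near: "l w \<le> l x + i \<and> l x \<le> l w + i" if "x \<in> ball_at E w i" for x w i
    using that
  proof (induction i arbitrary: x)
    case (Suc i)
    show ?case
    proof (cases "x \<in> ball_at E w i")
      case True
      then show ?thesis using Suc.IH[OF True] by linarith
    next
      case False
      then obtain y where y: "y \<in> ball_at E w i" "{y, x} \<in> E" using Suc.prems by (auto simp: nbrs_def)
      then have "l y \<le> Suc (l x)" "l x \<le> Suc (l y)" using lE[of y x] lE[of x y] by (auto simp: insert_commute)
      then show ?thesis using Suc.IH[OF y(1)] by linarith
    qed
  qed simp
  have disj: "ball_at E (w i) r \<inter> ball_at E (w j) r = {}" if "i < j" "j \<le> M" for i j
  proof (rule ccontr)
    assume "ball_at E (w i) r \<inter> ball_at E (w j) r \<noteq> {}"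
    then obtain x where x: "x \<in> ball_at E (w i) r" "x \<in> ball_at E (w j) r" by blast
    then have "l x \<le> i * (2 * r + 1) + r" "j * (2 * r + 1) \<le> l x + r"
      using near[OF x(1)] near[OF x(2)] w that by auto
    moreover have "Suc i * (2 * r + 1) \<le> j * (2 * r + 1)" using that by (intro mult_right_mono) auto
    ultimately show False by simp
  qed
  have fV: "finite V" using G by (simp add: is_graph_iff)
  have fb: "finite (ball_at E (w j) r)" if "j \<le> M" for j
    using ball_at_subset[OF G] w[OF that] fV finite_subset by blast
  have "real (Suc M) * b = (\<Sum>j\<le>M. b)" by simp
  also have "\<dots> \<le> (\<Sum>j\<le>M. real (card (ball_at E (w j) r)))" using ball w by (intro sum_mono) auto
  also have "\<dots> = real (card (\<Union>j\<le>M. ball_at E (w j) r))"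
  proof -
    have "\<forall>i\<in>{..M}. \<forall>j\<in>{..M}. i \<noteq> j \<longrightarrow> ball_at E (w i) r \<inter> ball_at E (w j) r = {}"
      using disj by (metis Int_commute atMost_iff nat_neq_iff)
    then show ?thesis using fb by (subst card_UN_disjoint) auto
  qed
  also have "\<dots> \<le> real (card V)"
    using ball_at_subset[OF G] w fV by (intro of_nat_mono card_mono) blast+
  finally show False using M by linarith
qed

section \<open>Edges inside a level\<close>

lemma successively_const:
  "successively (\<lambda>u v. f u = f v) xs \<Longrightarrow> x \<in> set xs \<Longrightarrow> f x = f (hd xs)"
  by (induction xs rule: induct_list012) auto

lemma successively_alternate:
  "successively (\<lambda>u v. g u \<noteq> (g v :: bool)) xs \<Longrightarrow> xs \<noteq> [] \<Longrightarrow> g (last xs) = g (hd xs) \<longleftrightarrow> odd (length xs)"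
  by (induction xs rule: induct_list012) auto

text \<open>The tree paths of \<open>u\<close> and \<open>v\<close> first meet after exactly \<open>i + 1\<close> steps.\<close>

definition siblings :: "(nat \<Rightarrow> nat) \<Rightarrow> (nat \<Rightarrow> nat) \<Rightarrow> nat \<Rightarrow> nat \<Rightarrow> nat \<Rightarrow> bool" where
  "siblings l par i u v \<longleftrightarrow> l u = l v \<and> i < l u \<and>
     (par ^^ i) u \<noteq> (par ^^ i) v \<and> (par ^^ Suc i) u = (par ^^ Suc i) v"

lemma siblings_commute: "siblings l par i u v = siblings l par i v u"
  unfolding siblings_def by metis

text \<open>Cut the edges according to the \<open>i\<close>-th ancestors of their ends. A path of odd length \<open>t\<close> along
  cut edges stays below one common ancestor and has its ends on different sides of the cut, so the
  two tree paths close it to a cycle of length \<open>t + 2 (i + 1)\<close>.\<close>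

lemma inner_edges_at_height:
  fixes l :: "nat \<Rightarrow> nat"
  assumes G: "is_graph (V, E)"
    and par: "\<And>v. 0 < l v \<Longrightarrow> {par v, v} \<in> E \<and> Suc (l (par v)) = l v"
    and k: "t + 2 * Suc i = k" "odd t" and free: "\<not> contains (V, E) (cycle k)"
  shows "card {e \<in> E. \<exists>u v. e = {u, v} \<and> siblings l par i u v} \<le> 2 * t * card V"
    (is "card ?E \<le> _")
proof (rule ccontr)
  assume neg: "\<not> card ?E \<le> 2 * t * card V"
  have gE: "is_graph (V, ?E)" by (rule is_graph_subset[OF G]) simp
  have sym: "siblings l par i u v" if "{u, v} \<in> ?E" for u v
  proof -
    from that obtain u' v' where "{u, v} = {u', v'}" "siblings l par i u' v'" by blast
    then show ?thesis using siblings_commute by (metis doubleton_eq_iff)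
  qed
  have "(par ^^ i) u \<noteq> (par ^^ i) v" if "{u, v} \<in> ?E" for u v
    using sym[OF that] by (simp add: siblings_def)
  then have "\<exists>Z. card ?E \<le> 2 * card {e \<in> ?E. \<exists>u v. e = {u, v} \<and> (par ^^ i) u \<in> Z \<and> (par ^^ i) v \<notin> Z}"
    by (rule max_cut[OF gE])
  then obtain Z where Z: "card ?E \<le> 2 * card {e \<in> ?E. \<exists>u v. e = {u, v} \<and> (par ^^ i) u \<in> Z \<and> (par ^^ i) v \<notin> Z}"
    (is "_ \<le> 2 * card ?E'")
    by (rule exE)
  have "is_graph (V, ?E')" by (rule is_graph_subset[OF G]) simp
  moreover have "t * card V < card ?E'" using neg Z by linarith
  ultimately obtain xs where xs: "distinct xs" "length xs = Suc t" "set xs \<subseteq> V"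
    and su: "successively (\<lambda>u v. {u, v} \<in> ?E') xs" using path_exists by blast
  have ne: "xs \<noteq> []" using xs by auto
  have step: "{u, v} \<in> E \<and> siblings l par i u v \<and> ((par ^^ i) u \<in> Z) \<noteq> ((par ^^ i) v \<in> Z)"
    if "{u, v} \<in> ?E'" for u v
  proof -
    from that obtain u' v' where *: "{u, v} = {u', v'}" "(par ^^ i) u' \<in> Z" "(par ^^ i) v' \<notin> Z" by blast
    have "{u, v} \<in> ?E" using that by simp
    then have "{u, v} \<in> E" "siblings l par i u v" using sym[of u v] by simp_all
    moreover have "u = u' \<and> v = v' \<or> u = v' \<and> v = u'" using *(1) by (simp add: doubleton_eq_iff)
    ultimately show ?thesis using *(2,3) by metis
  qed
  have "successively (\<lambda>u v. {u, v} \<in> E) xs" by (rule successively_mono[OF su]) (drule step, simp)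
  moreover have "successively (\<lambda>u v. l u = l v) xs"
    by (rule successively_mono[OF su]) (drule step, simp add: siblings_def)
  moreover have "successively (\<lambda>u v. (par ^^ Suc i) u = (par ^^ Suc i) v) xs"
    by (rule successively_mono[OF su]) (drule step, simp add: siblings_def)
  moreover have "successively (\<lambda>u v. i < l u) xs"
    by (rule successively_mono[OF su]) (drule step, simp add: siblings_def)
  moreover have "successively (\<lambda>u v. ((par ^^ i) u \<in> Z) \<noteq> ((par ^^ i) v \<in> Z)) xs"
    by (rule successively_mono[OF su]) (drule step, simp)
  note s = calculation this
  define a b where "a = hd xs" and "b = last xs"
  have lev: "l x = l a" if "x \<in> set xs" for x
    unfolding a_def by (rule successively_const[OF s(2) that])
  \<comment> \<open>Since \<open>t\<close> is odd, the path has at least one edge, and the bound is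
    read off at its first vertex.\<close>
  have la: "i < l a"
  proof -
    obtain m where "t = Suc m" using odd_pos[OF k(2)] gr0_implies_Suc by blast
    then obtain y z ys where "xs = y # z # ys" using xs(2) by (metis Suc_length_conv)
    then show ?thesis using s(4) by (simp add: a_def)
  qed
  have lb: "l b = l a" using lev ne by (simp add: b_def)
  have pab: "(par ^^ Suc i) b = (par ^^ Suc i) a"
    using successively_const[OF s(3), of b] ne by (simp add: a_def b_def)
  have nab: "(par ^^ i) b \<noteq> (par ^^ i) a"
    using successively_alternate[OF s(5) ne] xs(2) k(2) unfolding a_def b_def by auto
  have lp: "l ((par ^^ j) x) = l x - j" if "j \<le> l x" for x j using that
  proof (induction j)
    case (Suc j)
    then show ?case using par[of "(par ^^ j) x"] by auto
  qed simp
  have adj: "{(par ^^ Suc j) x, (par ^^ j) x} \<in> E" if "j < l x" for x j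
    using par[of "(par ^^ j) x"] lp[of j x] that by auto
  have inV: "(par ^^ Suc j) x \<in> V" if "j < l x" for x j
    using adj[OF that] is_graph_edgeD(1)[OF G] by blast
  \<comment> \<open>\<open>?cb\<close> climbs from the parent of \<open>b\<close> to the common
    ancestor at height \<open>i + 1\<close>; \<open>?ca\<close> descends from the
    \<open>i\<close>-th ancestor of \<open>a\<close> to its parent and is empty for
    \<open>i = 0\<close>. The lengths \<open>t + 1\<close>, \<open>i + 1\<close> and
    \<open>i\<close> add up to \<open>k\<close>.\<close>
  let ?cb = "map (\<lambda>j. (par ^^ j) b) [1..<Suc (Suc i)]" and ?ca = "rev (map (\<lambda>j. (par ^^ j) a) [1..<Suc i])"
  let ?c = "xs @ ?cb @ ?ca"
  have chain: "successively (\<lambda>u v. {u, v} \<in> E) (map (\<lambda>j. (par ^^ j) x) [1..<m])" if "m \<le> Suc (l x)" for x m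
  proof -
    have "{(par ^^ Suc j) x, (par ^^ Suc (Suc j)) x} \<in> E" if "Suc j < m - 1" for j
      using adj[of "Suc j" x] that \<open>m \<le> Suc (l x)\<close> by (simp add: insert_commute)
    then show ?thesis unfolding successively_conv_nth by simp
  qed
  have inj: "inj_on (\<lambda>j. (par ^^ j) x) {1..<m}" if "m \<le> Suc (l x)" for x m
  proof (rule inj_onI)
    fix j j' assume *: "j \<in> {1..<m}" "j' \<in> {1..<m}" "(par ^^ j) x = (par ^^ j') x"
    then have "l x - j = l x - j'" using lp[of j x] lp[of j' x] that by auto
    then show "j = j'" using * that by auto
  qed
  \<comment> \<open>Equal vertices lie on equal levels, so \<open>j = j'\<close>; then the
    \<open>i\<close>-th ancestors of \<open>a\<close> and \<open>b\<close> would agree, although a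
    path of odd length ends on opposite sides of \<open>Z\<close>.\<close>
  have ne_chain: "(par ^^ j) a \<noteq> (par ^^ j') b" if "j \<le> i" "j' \<le> Suc i" for j j'
  proof
    assume eq: "(par ^^ j) a = (par ^^ j') b"
    then have "l a - j = l a - j'" using lp[of j a] lp[of j' b] that la lb by auto
    then have "j = j'" using that la by auto
    then have "(par ^^ (i - j)) ((par ^^ j) a) = (par ^^ (i - j)) ((par ^^ j) b)" using eq by simp
    moreover have "(par ^^ (i - j)) ((par ^^ j) x) = (par ^^ i) x" for x
      using funpow_add[of "i - j" j par] that by simp
    ultimately show False using nab by simp
  qed
  \<comment> \<open>All of \<open>xs\<close> lies on one level, and proper ancestors lie on lower
    ones.\<close>
  have low: "(par ^^ j) x \<notin> set xs" if "1 \<le> j" "j \<le> Suc i" "l x = l a" for j x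
  proof
    assume "(par ^^ j) x \<in> set xs"
    then have "l ((par ^^ j) x) = l a" using lev by blast
    then show False using lp[of j x] that la by auto
  qed
  have "distinct ?c"
    using xs(1) inj[of "Suc (Suc i)" b] inj[of "Suc i" a] la lb ne_chain low
    by (auto simp: distinct_map simp del: upt_Suc) (metis less_Suc_eq_le less_imp_le_nat)+
  moreover have "length ?c = k" using xs k by simp
  moreover have "set ?c \<subseteq> V"
  proof -
    have "(par ^^ j) x \<in> V" if "1 \<le> j" "j \<le> Suc i" "l x = l a" for j x
      using inV[of "j - 1" x] that la by auto
    then show ?thesis using xs(3) lb by (auto simp del: upt_Suc)
  qed
  moreover have "successively (\<lambda>u v. {u, v} \<in> E) ?c"
  proof -
    have sb: "successively (\<lambda>u v. {u, v} \<in> E) ?cb" by (rule chain) (use la lb in auto)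
    have sa: "successively (\<lambda>u v. {u, v} \<in> E) ?ca"
      using chain[of "Suc i" a] la by (simp add: successively_rev insert_commute del: upt_Suc)
    have "{last xs, hd ?cb} \<in> E" using adj[of 0 b] la lb by (simp add: b_def hd_map insert_commute del: upt_Suc)
    moreover have "{last ?cb, hd ?ca} \<in> E" if "?ca \<noteq> []"
    proof -
      have "last ?cb = (par ^^ Suc i) a" using pab by simp
      moreover have "hd ?ca = (par ^^ i) a" using that by (cases "Suc 0 \<le> i") (auto simp: hd_rev)
      ultimately show ?thesis using adj[of i a] la by simp
    qed
    ultimately show ?thesis using s(1) sa sb by (auto simp: successively_append_iff simp del: upt_Suc)
  qed
  moreover have "{last ?c, hd ?c} \<in> E"
  proof -
    have "last ?c = (par ^^ 1) a"
    proof (cases i)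
      case 0
      then show ?thesis using pab by simp
    next
      case (Suc j)
      then have "?ca \<noteq> []" by simp
      then have "last ?c = last ?ca" by simp
      also have "\<dots> = hd (map (\<lambda>j. (par ^^ j) a) [1..<Suc i])" by (simp only: last_rev)
      also have "\<dots> = (par ^^ 1) a" using Suc by (simp add: hd_map del: upt_Suc)
      finally show ?thesis .
    qed
    moreover have "hd ?c = a" using ne by (simp add: a_def)
    ultimately show ?thesis using adj[of 0 a] la by simp
  qed
  moreover have "2 < k" using k odd_pos[OF k(2)] by simp
  ultimately show False using cycle_of_list[of ?c k V E] free by blast
qed

text \<open>The ends of an edge inside a level share a root, so their tree paths first meet at some
  height \<open>i + 1\<close> with \<open>i < D\<close>. These edges thus fall into \<open>D\<close>
  classes of at most \<open>2 * k * card V\<close> edges each; \<open>2 * D < k\<close> keeps the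
  path length \<open>k - 2 * (i + 1)\<close> positive in every class.\<close>

lemma near_bipartite:
  fixes l :: "nat \<Rightarrow> nat"
  assumes G: "is_graph (V, E)"
    and lE: "\<And>u v. {u, v} \<in> E \<Longrightarrow> rt u = (rt v :: nat) \<and> l u \<le> Suc (l v)"
    and par: "\<And>v. 0 < l v \<Longrightarrow> {par v, v} \<in> E \<and> Suc (l (par v)) = l v"
    and root: "\<And>v. l v = 0 \<Longrightarrow> v = rt v"
    and D: "\<And>v. v \<in> V \<Longrightarrow> l v < D" and k: "odd k" "2 * D < k"
    and free: "\<not> contains (V, E) (cycle k)"
  shows "\<exists>X\<subseteq>V. card E \<le> card (btw E X (V - X)) + 2 * D * k * card V"
proof -
  let ?X = "{v \<in> V. even (l v)}"
  let ?H = "\<lambda>i. {e \<in> E. \<exists>u v. e = {u, v} \<and> siblings l par i u v}"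
  have fE: "finite E" using G by (rule is_graph_finite_edges)
  have sub: "E \<subseteq> btw E ?X (V - ?X) \<union> (\<Union>i<D. ?H i)"
  proof
    fix e assume e: "e \<in> E"
    obtain u v where uv: "e = {u, v}" "u \<noteq> v" "u \<in> V" "v \<in> V" using is_graph_edgeE[OF G e] by blast
    show "e \<in> btw E ?X (V - ?X) \<union> (\<Union>i<D. ?H i)"
    proof (cases "l u = l v")
      case False
      moreover have "l u \<le> Suc (l v)" "l v \<le> Suc (l u)" using lE[of u v] lE[of v u] e uv by (auto simp: insert_commute)
      ultimately have "l u = Suc (l v) \<or> l v = Suc (l u)" by linarith
      then have "even (l u) \<noteq> even (l v)" by auto
      then show ?thesis using uv e unfolding btw_def by (cases "even (l u)") (auto simp: doubleton_eq_iff)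
    next
      case True
      have anc: "(par ^^ l w) w = rt w" for w
      proof (induction "l w" arbitrary: w)
        case 0
        then show ?case using root[of w] by simp
      next
        case (Suc m)
        then have p: "{par w, w} \<in> E" "Suc (l (par w)) = l w" using par[of w] by auto
        then have "(par ^^ l (par w)) (par w) = rt (par w)" using Suc by auto
        then show ?case using p lE[of "par w" w] by (metis comp_apply funpow_Suc_right)
      qed
      have eq: "(par ^^ l u) u = (par ^^ l u) v" using anc[of u] anc[of v] True lE[of u v] e uv by simp
      define m where "m = (LEAST m. (par ^^ m) u = (par ^^ m) v)"
      have m1: "(par ^^ m) u = (par ^^ m) v" unfolding m_def by (rule LeastI[of "\<lambda>m. (par ^^ m) u = (par ^^ m) v", OF eq])
      have m2: "m \<le> l u" unfolding m_def by (rule Least_le) (rule eq)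
      have "m \<noteq> 0" using m1 uv by (cases m) auto
      then obtain i where i: "m = Suc i" using not0_implies_Suc by blast
      have "(par ^^ i) u \<noteq> (par ^^ i) v"
        using not_less_Least[of i "\<lambda>m. (par ^^ m) u = (par ^^ m) v"] i unfolding m_def by simp
      then have "siblings l par i u v" using True m1 m2 i by (simp add: siblings_def)
      then have "e \<in> ?H i" using e uv(1) by blast
      moreover have "i \<in> {..<D}" using m2 i D[OF uv(3)] by simp
      ultimately have "e \<in> (\<Union>i<D. ?H i)" by (rule UN_I[rotated])
      then show ?thesis by (rule UnI2)
    qed
  qed
  have H: "card (?H i) \<le> 2 * k * card V" if "i < D" for i
  proof -
    have "card (?H i) \<le> 2 * (k - 2 * Suc i) * card V"
      by (rule inner_edges_at_height[OF G par _ _ free]) (use that k in auto)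
    also have "\<dots> \<le> 2 * k * card V" by (intro mult_right_mono) auto
    finally show ?thesis .
  qed
  have "card E \<le> card (btw E ?X (V - ?X) \<union> (\<Union>i<D. ?H i))"
    using sub fE by (intro card_mono) (auto simp: btw_def)
  also have "\<dots> \<le> card (btw E ?X (V - ?X)) + card (\<Union>i<D. ?H i)" by (rule card_Un_le)
  also have "card (\<Union>i<D. ?H i) \<le> (\<Sum>i<D. card (?H i))" by (rule card_UN_le) simp
  also have "(\<Sum>i<D. card (?H i)) \<le> (\<Sum>i<D. 2 * k * card V)" using H by (intro sum_mono) auto
  also have "\<dots> = 2 * D * k * card V" by simp
  finally show ?thesis by (intro exI[of _ ?X]) auto
qed

section \<open>Density between the two sides\<close>

text \<open>The weighted arithmetic-geometric mean inequality for \<open>1 - u\<close> and 1 with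
  weights \<gamma> and \<open>1 - \<gamma>\<close>.\<close>

lemma bernoulli_powr_le:
  fixes u \<gamma> :: real
  assumes "0 \<le> u" "u < 1" "0 \<le> \<gamma>" "\<gamma> \<le> 1"
  shows "(1 - u) powr \<gamma> \<le> 1 - \<gamma> * u"
  using Youngs_inequality_0[of \<gamma> "1 - \<gamma>" "1 - u" 1] assms by (simp add: algebra_simps)

text \<open>With mean \<open>m\<close> the parts are \<open>m * (1 - u)\<close> and
  \<open>m * (1 + u)\<close>, and \<open>(1 - u) * (1 + u) powr \<gamma> \<le> (1 - u) * (1 + u)
  \<le> 1\<close>. Hence the balanced bipartition maximises the main term.\<close>

lemma mult_powr_le_half_powr:
  fixes a b \<gamma> :: real
  assumes ab: "0 \<le> a" "a \<le> b" and \<gamma>: "0 \<le> \<gamma>" "\<gamma> \<le> 1"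
  shows "a * b powr \<gamma> \<le> ((a + b) / 2) powr (1 + \<gamma>)"
proof (cases "a = 0")
  case False
  define m where "m = (a + b) / 2"
  have m: "0 < m" "a \<le> m" "m \<le> b" using ab False by (auto simp: m_def)
  define u where "u = b / m - 1"
  have u: "0 \<le> u" using m by (simp add: u_def)
  have b: "b = m * (1 + u)" and a: "a = m * (1 - u)"
    using m by (auto simp: u_def algebra_simps) (auto simp: m_def field_simps)
  have u1: "u < 1"
  proof -
    have "0 < a" using ab False by simp
    then have "0 < m * (1 - u)" by (simp only: a)
    then show ?thesis using m by (simp add: zero_less_mult_iff)
  qed
  have "(1 + u) powr \<gamma> \<le> (1 + u) powr 1" using u \<gamma> by (intro powr_mono) auto
  then have "(1 - u) * (1 + u) powr \<gamma> \<le> (1 - u) * (1 + u)" using u u1 by (intro mult_left_mono) auto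
  also have "\<dots> \<le> 1" by (simp add: algebra_simps)
  finally have "m powr (1 + \<gamma>) * ((1 - u) * (1 + u) powr \<gamma>) \<le> m powr (1 + \<gamma>)"
    by (simp add: mult_left_le)
  moreover have "a * b powr \<gamma> = m powr (1 + \<gamma>) * ((1 - u) * (1 + u) powr \<gamma>)"
    using m u by (simp add: a b powr_mult powr_add)
  ultimately show ?thesis by (simp add: m_def)
qed simp

text \<open>The edges run from \<open>X - S\<close> to \<open>Y\<close> or from \<open>S\<close> to
  \<open>Y - T\<close>. Shrinking the second target by \<open>z\<close> lowers the \<gamma>-th power
  of its size by at least \<open>\<gamma> * z * n powr (\<gamma> - 1)\<close>, and this loss is
  multiplied by the \<open>z\<close> vertices of \<open>S\<close>; each piece brings one error term.
  By \<open>2 * z \<le> card Y\<close> the set \<open>S\<close> is not larger than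
  \<open>Y - T\<close>.\<close>

lemma btw_without_edge:
  fixes n :: real
  assumes G: "is_graph (V, E)" and sp: "sparse \<rho> C \<gamma> \<beta> V E"
    and c: "0 \<le> \<rho>" "0 \<le> C" "0 \<le> \<gamma>" "\<gamma> \<le> 1" "0 \<le> \<beta>"
    and XY: "X \<subseteq> V" "Y \<subseteq> V" "X \<inter> Y = {}" "card X \<le> card Y" and n: "real (card V) \<le> n"
    and ST: "S \<subseteq> X" "T \<subseteq> Y" "card S = z" "card T = z" "0 < z" "2 * z \<le> card Y"
    and no: "\<And>x y. x \<in> S \<Longrightarrow> y \<in> T \<Longrightarrow> {x, y} \<notin> E"
  shows "real (card (btw E X Y)) \<le> \<rho> * (real (card X + card Y) / 2) powr (1 + \<gamma>)
     - \<rho> * \<gamma> * (real z)\<^sup>2 * n powr (\<gamma> - 1) + 2 * C * n powr \<beta>"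
proof -
  let ?a = "real (card X)" and ?b = "real (card Y)" and ?z = "real z"
  have fin: "finite X" "finite Y" using G XY finite_subset by (auto simp: is_graph_iff)
  then have finST: "finite S" "finite T" using ST finite_subset by blast+
  have bn: "?b \<le> n" using n G XY card_mono[of V Y] by (simp add: is_graph_iff)
  have za: "z \<le> card X" using card_mono[OF fin(1) ST(1)] ST by simp
  have z: "0 < ?z" "2 * ?z \<le> ?b" using ST by linarith+
  have cXS: "real (card (X - S)) = ?a - ?z" using card_Diff_subset[OF finST(1) ST(1)] ST za by simp
  have cYT: "real (card (Y - T)) = ?b - ?z" using card_Diff_subset[OF finST(2) ST(2)] ST by simp
  have mon: "?b powr \<beta> \<le> n powr \<beta>" using bn c by (intro powr_mono2) auto
  have 1: "real (card (btw E (X - S) Y)) \<le> \<rho> * (?a - ?z) * ?b powr \<gamma> + C * ?b powr \<beta>"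
    using XY z by (intro sparse_le[OF G sp c]) (auto simp: cXS)
  have "real (card (btw E S (Y - T))) \<le> \<rho> * ?z * (?b - ?z) powr \<gamma> + C * (?b - ?z) powr \<beta>"
    using XY ST z by (intro sparse_le[OF G sp c]) (auto simp: cYT)
  also have "C * (?b - ?z) powr \<beta> \<le> C * ?b powr \<beta>"
    using z c by (intro mult_left_mono powr_mono2) auto
  finally have 2: "real (card (btw E S (Y - T))) \<le> \<rho> * ?z * (?b - ?z) powr \<gamma> + C * ?b powr \<beta>" by simp
  have sub: "btw E X Y \<subseteq> btw E (X - S) Y \<union> btw E S (Y - T)"
    using no unfolding btw_def by blast
  have "card (btw E X Y) \<le> card (btw E (X - S) Y \<union> btw E S (Y - T))"
    by (rule card_mono[OF _ sub]) (simp add: finite_btw[OF G])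
  also have "\<dots> \<le> card (btw E (X - S) Y) + card (btw E S (Y - T))" by (rule card_Un_le)
  finally have 3: "real (card (btw E X Y)) \<le> real (card (btw E (X - S) Y)) + real (card (btw E S (Y - T)))"
    by linarith
  have "(?b - ?z) powr \<gamma> \<le> ?b powr \<gamma> - \<gamma> * ?z * n powr (\<gamma> - 1)"
  proof -
    have "?b - ?z = ?b * (1 - ?z / ?b)" using z by (simp add: right_diff_distrib)
    then have "(?b - ?z) powr \<gamma> = (?b * (1 - ?z / ?b)) powr \<gamma>" by simp
    also have "\<dots> = ?b powr \<gamma> * (1 - ?z / ?b) powr \<gamma>" by (rule powr_mult)
    also have "\<dots> \<le> ?b powr \<gamma> * (1 - \<gamma> * (?z / ?b))"
      using z c by (intro mult_left_mono bernoulli_powr_le) auto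
    also have "\<dots> = ?b powr \<gamma> - \<gamma> * ?z * ?b powr (\<gamma> - 1)"
      using z by (simp add: powr_diff algebra_simps)
    also have "\<dots> \<le> ?b powr \<gamma> - \<gamma> * ?z * n powr (\<gamma> - 1)"
    proof -
      have "n powr (\<gamma> - 1) \<le> ?b powr (\<gamma> - 1)" using c z bn by (intro powr_mono2') auto
      then show ?thesis using c z by (intro diff_left_mono mult_left_mono) auto
    qed
    finally show ?thesis .
  qed
  then have "\<rho> * ?z * (?b - ?z) powr \<gamma> \<le> \<rho> * ?z * (?b powr \<gamma> - \<gamma> * ?z * n powr (\<gamma> - 1))"
    using c z by (intro mult_left_mono) auto
  also have "\<dots> = \<rho> * ?z * ?b powr \<gamma> - \<rho> * \<gamma> * ?z\<^sup>2 * n powr (\<gamma> - 1)"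
    by (simp add: algebra_simps power2_eq_square)
  finally have 4: "\<rho> * ?z * (?b - ?z) powr \<gamma> \<le> \<rho> * ?z * ?b powr \<gamma> - \<rho> * \<gamma> * ?z\<^sup>2 * n powr (\<gamma> - 1)" .
  have "?a * ?b powr \<gamma> \<le> ((?a + ?b) / 2) powr (1 + \<gamma>)"
    using XY c by (intro mult_powr_le_half_powr) auto
  then have 5: "\<rho> * (?a * ?b powr \<gamma>) \<le> \<rho> * (real (card X + card Y) / 2) powr (1 + \<gamma>)"
    using c by (intro mult_left_mono) auto
  have 6: "C * ?b powr \<beta> \<le> C * n powr \<beta>" using mon c by (intro mult_left_mono) auto
  have 7: "\<rho> * (?a - ?z) * ?b powr \<gamma> + \<rho> * ?z * ?b powr \<gamma> = \<rho> * (?a * ?b powr \<gamma>)"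
    by (simp add: algebra_simps)
  show ?thesis using 1 2 3 4 5 6 7 by simp
qed

section \<open>Closing odd cycles through layers\<close>

lemma layered_path:
  assumes "\<And>j v. j < m \<Longrightarrow> v \<in> K (Suc j) \<Longrightarrow> \<exists>u\<in>K j. {u, v} \<in> E"
  shows "v \<in> K m \<Longrightarrow> \<exists>xs. length xs = Suc m \<and> (\<forall>j\<le>m. xs ! j \<in> K j) \<and> last xs = v \<and>
    successively (\<lambda>u v. {u, v} \<in> E) xs"
  using assms
proof (induction m arbitrary: v)
  case 0
  then show ?case by (intro exI[of _ "[v]"]) auto
next
  case (Suc m)
  obtain u where u: "u \<in> K m" "{u, v} \<in> E" using Suc.prems(2)[of m v] Suc.prems(1) by auto
  obtain xs where xs: "length xs = Suc m" "\<forall>j\<le>m. xs ! j \<in> K j" "last xs = u"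
    "successively (\<lambda>u v. {u, v} \<in> E) xs"
    using Suc.IH[OF u(1)] Suc.prems(2) by (metis less_SucI)
  have ne: "xs \<noteq> []" using xs(1) by auto
  have nth: "(xs @ [v]) ! j \<in> K j" if "j \<le> Suc m" for j
    using that xs(1,2) Suc.prems(1) by (cases "j = Suc m") (auto simp: nth_append)
  have "successively (\<lambda>u v. {u, v} \<in> E) (xs @ [v])"
    using xs u ne by (simp add: successively_append_iff)
  then show ?case using xs(1) nth by (intro exI[of _ "xs @ [v]"]) auto
qed

lemma layered_path_distinct:
  assumes "length xs = Suc m" "\<forall>j\<le>m. xs ! j \<in> K j"
    and "\<And>i j. i < j \<Longrightarrow> j \<le> m \<Longrightarrow> K i \<inter> K j = {}"
  shows "distinct xs"
  unfolding distinct_conv_nth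
proof (intro allI impI)
  fix i j assume ij: "i < length xs" "j < length xs" "i \<noteq> j"
  then have "K i \<inter> K j = {}" using assms(3)[of i j] assms(3)[of j i] assms(1) by (cases "i < j") auto
  moreover have "xs ! i \<in> K i" "xs ! j \<in> K j" using ij assms by auto
  ultimately show "xs ! i \<noteq> xs ! j" by auto
qed

text \<open>Supplies fresh vertices for the inner layers of the joining paths, one block for each
  position, so that layers on the same side never overlap.\<close>

lemma disjoint_blocks:
  "finite X \<Longrightarrow> k * w \<le> card X \<Longrightarrow>
    \<exists>f. (\<forall>c<k. f c \<subseteq> X \<and> card (f c) = w) \<and> (\<forall>c<k. \<forall>d<k. c \<noteq> d \<longrightarrow> f c \<inter> f d = {})"
proof (induction k arbitrary: X)
  case (Suc k)
  have "w \<le> card X" using Suc.prems by simp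
  then obtain T where T: "T \<subseteq> X" "card T = w" "finite T" using obtain_subset_with_card_n by metis
  have "k * w \<le> card (X - T)" using Suc.prems T by (simp add: card_Diff_subset)
  then obtain f where f: "\<forall>c<k. f c \<subseteq> X - T \<and> card (f c) = w" "\<forall>c<k. \<forall>d<k. c \<noteq> d \<longrightarrow> f c \<inter> f d = {}"
    using Suc.IH[of "X - T"] Suc.prems by auto
  have "(f(k := T)) c \<subseteq> X \<and> card ((f(k := T)) c) = w" if "c < Suc k" for c
  proof (cases "c = k")
    case False
    then have "f c \<subseteq> X - T \<and> card (f c) = w" using f(1) that by simp
    then show ?thesis using False by auto
  qed (use T in simp)
  moreover have "(f(k := T)) c \<inter> (f(k := T)) d = {}" if "c < Suc k" "d < Suc k" "c \<noteq> d" for c d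
  proof -
    have "f c \<inter> T = {} \<and> T \<inter> f c = {}" if "c < k" for c using f(1) that by blast
    then show ?thesis using f(2) that by (cases "c = k"; cases "d = k") auto
  qed
  ultimately show ?case by (intro exI[of _ "f(k := T)"]) blast
qed simp

text \<open>The two paths share their ends and \<open>ws\<close> holds only the inner vertices of
  the second, so it may be empty; traversed backwards it closes the cycle.\<close>

lemma cycle_of_two_paths:
  assumes xs: "distinct xs" "set xs \<subseteq> V" "successively (\<lambda>u v. {u, v} \<in> E) xs" "xs \<noteq> []"
    and ys: "distinct ws" "set ws \<subseteq> V" "successively (\<lambda>u v. {u, v} \<in> E) (hd xs # ws @ [last xs])"
    and disj: "set xs \<inter> set ws = {}" and k: "length xs + length ws = k" "2 < k"
  shows "contains (V, E) (cycle k)"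
proof (rule cycle_of_list[of "xs @ rev ws"])
  have "successively (\<lambda>u v. {u, v} \<in> E) (ws @ [last xs])" and "{hd xs, hd (ws @ [last xs])} \<in> E"
    using ys(3) by (simp_all add: successively_Cons)
  then have w: "successively (\<lambda>u v. {u, v} \<in> E) ws" "ws \<noteq> [] \<Longrightarrow> {hd xs, hd ws} \<in> E"
    "ws \<noteq> [] \<Longrightarrow> {last ws, last xs} \<in> E" "ws = [] \<Longrightarrow> {hd xs, last xs} \<in> E"
    by (simp_all add: successively_append_iff)
  show "distinct (xs @ rev ws)" "length (xs @ rev ws) = k" "set (xs @ rev ws) \<subseteq> V" "2 < k"
    using xs ys disj k by auto
  show "successively (\<lambda>u v. {u, v} \<in> E) (xs @ rev ws)"
    using xs(3) w by (auto simp: successively_append_iff successively_rev insert_commute hd_rev)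
  show "{last (xs @ rev ws), hd (xs @ rev ws)} \<in> E"
    using w xs(4) by (cases "ws = []") (auto simp: last_rev insert_commute)
qed

section \<open>Trees with a parity flag and their joining\<close>

text \<open>A tree of depth \<open>i\<close> rooted at \<open>p\<close> with layers \<open>L\<close> inside \<open>A\<close>, whose last layer lies on one side.
  The flag \<open>b\<close> says that \<open>p\<close> behaves like a vertex of \<open>X\<close> with respect to parity.\<close>

definition branch :: "nat set set \<Rightarrow> nat set \<Rightarrow> nat set \<Rightarrow> nat \<Rightarrow> nat \<Rightarrow> nat set \<Rightarrow> nat \<Rightarrow> bool \<Rightarrow> nat \<Rightarrow> (nat \<Rightarrow> nat set) \<Rightarrow> bool" where
  "branch E V A r z X p b i L \<longleftrightarrow> 1 \<le> i \<and> i \<le> r \<and> L 0 = {p} \<and> (\<forall>j. 1 \<le> j \<and> j \<le> i \<longrightarrow> L j \<subseteq> A) \<and>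
     (\<forall>j j'. j < j' \<and> j' \<le> i \<longrightarrow> L j \<inter> L j' = {}) \<and>
     (\<forall>j<i. \<forall>v\<in>L (Suc j). \<exists>u\<in>L j. {u, v} \<in> E) \<and>
     card (\<Union>j\<le>i. L j) \<le> 2 * Suc r * z \<and> card (L i) = z \<and> L i \<subseteq> (if b = even i then X else V - X)"

text \<open>By expansion the layers up to radius \<open>r\<close> have at least
  \<open>\<epsilon> * n\<close> vertices in total, so one of them has \<open>2 * z\<close>, and at
  least half of it lies on one side. Taking the first such layer keeps all earlier ones below
  \<open>2 * z\<close>, hence the tree small enough to leave room for the rest of a cycle.\<close>

lemma branch_exists:
  fixes n :: real
  assumes G: "is_graph (V, E)" and sp: "sparse \<rho> C \<gamma> \<beta> V E"
    and c: "0 \<le> \<rho>" "0 < C" "0 \<le> \<gamma>" "\<gamma> \<le> 1" "1 \<le> \<beta>"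
    and n: "real (card V) \<le> n" "1 < n"
    and A: "A \<subseteq> V" "p \<in> V" "p \<notin> A"
    and deg: "\<And>v. v \<in> V \<Longrightarrow> \<delta> * n powr \<gamma> \<le> real (card (nbrs E v \<inter> A))"
    and \<epsilon>: "0 < \<epsilon>" "16 * \<rho> * \<epsilon> powr \<gamma> \<le> \<delta>" and \<delta>: "0 < \<delta>"
    and \<theta>: "n powr \<theta> \<le> \<delta> / (16 * C) * n powr (\<gamma> + 1 - \<beta>)" and r: "1 < real r * \<theta>"
    and z: "0 < z" "real (2 * Suc r * z) \<le> \<epsilon> * n"
  shows "\<exists>b i L. branch E V A r z X p b i L"
proof -
  define U where "U = rec_nat {p} (\<lambda>_ U. U \<union> (\<Union>v\<in>U. nbrs E v \<inter> A))"
  have U0: "U 0 = {p}" and US: "U (Suc i) = U i \<union> (\<Union>v\<in>U i. nbrs E v \<inter> A)" for i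
    by (simp_all add: U_def)
  have fV: "finite V" using G by (simp add: is_graph_iff)
  have UV: "U i \<subseteq> V" for i by (induction i) (use A in \<open>auto simp: U0 US\<close>)
  then have fU: "finite (U i)" for i using fV finite_subset by blast
  have Ur: "\<epsilon> * n \<le> real (card (U r))"
  proof (rule expansion[OF G sp c n _ UV _ _ \<epsilon> \<delta> \<theta> r])
    show "U i \<subseteq> U (Suc i)" for i by (simp add: US)
    show "U 0 \<noteq> {}" by (simp add: U0)
    fix i v assume v: "v \<in> U i"
    have "finite (nbrs E v \<inter> U (Suc i))" using fU[of "Suc i"] by simp
    moreover have "nbrs E v \<inter> A \<subseteq> nbrs E v \<inter> U (Suc i)" using v by (auto simp: US)
    ultimately have "card (nbrs E v \<inter> A) \<le> card (nbrs E v \<inter> U (Suc i))" by (rule card_mono)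
    moreover have "v \<in> V" using v UV by blast
    ultimately show "\<delta> * n powr \<gamma> \<le> real (card (nbrs E v \<inter> U (Suc i)))"
      using deg[of v] by linarith
  qed
  have mono: "U i \<subseteq> U j" if "i \<le> j" for i j
    by (rule lift_Suc_mono_le[of U, OF _ that]) (simp add: US)
  define B where "B j = (if j = 0 then {p} else U j - U (j - 1))" for j
  have BU: "B j \<subseteq> U j" for j by (cases j) (auto simp: B_def U0)
  have UB: "U i = (\<Union>j\<le>i. B j)" for i
  proof (induction i)
    case 0
    then show ?case by (simp add: U0 B_def)
  next
    case (Suc i)
    have "U (Suc i) = U i \<union> B (Suc i)" using mono[of i "Suc i"] by (auto simp: B_def)
    then show ?case using Suc by (simp add: atMost_Suc Un_commute)
  qed
  have "\<exists>j. j \<le> r \<and> 2 * z \<le> card (B j)"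
  proof (rule ccontr)
    assume "\<not> ?thesis"
    then have lt: "card (B j) < 2 * z" if "j \<in> {..r}" for j using that by (meson atMost_iff not_le)
    have "card (U r) \<le> (\<Sum>j\<le>r. card (B j))" unfolding UB by (rule card_UN_le) simp
    also have "\<dots> < (\<Sum>j\<le>r. 2 * z)" using lt by (intro sum_strict_mono) auto
    also have "\<dots> = 2 * Suc r * z" by simp
    finally show False using Ur z by linarith
  qed
  then have ex: "\<exists>j. j \<le> r \<and> 2 * z \<le> card (B j)" .
  define i where "i = (LEAST j. j \<le> r \<and> 2 * z \<le> card (B j))"
  have i: "i \<le> r" "2 * z \<le> card (B i)" using LeastI_ex[OF ex] unfolding i_def by auto
  have min: "card (B j) < 2 * z" if "j < i" for j
    using not_less_Least[OF that[unfolded i_def]] that i(1) by simp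
  have "card (B 0) = 1" by (simp add: B_def)
  then have "i \<noteq> 0" using i(2) z(1) by (intro notI) simp
  then have i1: "1 \<le> i" by simp
  have BA: "B j \<subseteq> A" if "1 \<le> j" for j
    using that US[of "j - 1"] by (auto simp: B_def)
  have link: "\<exists>u\<in>B j. {u, v} \<in> E" if "v \<in> B (Suc j)" for j v
  proof -
    have v: "v \<in> U (Suc j)" "v \<notin> U j" using that by (auto simp: B_def)
    then obtain u where u: "u \<in> U j" "v \<in> nbrs E u" "v \<in> A" by (auto simp: US)
    have "u \<in> B j"
    proof (rule ccontr)
      assume "u \<notin> B j"
      then have "j \<noteq> 0" "u \<in> U (j - 1)" using u by (auto simp: B_def U0 split: if_splits)
      then have "v \<in> U j" using US[of "j - 1"] u by auto
      then show False using v by simp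
    qed
    then show ?thesis using u by (auto simp: nbrs_def)
  qed
  have disj: "B j \<inter> B j' = {}" if "j < j'" for j j'
  proof -
    have "U j \<subseteq> U (j' - 1)" by (rule mono) (use that in simp)
    then have "B j \<subseteq> U (j' - 1)" using BU by blast
    then show ?thesis using that by (auto simp: B_def)
  qed
  have "card (B i) \<le> card (B i \<inter> X) + card (B i \<inter> (V - X))"
  proof -
    have "B i = (B i \<inter> X) \<union> (B i \<inter> (V - X))" using BU[of i] UV[of i] by blast
    then show ?thesis using card_Un_le by metis
  qed
  then have "z \<le> card (B i \<inter> X) \<or> z \<le> card (B i \<inter> (V - X))" using i by linarith
  then obtain Y T where T: "Y = X \<or> Y = V - X" "T \<subseteq> B i \<inter> Y" "card T = z"
    using obtain_subset_with_card_n by metis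
  \<comment> \<open>The flag carries the side of the last layer back to \<open>p\<close> through
    \<open>i\<close> alternations.\<close>
  define b where "b = ((Y = X) = even i)"
  have TX: "T \<subseteq> (if b = even i then X else V - X)" using T by (auto simp: b_def)
  define L where "L j = (if j = i then T else B j)" for j
  have LB: "L j \<subseteq> B j" for j using T by (auto simp: L_def)
  have "card (\<Union>j\<le>i. L j) \<le> (\<Sum>j\<le>i. card (L j))" by (rule card_UN_le) simp
  also have "\<dots> \<le> (\<Sum>j\<le>i. 2 * z)"
  proof (rule sum_mono)
    fix j assume "j \<in> {..i}"
    then show "card (L j) \<le> 2 * z" using T min[of j] by (cases "j = i") (auto simp: L_def)
  qed
  also have "\<dots> = 2 * Suc i * z" by simp
  also have "\<dots> \<le> 2 * Suc r * z" using i by simp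
  finally have sz: "card (\<Union>j\<le>i. L j) \<le> 2 * Suc r * z" .
  have "\<exists>u\<in>L j. {u, v} \<in> E" if "j < i" "v \<in> L (Suc j)" for j v
    using link[of v j] LB[of "Suc j"] that by (auto simp: L_def)
  moreover have "L j \<subseteq> A" if "1 \<le> j" for j using BA[OF that] LB[of j] by blast
  moreover have "L j \<inter> L j' = {}" if "j < j'" for j j' using disj[OF that] LB[of j] LB[of j'] by blast
  moreover have "L 0 = {p}" using i1 by (simp add: L_def B_def)
  moreover have "card (L i) = z" "L i \<subseteq> (if b = even i then X else V - X)" using T TX by (simp_all add: L_def)
  ultimately have "branch E V A r z X p b i L" unfolding branch_def using i i1 sz by blast
  then show ?thesis by blast
qed

text \<open>By induction every \<open>R c\<close> keeps at least \<open>z\<close> vertices: if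
  \<open>z\<close> vertices of the next layer were missed, density would give an edge from
  \<open>R c\<close> to one of them, so fewer than \<open>z\<close> of its at least
  \<open>2 * z\<close> vertices are missed.\<close>

lemma linked_layers:
  assumes X: "X \<subseteq> V" and fV: "finite V"
    and dense: "\<And>S T. S \<subseteq> X \<Longrightarrow> T \<subseteq> V - X \<Longrightarrow> z \<le> card S \<Longrightarrow> z \<le> card T \<Longrightarrow> \<exists>x\<in>S. \<exists>y\<in>T. {x, y} \<in> E"
    and W: "\<And>c. c \<le> t \<Longrightarrow> W c \<subseteq> (if side = even c then X else V - X)" "\<And>c. c \<le> t \<Longrightarrow> 2 * z \<le> card (W c)"
    and z: "0 < z"
  shows "\<exists>R. R 0 = W 0 \<and> (\<forall>c\<le>t. R c \<subseteq> W c \<and> R c \<noteq> {}) \<and> (\<forall>c<t. \<forall>v\<in>R (Suc c). \<exists>u\<in>R c. {u, v} \<in> E)"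
proof -
  define R where "R = rec_nat (W 0) (\<lambda>c R. {v \<in> W (Suc c). \<exists>u\<in>R. {u, v} \<in> E})"
  have R0: "R 0 = W 0" and RS: "R (Suc c) = {v \<in> W (Suc c). \<exists>u\<in>R c. {u, v} \<in> E}" for c
    by (simp_all add: R_def)
  have sub: "R c \<subseteq> W c" for c by (cases c) (auto simp: R0 RS)
  have WV: "W c \<subseteq> V" if "c \<le> t" for c using W(1)[OF that] X by (auto split: if_splits)
  have big: "z \<le> card (R c)" if "c \<le> t" for c
    using that
  proof (induction c)
    case 0
    have "z \<le> 2 * z" by simp
    then show ?case using W(2)[of 0] 0 unfolding R0 by linarith
  next
    case (Suc c)
    show ?case
    proof (rule ccontr)
      assume "\<not> z \<le> card (R (Suc c))"
      let ?N = "W (Suc c) - R (Suc c)"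
      have "R (Suc c) \<subseteq> V" using sub[of "Suc c"] WV[OF Suc.prems] by (rule subset_trans)
      then have "finite (R (Suc c))" using fV by (rule finite_subset)
      then have "card ?N = card (W (Suc c)) - card (R (Suc c))" using sub by (intro card_Diff_subset) auto
      then have N: "z \<le> card ?N" using W(2)[OF Suc.prems] \<open>\<not> z \<le> card (R (Suc c))\<close> by linarith
      have no: "{u, v} \<notin> E" if "u \<in> R c" "v \<in> ?N" for u v using that by (auto simp: RS)
      have Rc: "z \<le> card (R c)" using Suc by simp
      have RX: "R c \<subseteq> (if side = even c then X else V - X)" using sub[of c] W(1)[of c] Suc.prems by (meson Suc_leD subset_trans)
      have NX: "?N \<subseteq> (if side = even (Suc c) then X else V - X)" using W(1)[OF Suc.prems] by blast
      show False
      proof (cases "side = even c")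
        case True
        then have "R c \<subseteq> X" "?N \<subseteq> V - X" using RX NX by auto
        then show False using dense[of "R c" ?N] Rc N no by blast
      next
        case False
        then have "R c \<subseteq> V - X" "?N \<subseteq> X" using RX NX by (auto split: if_splits)
        then obtain x y where "x \<in> ?N" "y \<in> R c" "{x, y} \<in> E" using dense[of ?N "R c"] Rc N by blast
        then show False using no[of y x] by (simp add: insert_commute)
      qed
    qed
  qed
  have "R c \<noteq> {}" if "c \<le> t" for c using big[OF that] z by auto
  then show ?thesis using sub R0 RS by (intro exI[of _ R]) auto
qed

text \<open>A path of \<open>t\<close> steps leads from the last layer of one tree to that of the
  other through fresh blocks on alternating sides. Here \<open>t\<close> is what remains of
  \<open>k\<close> after the two tree paths and the possible edge between \<open>p\<close> and
  \<open>q\<close>; the condition on the flags gives it the parity that fits the sides of both last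
  layers. In the room, \<open>8 * Suc r * z\<close> vertices account for the two trees and
  \<open>2 * k * z\<close> for \<open>k\<close> blocks of size \<open>2 * z\<close>.\<close>

lemma close_branches:
  assumes G: "is_graph (V, E)" and X: "X \<subseteq> V" and AB: "A \<subseteq> V" "B \<subseteq> V" "A \<inter> B = {}"
    and pq: "p \<in> V" "q \<in> V" "p \<notin> A" "p \<notin> B" "q \<notin> A" "q \<notin> B"
    and dense: "\<And>S T. S \<subseteq> X \<Longrightarrow> T \<subseteq> V - X \<Longrightarrow> z \<le> card S \<Longrightarrow> z \<le> card T \<Longrightarrow> \<exists>x\<in>S. \<exists>y\<in>T. {x, y} \<in> E"
    and z: "0 < z"
    and L: "branch E V A r (2 * z) X p b i L" and M: "branch E V B r (2 * z) X q b' j M"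
    and room: "(8 * Suc r + 2 * k) * z \<le> card X" "(8 * Suc r + 2 * k) * z \<le> card (V - X)"
    and k: "odd k" "2 * r + 2 < k"
    and pair: "p = q \<and> b \<noteq> b' \<or> {p, q} \<in> E \<and> b = b'"
  shows "contains (V, E) (cycle k)"
proof -
  have Ld: "1 \<le> i" "i \<le> r" "L 0 = {p}" "\<And>c. 1 \<le> c \<Longrightarrow> c \<le> i \<Longrightarrow> L c \<subseteq> A"
    "\<And>c d. c < d \<Longrightarrow> d \<le> i \<Longrightarrow> L c \<inter> L d = {}"
    "\<And>c v. c < i \<Longrightarrow> v \<in> L (Suc c) \<Longrightarrow> \<exists>u\<in>L c. {u, v} \<in> E"
    "card (\<Union>c\<le>i. L c) \<le> 2 * Suc r * (2 * z)" "card (L i) = 2 * z"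
    "L i \<subseteq> (if b = even i then X else V - X)"
    using L unfolding branch_def by auto
  have Md: "1 \<le> j" "j \<le> r" "M 0 = {q}" "\<And>c. 1 \<le> c \<Longrightarrow> c \<le> j \<Longrightarrow> M c \<subseteq> B"
    "\<And>c d. c < d \<Longrightarrow> d \<le> j \<Longrightarrow> M c \<inter> M d = {}"
    "\<And>c v. c < j \<Longrightarrow> v \<in> M (Suc c) \<Longrightarrow> \<exists>u\<in>M c. {u, v} \<in> E"
    "card (\<Union>c\<le>j. M c) \<le> 2 * Suc r * (2 * z)" "card (M j) = 2 * z"
    "M j \<subseteq> (if b' = even j then X else V - X)"
    using M unfolding branch_def by auto
  define s where "s = (if p = q then 0 else 1 :: nat)"
  define t where "t = k - (i + j + s)"
  have s1: "s \<le> 1" by (simp add: s_def)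
  have t: "1 \<le> t" "i + j + s + t = k" "t \<le> k" using Ld(2) Md(2) k s1 by (auto simp: t_def)
  define side where "side = (b = even i)"
  have par: "(b' = even j) = (side = even t)"
  proof -
    have "odd (i + j + s + t)" using t k by simp
    then show ?thesis using pair is_graph_edgeD(3)[OF G] by (auto simp: side_def s_def)
  qed
  define U where "U = (\<Union>c\<le>i. L c) \<union> (\<Union>c\<le>j. M c)"
  have LU: "L c \<subseteq> U" if "c \<le> i" for c using that by (auto simp: U_def)
  have MU: "M c \<subseteq> U" if "c \<le> j" for c using that by (auto simp: U_def)
  have LV: "L c \<subseteq> V" if "c \<le> i" for c using Ld(3) Ld(4)[of c] that AB pq by (cases "c = 0") auto
  have MV: "M c \<subseteq> V" if "c \<le> j" for c using Md(3) Md(4)[of c] that AB pq by (cases "c = 0") auto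
  have fV: "finite V" using G by (simp add: is_graph_iff)
  have cU: "card U \<le> 8 * Suc r * z" using card_Un_le[of "\<Union>c\<le>i. L c" "\<Union>c\<le>j. M c"] Ld(7) Md(7) by (simp add: U_def algebra_simps)
  have "U \<subseteq> V" unfolding U_def using LV MV by blast
  then have fU: "finite U" using fV by (rule finite_subset)
  have blocks: "\<exists>f. (\<forall>c<k. f c \<subseteq> Y - U \<and> card (f c) = 2 * z) \<and> (\<forall>c<k. \<forall>d<k. c \<noteq> d \<longrightarrow> f c \<inter> f d = {})"
    if "(8 * Suc r + 2 * k) * z \<le> card Y" "Y \<subseteq> V" for Y
  proof (rule disjoint_blocks)
    show "finite (Y - U)" using that(2) fV finite_subset by blast
    have "card Y - card U \<le> card (Y - U)" by (rule diff_card_le_card_Diff[OF fU])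
    then show "k * (2 * z) \<le> card (Y - U)" using that(1) cU by (simp add: algebra_simps)
  qed
  have "\<exists>f. (\<forall>c<k. f c \<subseteq> X - U \<and> card (f c) = 2 * z) \<and> (\<forall>c<k. \<forall>d<k. c \<noteq> d \<longrightarrow> f c \<inter> f d = {})"
    by (rule blocks) (use room X in auto)
  then obtain f where f0: "(\<forall>c<k. f c \<subseteq> X - U \<and> card (f c) = 2 * z) \<and> (\<forall>c<k. \<forall>d<k. c \<noteq> d \<longrightarrow> f c \<inter> f d = {})"
    by (rule exE)
  have f: "c < k \<Longrightarrow> f c \<subseteq> X - U \<and> card (f c) = 2 * z" "c < k \<Longrightarrow> d < k \<Longrightarrow> c \<noteq> d \<Longrightarrow> f c \<inter> f d = {}" for c d
    using f0 by simp_all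
  have "\<exists>f. (\<forall>c<k. f c \<subseteq> (V - X) - U \<and> card (f c) = 2 * z) \<and> (\<forall>c<k. \<forall>d<k. c \<noteq> d \<longrightarrow> f c \<inter> f d = {})"
    by (rule blocks) (use room X in auto)
  then obtain g where g0: "(\<forall>c<k. g c \<subseteq> (V - X) - U \<and> card (g c) = 2 * z) \<and> (\<forall>c<k. \<forall>d<k. c \<noteq> d \<longrightarrow> g c \<inter> g d = {})"
    by (rule exE)
  have g: "c < k \<Longrightarrow> g c \<subseteq> (V - X) - U \<and> card (g c) = 2 * z" "c < k \<Longrightarrow> d < k \<Longrightarrow> c \<noteq> d \<Longrightarrow> g c \<inter> g d = {}" for c d
    using g0 by simp_all
  \<comment> \<open>Only the positions strictly between 0 and \<open>t\<close> take blocks, which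
    avoid both trees; the end positions are the last layers of the trees themselves.\<close>
  define W where "W c = (if c = 0 then L i else if c = t then M j else if side = even c then f c else g c)" for c
  have tk: "t < k" using t Ld(1) by linarith
  have Wmid: "W c \<subseteq> (if side = even c then X else V - X) - U \<and> card (W c) = 2 * z" if "0 < c" "c < t" for c
    using f(1)[of c] g(1)[of c] that tk by (simp add: W_def)
  have Wside: "W c \<subseteq> (if side = even c then X else V - X)" if "c \<le> t" for c
  proof -
    consider "c = 0" | "c = t" "c \<noteq> 0" | "0 < c" "c < t" using \<open>c \<le> t\<close> by linarith
    then show ?thesis
    proof cases
      case 1
      then show ?thesis using Ld(9) by (simp add: W_def side_def)
    next
      case 2
      then show ?thesis using Md(9) par by (simp add: W_def)
    next
      case 3
      then show ?thesis using Wmid[of c] by blast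
    qed
  qed
  have Wcard: "2 * z \<le> card (W c)" if "c \<le> t" for c
    using that Ld(8) Md(8) Wmid[of c] by (cases "c = 0"; cases "c = t") (auto simp: W_def)
  have "\<exists>R. R 0 = W 0 \<and> (\<forall>c\<le>t. R c \<subseteq> W c \<and> R c \<noteq> {}) \<and> (\<forall>c<t. \<forall>v\<in>R (Suc c). \<exists>u\<in>R c. {u, v} \<in> E)"
    by (rule linked_layers[OF X fV dense Wside Wcard z])
  then obtain R where R0: "R 0 = W 0 \<and> (\<forall>c\<le>t. R c \<subseteq> W c \<and> R c \<noteq> {}) \<and> (\<forall>c<t. \<forall>v\<in>R (Suc c). \<exists>u\<in>R c. {u, v} \<in> E)"
    by (rule exE)
  have R: "R 0 = W 0" "c \<le> t \<Longrightarrow> R c \<subseteq> W c \<and> R c \<noteq> {}"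
    "c < t \<Longrightarrow> v \<in> R (Suc c) \<Longrightarrow> \<exists>u\<in>R c. {u, v} \<in> E" for c v
    using R0 by simp_all
  \<comment> \<open>The layers from \<open>p\<close> through the first tree and on into the second.
    The two descriptions agree at position \<open>i\<close>, where \<open>R 0 = L i\<close>.\<close>
  define K where "K c = (if c \<le> i then L c else R (c - i))" for c
  have Klink: "\<exists>u\<in>K c. {u, v} \<in> E" if "c < i + t" "v \<in> K (Suc c)" for c v
  proof -
    consider "c < i" | "c = i" | "i < c" by linarith
    then show ?thesis
    proof cases
      case 1
      then show ?thesis using Ld(6)[of c v] that by (simp add: K_def)
    next
      case 2
      then show ?thesis using R(3)[of 0 v] R(1) that t by (simp add: K_def W_def)
    next
      case 3
      then have "Suc c - i = Suc (c - i)" by simp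
      then show ?thesis using R(3)[of "c - i" v] 3 that by (simp add: K_def)
    qed
  qed
  have Wt: "R t \<subseteq> M j" using R(2)[of t] t by (simp add: W_def)
  \<comment> \<open>The two paths meet at \<open>v\<close>: one goes back to \<open>p\<close>
    through \<open>K\<close>, the other to \<open>q\<close> through \<open>M\<close>.\<close>
  obtain v where v: "v \<in> R t" using R(2)[of t] by blast
  then have vM: "v \<in> M j" using Wt by blast
  have vK: "v \<in> K (i + t)" using v t by (simp add: K_def)
have "\<exists>xs. length xs = Suc (i + t) \<and> (\<forall>c\<le>i + t. xs ! c \<in> K c) \<and> last xs = v \<and> successively (\<lambda>u v. {u, v} \<in> E) xs"
    by (rule layered_path) (fact Klink vK)+
  then obtain xs where xs0: "length xs = Suc (i + t) \<and> (\<forall>c\<le>i + t. xs ! c \<in> K c) \<and> last xs = v \<and> successively (\<lambda>u v. {u, v} \<in> E) xs"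
    by (rule exE)
  note xs = xs0[THEN conjunct1] xs0[THEN conjunct2, THEN conjunct1]
    xs0[THEN conjunct2, THEN conjunct2, THEN conjunct1] xs0[THEN conjunct2, THEN conjunct2, THEN conjunct2]
  have "\<exists>ys. length ys = Suc (j) \<and> (\<forall>c\<le>j. ys ! c \<in> M c) \<and> last ys = v \<and> successively (\<lambda>u v. {u, v} \<in> E) ys"
    by (rule layered_path) (fact Md(6) vM)+
  then obtain ys where ys0: "length ys = Suc (j) \<and> (\<forall>c\<le>j. ys ! c \<in> M c) \<and> last ys = v \<and> successively (\<lambda>u v. {u, v} \<in> E) ys"
    by (rule exE)
  note ys = ys0[THEN conjunct1] ys0[THEN conjunct2, THEN conjunct1]
    ys0[THEN conjunct2, THEN conjunct2, THEN conjunct1] ys0[THEN conjunct2, THEN conjunct2, THEN conjunct2]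
  have Kmid: "K c \<subseteq> V - U" if "i < c" "c < i + t" for c
  proof -
    have "R (c - i) \<subseteq> W (c - i)" "0 < c - i" "c - i < t" using R(2)[of "c - i"] that by auto
    moreover have "(if side = even (c - i) then X else V - X) \<subseteq> V" using X by auto
    ultimately show ?thesis using Wmid[of "c - i"] that unfolding K_def by auto
  qed
  have Kend: "K (i + t) \<subseteq> M j" using Wt t by (simp add: K_def)
  have MB: "M c \<inter> (A \<union> {p}) = {}" if "1 \<le> c" "c \<le> j" for c using Md(4)[OF that] AB pq by auto
  have LA: "L c \<subseteq> A \<union> {p}" if "c \<le> i" for c using Ld(3) Ld(4)[of c] that by (cases "c = 0") auto
  have KM: "K c \<inter> M d = {}" if "c < i + t" "1 \<le> d" "d \<le> j" for c d
  proof (cases "c \<le> i")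
    case True
    then show ?thesis using LA[OF True] MB[OF that(2,3)] by (auto simp: K_def)
  next
    case False
    then have "K c \<subseteq> V - U" using Kmid[of c] that by simp
    then show ?thesis using MU[OF that(3)] by blast
  qed
  have Kdisj: "K c \<inter> K d = {}" if "c < d" "d \<le> i + t" for c d
  proof -
    have "d \<le> i \<or> (i < d \<and> d < i + t \<and> c \<le> i) \<or> (i < c \<and> d < i + t) \<or> d = i + t"
      using that by presburger
    then consider "d \<le> i" | "i < d" "d < i + t" "c \<le> i" | "i < c" "d < i + t" | "d = i + t"
      by blast
    then show ?thesis
    proof cases
      case 1
      then show ?thesis using Ld(5)[of c d] that by (simp add: K_def)
    next
      case 2
      then have "K c \<subseteq> U" using LU by (simp add: K_def)
      moreover have "K d \<subseteq> V - U" by (rule Kmid) (use 2 in auto)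
      ultimately show ?thesis by blast
    next
      case 3
      let ?c = "c - i" and ?d = "d - i"
      have cd: "0 < ?c" "?c < t" "0 < ?d" "?d < t" "?c \<noteq> ?d" using 3 that by auto
      then have "W ?c \<inter> W ?d = {}"
      proof -
        have Wc: "W x = (if side = even x then f x else g x)" if "0 < x" "x < t" for x
          using that by (simp add: W_def)
        have fg: "f x \<inter> g y = {}" if "x < k" "y < k" for x y using f(1)[OF that(1)] g(1)[OF that(2)] by blast
        show ?thesis using cd tk f(2)[of ?c ?d] g(2)[of ?c ?d] fg[of ?c ?d] fg[of ?d ?c]
          by (simp add: Wc Int_commute)
      qed
      moreover have "K c = R ?c" "K d = R ?d" using 3 that by (auto simp: K_def)
      moreover have "R ?c \<subseteq> W ?c" "R ?d \<subseteq> W ?d" using R(2) cd by auto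
      ultimately show ?thesis by blast
    next
      case 4
      then show ?thesis using KM[of c j] Kend that Md(1) by auto
    qed
  qed
  have dxs: "distinct xs" by (rule layered_path_distinct[OF xs(1,2) Kdisj])
  have dys: "distinct ys" by (rule layered_path_distinct[OF ys(1,2) Md(5)])
  have KV: "K c \<subseteq> V" if "c \<le> i + t" for c
  proof -
    have "c \<le> i \<or> (i < c \<and> c < i + t) \<or> c = i + t" using that by auto
    then consider "c \<le> i" | "i < c" "c < i + t" | "c = i + t" by blast
    then show ?thesis
    proof cases
      case 1
      then show ?thesis using LV by (simp add: K_def)
    next
      case 2
      then show ?thesis using Kmid[of c] by blast
    next
      case 3
      then show ?thesis using Kend MV[of j] by auto
    qed
  qed
  have xsV: "set xs \<subseteq> V"
  proof
    fix x assume "x \<in> set xs"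
    then obtain c where "c < length xs" "x = xs ! c" by (auto simp: in_set_conv_nth)
    then show "x \<in> V" using xs(1,2) KV[of c] by auto
  qed
  have nexs: "xs \<noteq> []" using xs(1) by auto
  have hxs: "hd xs = p" using xs(1,2) nexs Ld(3) by (auto simp: hd_conv_nth K_def)
  have hys: "hd ys = q" using ys(1,2) Md(3) by (cases ys) auto
  \<comment> \<open>Both ends are dropped, since \<open>q\<close> and \<open>v\<close> also belong
    to the other path.\<close>
  define ws where "ws = butlast (tl ys)"
  have ysdec: "ys = q # ws @ [v]"
  proof -
    obtain y zs where yz: "ys = y # zs" using ys(1) by (cases ys) auto
    then have "zs \<noteq> []" using ys(1) Md(1) by (intro notI) simp
    with yz show ?thesis using hys ys(3) by (simp add: ws_def) (metis append_butlast_last_id)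
  qed
  have lws: "length ws = j - 1" using ys(1) ysdec by auto
  have wsM: "\<exists>d. 1 \<le> d \<and> d < j \<and> x \<in> M d" if "x \<in> set ws" for x
  proof -
    obtain d where d: "d < length ws" "x = ws ! d" using \<open>x \<in> set ws\<close> by (auto simp: in_set_conv_nth)
    then have "ys ! Suc d = x" by (simp add: ysdec nth_append)
    moreover have "Suc d < j" using d lws by simp
    ultimately show ?thesis using ys(2) by (intro exI[of _ "Suc d"]) auto
  qed
  have disj: "set xs \<inter> set ws = {}"
  proof (rule ccontr)
    assume "set xs \<inter> set ws \<noteq> {}"
    then obtain x c d where x: "c < length xs" "x = xs ! c" "1 \<le> d" "d < j" "x \<in> M d"
      using wsM by (metis disjoint_iff in_set_conv_nth)
    then have xK: "x \<in> K c" "c \<le> i + t" using xs by auto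
    show False
    proof (cases "c = i + t")
      case True
      then show False using Kend xK x Md(5)[of d j] by blast
    next
      case False
      then show False using KM[of c d] xK x by auto
    qed
  qed
  have qxs: "q \<notin> set xs" if "p \<noteq> q"
  proof
    assume "q \<in> set xs"
    then obtain c where c: "c < length xs" "q = xs ! c" by (metis in_set_conv_nth)
    then have qK: "q \<in> K c" "c \<le> i + t" using xs by auto
    have "c \<le> i \<or> (i < c \<and> c < i + t) \<or> c = i + t" using qK by auto
    then consider "c \<le> i" | "i < c" "c < i + t" | "c = i + t" by blast
    then show False
    proof cases
      case 1
      then show False using LA[of c] qK pq that by (auto simp: K_def)
    next
      case 2
      have "q \<in> U" using Md(3) MU[of 0] by simp
      then show False using Kmid[of c] 2 qK by blast
    next
      case 3
      then show False using Kend Md(4)[of j] Md(1) qK pq by auto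
    qed
  qed
  \<comment> \<open>When \<open>p\<close> and \<open>q\<close> differ, their edge is added to the
    first path, so that in either case both paths run between \<open>q\<close> and
    \<open>v\<close>.\<close>
  define xs' where "xs' = (if p = q then xs else q # xs)"
  have "distinct xs'" using dxs qxs by (simp add: xs'_def)
  moreover have "set xs' \<subseteq> V" using xsV pq by (simp add: xs'_def)
  moreover have "successively (\<lambda>u v. {u, v} \<in> E) xs'"
    using xs(4) hxs pair nexs by (auto simp: xs'_def successively_Cons insert_commute)
  moreover have ne': "xs' \<noteq> []" using nexs by (simp add: xs'_def)
  moreover have "distinct ws" using dys ysdec by simp
  moreover have "set ws \<subseteq> V" using wsM MV by (meson less_imp_le_nat subset_iff)
  moreover have "successively (\<lambda>u v. {u, v} \<in> E) (hd xs' # ws @ [last xs'])"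
    using ys(4) ysdec hxs xs(3) nexs by (simp add: xs'_def)
  moreover have "set xs' \<inter> set ws = {}"
    using disj dys ysdec by (auto simp: xs'_def)
  moreover have "length xs' + length ws = k"
    using xs(1) lws t Md(1) by (auto simp: xs'_def s_def split: if_splits)
  moreover have "2 < k" using k by simp
  ultimately show ?thesis by (rule cycle_of_two_paths)
qed

lemma branch_mono:
  assumes "branch E V A r z X p b i L" "A \<subseteq> A'"
  shows "branch E V A' r z X p b i L"
proof -
  have "\<forall>j. 1 \<le> j \<and> j \<le> i \<longrightarrow> L j \<subseteq> A" using assms(1) by (simp add: branch_def)
  then have "\<forall>j. 1 \<le> j \<and> j \<le> i \<longrightarrow> L j \<subseteq> A'" using assms(2) by (meson subset_trans)
  then show ?thesis using assms(1) by (simp add: branch_def)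
qed

lemma bipartiteI:
  assumes G: "is_graph (V, E)" and T: "\<And>u v. {u, v} \<in> E \<Longrightarrow> T u \<noteq> (T v :: bool)"
  shows "bipartite (V, E)"
proof -
  have "card (e \<inter> {v. T v}) = 1" if e: "e \<in> E" for e
  proof -
    obtain u v where uv: "e = {u, v}" using is_graph_edgeE[OF G e] by metis
    then have "T u \<noteq> T v" using T e by simp
    then have "e \<inter> {v. T v} = {u} \<or> e \<inter> {v. T v} = {v}" using uv by (cases "T u") auto
    then show ?thesis by auto
  qed
  then show ?thesis unfolding bipartite_def edges_def by (intro exI[of _ "{v. T v}"]) simp
qed

lemma ball_at_big:
  fixes n :: real
  assumes G: "is_graph (V, E)" and sp: "sparse \<rho> C \<gamma> \<beta> V E"
    and c: "0 \<le> \<rho>" "0 < C" "0 \<le> \<gamma>" "\<gamma> \<le> 1" "1 \<le> \<beta>"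
    and n: "real (card V) \<le> n" "1 < n"
    and deg: "\<And>v. v \<in> V \<Longrightarrow> \<delta> * n powr \<gamma> \<le> real (card (nbrs E v))"
    and \<epsilon>: "0 < \<epsilon>" "16 * \<rho> * \<epsilon> powr \<gamma> \<le> \<delta>" and \<delta>: "0 < \<delta>"
    and \<theta>: "n powr \<theta> \<le> \<delta> / (16 * C) * n powr (\<gamma> + 1 - \<beta>)" and r: "1 < real r * \<theta>"
    and w: "w \<in> V"
  shows "\<epsilon> * n \<le> real (card (ball_at E w r))"
proof (rule expansion[OF G sp c n _ _ _ _ \<epsilon> \<delta> \<theta> r])
  show "ball_at E w i \<subseteq> ball_at E w (Suc i)" for i by simp
  show sub: "ball_at E w i \<subseteq> V" for i by (rule ball_at_subset[OF G w])
  show "ball_at E w 0 \<noteq> {}" by simp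
  fix i v assume v: "v \<in> ball_at E w i"
  then have "nbrs E v \<inter> ball_at E w (Suc i) = nbrs E v" by auto
  then show "\<delta> * n powr \<gamma> \<le> real (card (nbrs E v \<inter> ball_at E w (Suc i)))"
    using deg sub v by auto
qed

section \<open>Bipartiteness\<close>

text \<open>The numerical hypotheses isolate what a large \<open>n\<close> must provide:
  \<open>split\<close> gives both halves a tenth of every degree bound, \<open>big\<close> lets a
  twentieth survive the removal of two vertices, \<open>gap\<close> rules out an edgeless pair of
  sets of size \<open>z\<close>, and \<open>room\<close> rules out a small side. The colour of a
  vertex is the flag of its trees.\<close>

lemma min_degree_bipartite:
  fixes n :: real
  assumes G: "is_graph (V, E)" and sp: "sparse \<rho> C \<gamma> \<beta> V E"
    and c: "0 < \<rho>" "0 < C" "0 < \<gamma>" "\<gamma> \<le> 1" "1 \<le> \<beta>"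
    and n: "real (card V) \<le> n" "1 < n"
    and deg: "\<And>v. v \<in> V \<Longrightarrow> \<delta> * n powr \<gamma> \<le> real (card (nbrs E v))"
    and \<epsilon>: "0 < \<epsilon>" "16 * \<rho> * \<epsilon> powr \<gamma> \<le> \<delta> / 20" and \<delta>: "0 < \<delta>"
    and \<theta>: "n powr \<theta> \<le> \<delta> / 20 / (16 * C) * n powr (\<gamma> + 1 - \<beta>)" and r: "1 < real r * \<theta>"
    and M: "1 < real (Suc M) * \<epsilon>" and D: "D = M * (2 * r + 1)"
    and k: "odd k" "2 * D < k" "2 * r + 2 < k" and free: "\<not> contains (V, E) (cycle k)"
    and split: "2 * n * (3/4) powr (\<delta> * n powr \<gamma>) * 2 powr (\<delta> * n powr \<gamma> / 10) < 1"
    and big: "40 \<le> \<delta> * n powr \<gamma>"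
    and z: "0 < z" "real (2 * Suc r * (2 * z)) \<le> \<epsilon> * n"
    and lower: "\<rho> * (real (card V) / 2) powr (1 + \<gamma>) - B \<le> real (card E)"
    and gap: "B + real (2 * D * k) * n + 2 * C * n powr \<beta> < \<rho> * \<gamma> * (real z)\<^sup>2 * n powr (\<gamma> - 1)"
    and room: "\<rho> * real ((8 * Suc r + 2 * k) * z) * n powr \<gamma> + C * n powr \<beta> + real (2 * D * k) * n < real (card E)"
  shows "bipartite (V, E)"
proof -
  have fV: "finite V" using G by (simp add: is_graph_iff)
  have c': "0 \<le> \<rho>" "0 \<le> C" "0 \<le> \<gamma>" "0 \<le> \<beta>" using c by auto
  let ?d = "\<delta> * n powr \<gamma>"
  obtain l par rt where l: "\<forall>u v. {u, v} \<in> E \<longrightarrow> rt u = (rt v :: nat) \<and> l u \<le> Suc (l v)"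
    "\<forall>v. 0 < l v \<longrightarrow> {par v, v} \<in> E \<and> Suc (l (par v)) = l v" "\<forall>v. l v = 0 \<longrightarrow> v = rt v"
    using levels_exist[of E] by (elim exE conjE)
  have ball: "\<epsilon> * n \<le> real (card (ball_at E w r))" if "w \<in> V" for w
  proof (rule ball_at_big[OF G sp c'(1) c(2) c'(3) c(4,5) n deg \<epsilon>(1) _ \<delta> _ r that])
    show "16 * \<rho> * \<epsilon> powr \<gamma> \<le> \<delta>" using \<epsilon>(2) \<delta> by linarith
    have "\<delta> / 20 / (16 * C) \<le> \<delta> / (16 * C)" using \<delta> c by (intro divide_right_mono) auto
    then have "\<delta> / 20 / (16 * C) * n powr (\<gamma> + 1 - \<beta>) \<le> \<delta> / (16 * C) * n powr (\<gamma> + 1 - \<beta>)"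
      by (rule mult_right_mono) simp
    then show "n powr \<theta> \<le> \<delta> / (16 * C) * n powr (\<gamma> + 1 - \<beta>)" using \<theta> by linarith
  qed
  have Mn: "real (card V) < real (Suc M) * (\<epsilon> * n)"
  proof -
    have "1 * n < real (Suc M) * \<epsilon> * n" using M n by (intro mult_strict_right_mono) auto
    then have "n < real (Suc M) * (\<epsilon> * n)" by (simp only: mult.assoc mult_1)
    then show ?thesis using n by linarith
  qed
  have lE: "l u \<le> Suc (l v)" "rt u = rt v \<and> l u \<le> Suc (l v)" if "{u, v} \<in> E" for u v
    using l(1) that by blast+
  have lpar: "{par v, v} \<in> E \<and> Suc (l (par v)) = l v" if "0 < l v" for v using l(2) that by blast
  have lroot: "v = rt v" if "l v = 0" for v using l(3) that by blast
  have lD: "l v < D" if "v \<in> V" for v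
    unfolding D by (rule level_bound[OF G lE(1) lpar ball Mn that])
  have "\<exists>X\<subseteq>V. card E \<le> card (btw E X (V - X)) + 2 * D * k * card V"
    by (rule near_bipartite[OF G lE(2) lpar lroot lD k(1,2) free])
  then obtain X0 where X0: "X0 \<subseteq> V" "card E \<le> card (btw E X0 (V - X0)) + 2 * D * k * card V"
    by (elim exE conjE)
  \<comment> \<open>The sides are exchanged if necessary, because the loss estimate for a missing
    pair takes \<open>X\<close> as the smaller side.\<close>
  obtain X where X: "X \<subseteq> V" "card E \<le> card (btw E X (V - X)) + 2 * D * k * card V" "card X \<le> card (V - X)"
  proof (cases "card X0 \<le> card (V - X0)")
    case True
    then show ?thesis using X0 that by blast
  next
    case False
    have "V - (V - X0) = X0" using X0 by blast
    then show ?thesis using that[of "V - X0"] X0 False by (simp add: btw_commute)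
  qed
  let ?Y = "V - X"
  have XY: "card X + card ?Y = card V" using card_Diff_subset[of X V] X(1) fV card_mono[OF fV X(1)] finite_subset[OF X(1)] by simp
  have inner: "real (card E) \<le> real (card (btw E X ?Y)) + real (2 * D * k) * n"
  proof -
    have "real (card E) \<le> real (card (btw E X ?Y) + 2 * D * k * card V)" using X(2) by (rule of_nat_mono)
    also have "\<dots> = real (card (btw E X ?Y)) + real (2 * D * k) * real (card V)" by simp
    also have "\<dots> \<le> real (card (btw E X ?Y)) + real (2 * D * k) * n" using n by (intro add_left_mono mult_left_mono) auto
    finally show ?thesis .
  qed
  have Yn: "real (card ?Y) \<le> n" "real (card X) \<le> n" using XY n by linarith+
  have roomX: "(8 * Suc r + 2 * k) * z \<le> card X"
  proof (rule ccontr)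
    assume "\<not> ?thesis"
    then have "card X \<le> (8 * Suc r + 2 * k) * z" by simp
    then have "real (card X) \<le> real ((8 * Suc r + 2 * k) * z)" by (rule of_nat_mono)
    then have "real (card (btw E X ?Y)) \<le> \<rho> * real ((8 * Suc r + 2 * k) * z) * n powr \<gamma> + C * n powr \<beta>"
      using X(1) Yn by (intro sparse_le[OF G sp c'(1,2,3) c(4) c'(4)]) auto
    then show False using inner room by linarith
  qed
  then have roomY: "(8 * Suc r + 2 * k) * z \<le> card ?Y" using X(3) by linarith
  have "2 * z \<le> (8 * Suc r + 2 * k) * z" by (intro mult_right_mono) auto
  then have zY: "2 * z \<le> card ?Y" using roomY by linarith
  \<comment> \<open>Both sets are cut down to size \<open>z\<close> for the loss estimate; by
    \<open>gap\<close> the loss exceeds the deficit \<open>B\<close>, the edges inside the sides and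
    both error terms together.\<close>
  have dense: "\<exists>x\<in>S. \<exists>y\<in>T. {x, y} \<in> E" if ST: "S \<subseteq> X" "T \<subseteq> ?Y" "z \<le> card S" "z \<le> card T" for S T
  proof (rule ccontr)
    assume no: "\<not> ?thesis"
    obtain S' where S': "S' \<subseteq> S" "card S' = z" using obtain_subset_with_card_n[OF ST(3)] by metis
    obtain T' where T': "T' \<subseteq> T" "card T' = z" using obtain_subset_with_card_n[OF ST(4)] by metis
    have "real (card (btw E X ?Y)) \<le> \<rho> * (real (card X + card ?Y) / 2) powr (1 + \<gamma>)
     - \<rho> * \<gamma> * (real z)\<^sup>2 * n powr (\<gamma> - 1) + 2 * C * n powr \<beta>"
    proof (rule btw_without_edge[OF G sp c'(1,2,3) c(4) c'(4) X(1) _ _ X(3) n(1) _ _ S'(2) T'(2) z(1) zY])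
      show "S' \<subseteq> X" "T' \<subseteq> ?Y" using S' T' ST by blast+
      show "{x, y} \<notin> E" if "x \<in> S'" "y \<in> T'" for x y using no that S' T' by blast
    qed auto
    then show False using inner lower gap unfolding XY by linarith
  qed
  have "\<exists>A\<subseteq>V. \<forall>v\<in>V. ?d / 10 \<le> real (card (nbrs E v \<inter> A)) \<and> ?d / 10 \<le> real (card (nbrs E v \<inter> (V - A)))"
  proof (rule split_exists[OF fV fV])
    show "nbrs E v \<subseteq> V" for v by (rule nbrs_subset[OF G])
    show "?d \<le> real (card (nbrs E v))" if "v \<in> V" for v by (rule deg[OF that])
    have "2 * real (card V) * ((3/4) powr ?d * 2 powr (?d / 10)) \<le> 2 * n * ((3/4) powr ?d * 2 powr (?d / 10))"
      using n by (intro mult_right_mono) auto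
    then show "2 * real (card V) * (3/4) powr ?d * 2 powr (?d / 10) < 1" using split unfolding mult.assoc by linarith
    show "0 \<le> ?d" using big by linarith
  qed
  then obtain A where A: "A \<subseteq> V"
    and dA: "\<forall>v\<in>V. ?d / 10 \<le> real (card (nbrs E v \<inter> A)) \<and> ?d / 10 \<le> real (card (nbrs E v \<inter> (V - A)))"
    by (elim exE conjE)
  have degA: "?d / 10 \<le> real (card (nbrs E v \<inter> A'))" if "A' = A \<or> A' = V - A" "v \<in> V" for A' v
    using dA that by blast
  \<comment> \<open>Both roots are removed from the half, so that trees from the two ends of an edge
    avoid each other's root; \<open>q = p\<close> covers a single root.\<close>
  have branches: "\<exists>b i L. branch E V (A' - {p, q}) r (2 * z) X p b i L"
    if A': "A' = A \<or> A' = V - A" and pq: "p \<in> V" for A' p q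
  proof (rule branch_exists[OF G sp c'(1) c(2) c'(3) c(4,5) n _ pq _ _ \<epsilon> _ \<theta> r])
    show "A' - {p, q} \<subseteq> V" "p \<notin> A' - {p, q}" using A' A by auto
    show "\<delta> / 20 * n powr \<gamma> \<le> real (card (nbrs E v \<inter> (A' - {p, q})))" if "v \<in> V" for v
    proof -
      have "card (nbrs E v \<inter> A') - card {p, q} \<le> card (nbrs E v \<inter> A' - {p, q})"
        by (rule diff_card_le_card_Diff) simp
      moreover have "card {p, q} \<le> 2" by (simp add: card_insert_if)
      moreover have "nbrs E v \<inter> A' - {p, q} = nbrs E v \<inter> (A' - {p, q})" by blast
      ultimately have "card (nbrs E v \<inter> A') \<le> card (nbrs E v \<inter> (A' - {p, q})) + 2" by simp
      moreover have "?d / 10 \<le> real (card (nbrs E v \<inter> A'))" by (rule degA[OF A' that])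
      ultimately show ?thesis using big by simp
    qed
    show "0 < \<delta> / 20" using \<delta> by simp
    show "0 < 2 * z" "real (2 * Suc r * (2 * z)) \<le> \<epsilon> * n" using z by auto
  qed
  \<comment> \<open>Otherwise the two trees, which lie in opposite halves, would close a cycle of
    length \<open>k\<close>. So flags agree at a common root and differ along an edge.\<close>
  have type: "\<not> (p = q \<and> b \<noteq> b' \<or> {p, q} \<in> E \<and> b = b')"
    if "p \<in> V" "q \<in> V" "branch E V (A - {p, q}) r (2 * z) X p b i L" "branch E V (V - A - {p, q}) r (2 * z) X q b' j N"
    for p q b b' i j L N
  proof
    assume pair: "p = q \<and> b \<noteq> b' \<or> {p, q} \<in> E \<and> b = b'"
    have "contains (V, E) (cycle k)"
      by (rule close_branches[OF G X(1) _ _ _ that(1,2) _ _ _ _ dense z(1) that(3,4) roomX roomY k(1,3) pair])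
        (use A in auto)
    then show False using free by blast
  qed
  \<comment> \<open>The colour refers to trees in \<open>A\<close> alone. Comparison with a tree in
    \<open>V - A\<close> shows that all trees at \<open>p\<close>, in either half, carry this
    flag.\<close>
  define T where "T p = (\<exists>i L. branch E V (A - {p}) r (2 * z) X p True i L)" for p
  have T1: "b = T p" if "p \<in> V" "branch E V (A - {p, p}) r (2 * z) X p b i L" for p b i L
  proof -
    have "\<exists>b i L. branch E V (V - A - {p, p}) r (2 * z) X p b i L" by (rule branches) (use that in simp_all)
    then obtain b' j N where N: "branch E V (V - A - {p, p}) r (2 * z) X p b' j N" by (elim exE)
    have "b = b'" using type[OF that(1,1) that(2) N] by blast
    moreover have "b'" if "T p"
    proof -
      from \<open>T p\<close> obtain i' L' where "branch E V (A - {p}) r (2 * z) X p True i' L'"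
        unfolding T_def by (elim exE)
      then have "branch E V (A - {p, p}) r (2 * z) X p True i' L'" by simp
      then show ?thesis using type[OF \<open>p \<in> V\<close> \<open>p \<in> V\<close> _ N, of True] by blast
    qed
    moreover have "T p" if b
    proof -
      have "branch E V (A - {p}) r (2 * z) X p True i L"
        using \<open>branch E V (A - {p, p}) r (2 * z) X p b i L\<close> that by simp
      then show ?thesis unfolding T_def by (intro exI)
    qed
    ultimately show ?thesis by (cases b; cases "T p") simp_all
  qed
  have T2: "b' = T p" if "p \<in> V" "branch E V (V - A - {p, p}) r (2 * z) X p b' j N" for p b' j N
  proof -
    have "\<exists>b i L. branch E V (A - {p, p}) r (2 * z) X p b i L" by (rule branches) (use that in simp_all)
    then obtain b i L where L: "branch E V (A - {p, p}) r (2 * z) X p b i L" by (elim exE)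
    have "b = b'" using type[OF that(1,1) L that(2)] by blast
    then show ?thesis using T1[OF that(1) L] by simp
  qed
  show ?thesis
  proof (rule bipartiteI[OF G, of T])
    fix p q assume pq: "{p, q} \<in> E"
    then have V: "p \<in> V" "q \<in> V" using is_graph_edgeD[OF G] by blast+
    have "\<exists>b i L. branch E V (A - {p, q}) r (2 * z) X p b i L" by (rule branches) (use V in simp_all)
    then obtain b i L where L: "branch E V (A - {p, q}) r (2 * z) X p b i L" by (elim exE)
    have "\<exists>b i L. branch E V (V - A - {q, p}) r (2 * z) X q b i L" by (rule branches) (use V in simp_all)
    then obtain b' j N where N: "branch E V (V - A - {q, p}) r (2 * z) X q b' j N" by (elim exE)
    have N': "branch E V (V - A - {p, q}) r (2 * z) X q b' j N" using N by (simp only: insert_commute)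
    have "b \<noteq> b'" using type[OF V L N'] pq by blast
    \<comment> \<open>The tree also avoids \<open>q\<close>; forgetting this makes it a tree of the
      kind that determines the colour.\<close>
    moreover have "branch E V (A - {p, p}) r (2 * z) X p b i L" by (rule branch_mono[OF L]) auto
    then have "b = T p" by (rule T1[OF V(1)])
    moreover have "branch E V (V - A - {q, q}) r (2 * z) X q b' j N" by (rule branch_mono[OF N]) auto
    then have "b' = T q" by (rule T2[OF V(2)])
    ultimately show "T p \<noteq> T q" by blast
  qed
qed

section \<open>Asymptotic inequalities\<close>

lemma eventually_powr_less:
  fixes a b K \<kappa> :: real
  assumes "a < b" "0 < \<kappa>"
  shows "\<forall>\<^sub>F n in sequentially. K * real n powr a < \<kappa> * real n powr b"
proof -
  have "filterlim (\<lambda>n. real n powr (b - a)) at_top sequentially"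
    using assms by real_asymp
  then have "\<forall>\<^sub>F n in sequentially. K / \<kappa> < real n powr (b - a)"
    by (rule filterlim_at_top_dense[THEN iffD1, rule_format])
  moreover have "\<forall>\<^sub>F n in sequentially. 0 < n" by (rule eventually_gt_at_top)
  ultimately show ?thesis
  proof eventually_elim
    case (elim n)
    then have "K < \<kappa> * real n powr (b - a)" using assms by (simp add: field_simps)
    then have "K * real n powr a < \<kappa> * real n powr (b - a) * real n powr a"
      using elim by (intro mult_strict_right_mono) auto
    also have "\<dots> = \<kappa> * real n powr b" by (simp add: mult.assoc flip: powr_add)
    finally show ?case .
  qed
qed

text \<open>The left side is at most \<open>2 * n\<close> times an exponential with exponent a
  negative multiple of \<open>n powr \<gamma>\<close>, which outweighs the factor \<open>n\<close>
  from the sum over all neighbourhoods.\<close>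

lemma eventually_split_small:
  fixes \<delta> \<gamma> :: real
  assumes "0 < \<delta>" "0 < \<gamma>"
  shows "\<forall>\<^sub>F n in sequentially. 2 * real n * (3/4) powr (\<delta> * real n powr \<gamma>) * 2 powr (\<delta> * real n powr \<gamma> / 10) < 1"
proof -
  \<comment> \<open>By \<open>2 \<le> (6/5) powr 10\<close> the product is at most 9/10, and
    \<open>1 + x \<le> exp x\<close> at \<open>x = - 1/10\<close> turns this into an
    exponential.\<close>
  have base: "(3/4 :: real) * 2 powr (1/10) \<le> exp (- 1/10)"
  proof -
    have "(2 :: real) \<le> (6/5) powr 10" by (simp add: eval_nat_numeral)
    then have "(2 :: real) powr (1/10) \<le> ((6/5) powr 10) powr (1/10)" by (rule powr_mono2[rotated 2]) simp_all
    also have "\<dots> = 6/5" unfolding powr_powr by simp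
    finally have "(3/4 :: real) * 2 powr (1/10) \<le> 1 + (- 1/10)" by simp
    also have "\<dots> \<le> exp (- 1/10)" by (rule exp_ge_add_one_self)
    finally show ?thesis .
  qed
  have "((\<lambda>n. 2 * real n * exp (- (\<delta> * real n powr \<gamma> / 10))) \<longlongrightarrow> 0) sequentially"
    using assms by real_asymp
  then have "\<forall>\<^sub>F n in sequentially. 2 * real n * exp (- (\<delta> * real n powr \<gamma> / 10)) < 1"
    by (rule order_tendstoD) simp
  then show ?thesis
  proof eventually_elim
    case (elim n)
    let ?d = "\<delta> * real n powr \<gamma>"
    have "(3/4) powr ?d * 2 powr (?d / 10) = ((3/4) * 2 powr (1/10)) powr ?d"
      unfolding powr_mult powr_powr by simp
    also have "\<dots> \<le> exp (- 1/10) powr ?d" using base assms by (intro powr_mono2) auto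
    also have "\<dots> = exp (- (?d / 10))" by (simp add: powr_def)
    finally have "2 * real n * ((3/4) powr ?d * 2 powr (?d / 10)) \<le> 2 * real n * exp (- (?d / 10))"
      by (rule mult_left_mono) simp
    then show ?case using elim by (simp add: mult.assoc)
  qed
qed

section \<open>The core of a nearly extremal graph\<close>

lemma contains_mono:
  assumes "contains (V', E') H" "V' \<subseteq> V" "E' \<subseteq> E"
  shows "contains (V, E) H"
proof -
  obtain f where "inj_on f (verts H)" "f ` verts H \<subseteq> V'" "\<forall>e\<in>edges H. f ` e \<in> E'"
    using assms(1) unfolding contains_def by (auto simp: verts_def edges_def)
  then show ?thesis using assms(2,3) unfolding contains_def
    by (intro exI[of _ f]) (auto simp: verts_def edges_def)
qed

lemma sparse_subset:
  assumes G: "is_graph (V, E)" and sp: "sparse \<rho> C \<gamma> \<beta> V E" and sub: "V' \<subseteq> V" "E' \<subseteq> E"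
  shows "sparse \<rho> C \<gamma> \<beta> V' E'"
  unfolding sparse_def
proof (intro allI impI)
  fix P Q assume PQ: "P \<subseteq> V'" "Q \<subseteq> V'" "P \<inter> Q = {}" "card P \<le> card Q" "Q \<noteq> {}"
  have "card (btw E' P Q) \<le> card (btw E P Q)"
    by (rule card_mono[OF finite_btw[OF G]]) (use sub in \<open>auto simp: btw_def\<close>)
  moreover have "real (card (btw E P Q)) \<le> \<rho> * real (card P) * real (card Q) powr \<gamma> + C * real (card Q) powr \<beta>"
    using sp[unfolded sparse_def, rule_format, of P Q] PQ sub by (meson subset_trans)
  ultimately show "real (card (btw E' P Q)) \<le> \<rho> * real (card P) * real (card Q) powr \<gamma> + C * real (card Q) powr \<beta>"
    by linarith
qed

text \<open>The sizes of the two classes add up to \<open>card V\<close>, and the main term is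
  largest when they are equal.\<close>

lemma bipartite_sparse_edges:
  fixes n :: real
  assumes G: "is_graph (V, E)" and sp: "sparse \<rho> C \<gamma> \<beta> V E"
    and c: "0 \<le> \<rho>" "0 \<le> C" "0 \<le> \<gamma>" "\<gamma> \<le> 1" "0 \<le> \<beta>"
    and bip: "bipartite (V, E)" and n: "real (card V) \<le> n"
  shows "real (card E) \<le> \<rho> * (real (card V) / 2) powr (1 + \<gamma>) + C * n powr \<beta>"
proof -
  have fV: "finite V" using G by (simp add: is_graph_iff)
  obtain A where A: "\<forall>e\<in>E. card (e \<inter> A) = 1" using bip by (auto simp: bipartite_def edges_def)
  have cards: "card (V \<inter> A) + card (V - A) = card V" using card_Int_Diff[OF fV] by simp
  have bound: "real (card (btw E P Q)) \<le> \<rho> * (real (card V) / 2) powr (1 + \<gamma>) + C * n powr \<beta>"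
    if "P \<subseteq> V" "Q \<subseteq> V" "P \<inter> Q = {}" "card P \<le> card Q" "card P + card Q = card V" for P Q
  proof -
    have "real (card (btw E P Q)) \<le> \<rho> * real (card P) * real (card Q) powr \<gamma> + C * real (card Q) powr \<beta>"
      using that by (intro sparse_le[OF G sp c]) auto
    also have "\<rho> * real (card P) * real (card Q) powr \<gamma> \<le> \<rho> * ((real (card P) + real (card Q)) / 2) powr (1 + \<gamma>)"
      using that c mult_powr_le_half_powr[of "real (card P)" "real (card Q)" \<gamma>] by (simp add: mult.assoc mult_left_mono)
    also have "real (card P) + real (card Q) = real (card V)" using that(5) by linarith
    also have "C * real (card Q) powr \<beta> \<le> C * n powr \<beta>"
      using that(5) n c by (intro mult_left_mono powr_mono2) auto
    finally show ?thesis by simp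
  qed
  have "E \<subseteq> btw E (V \<inter> A) (V - A)"
  proof
    fix e assume e: "e \<in> E"
    obtain u v where uv: "e = {u, v}" "u \<noteq> v" "u \<in> V" "v \<in> V" using is_graph_edgeE[OF G e] by metis
    have "(u \<in> A) \<noteq> (v \<in> A)"
    proof (rule notI)
      assume "(u \<in> A) = (v \<in> A)"
      then have "e \<inter> A = e \<or> e \<inter> A = {}" using uv by auto
      then show False using A e uv by (auto simp: card_insert_if)
    qed
    then show "e \<in> btw E (V \<inter> A) (V - A)"
    proof (cases "u \<in> A")
      case True
      then show ?thesis using uv e \<open>(u \<in> A) \<noteq> (v \<in> A)\<close> by (auto simp: btw_def)
    next
      case False
      then have "e = {v, u}" "v \<in> V \<inter> A" "u \<in> V - A" using uv \<open>(u \<in> A) \<noteq> (v \<in> A)\<close> by auto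
      then show ?thesis using e unfolding btw_def by blast
    qed
  qed
  then have le: "card E \<le> card (btw E (V \<inter> A) (V - A))" by (rule card_mono[OF finite_btw[OF G]])
  show ?thesis
  proof (cases "card (V \<inter> A) \<le> card (V - A)")
    case True
    have "real (card (btw E (V \<inter> A) (V - A))) \<le> \<rho> * (real (card V) / 2) powr (1 + \<gamma>) + C * n powr \<beta>"
      by (rule bound) (use True cards in auto)
    then show ?thesis using le by linarith
  next
    case False
    have "real (card (btw E (V - A) (V \<inter> A))) \<le> \<rho> * (real (card V) / 2) powr (1 + \<gamma>) + C * n powr \<beta>"
      by (rule bound) (use False cards in auto)
    then show ?thesis using le unfolding btw_commute[of E "V \<inter> A"] by linarith
  qed
qed

text \<open>The order of the constants matters: \<epsilon>, \<theta>, \<open>r\<close>,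
  \<open>M0\<close> and \<open>D\<close>, hence the threshold for \<open>k\<close>, come from
  \<rho>, \<gamma> and \<beta>, whereas \<open>\<epsilon>'\<close> and the bound on \<open>n\<close>
  may depend on \<open>k\<close>. The deficit \<open>C1\<close> is allowed because an extremal graph
  is only known to have as many edges as the best bipartite one.\<close>

lemma dense_graph_near_bipartite:
  fixes \<rho> C C1 \<gamma> \<beta> \<delta> :: real
  assumes c: "0 < \<rho>" "0 < C" "0 \<le> C1" "0 < \<gamma>" "\<gamma> < 1" "1 \<le> \<beta>" "\<beta> < 1 + \<gamma>"
    and \<delta>_def: "\<delta> = \<rho> * (1/2) powr (1 + \<gamma>) / 2"
  shows "\<exists>k0. \<forall>k. odd k \<and> k0 \<le> k \<longrightarrow> (\<exists>N. \<forall>n\<ge>N. \<forall>V E. is_graph (V, E) \<longrightarrow> card V = n \<longrightarrow>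
      sparse \<rho> C \<gamma> \<beta> V E \<longrightarrow> \<not> contains (V, E) (cycle k) \<longrightarrow>
      \<rho> * (real n / 2) powr (1 + \<gamma>) - C1 * real n powr \<beta> \<le> real (card E) \<longrightarrow>
      (\<exists>S\<subseteq>V. real (card S) \<le> (C + C1) / \<delta> * real n powr (\<beta> - \<gamma>) \<and>
        real (card {e \<in> E. e \<inter> S \<noteq> {}}) \<le> (C + C1) * real n powr \<beta> \<and>
        bipartite (V - S, {e \<in> E. e \<inter> S = {}})))"
proof -
  have \<delta>: "0 < \<delta>" using c by (simp add: \<delta>_def)
  have half: "\<rho> * (x / 2) powr (1 + \<gamma>) = 2 * \<delta> * (x * x powr \<gamma>)" if "0 \<le> x" for x
  proof -
    have "(x / 2) powr (1 + \<gamma>) = x powr (1 + \<gamma>) * (1/2) powr (1 + \<gamma>)"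
      using powr_mult[of x "1/2" "1 + \<gamma>"] by simp
    also have "x powr (1 + \<gamma>) = x * x powr \<gamma>" using that by (simp add: powr_mult_base)
    finally show ?thesis by (simp add: \<delta>_def)
  qed
  define \<epsilon> where "\<epsilon> = (\<delta> / (320 * \<rho>)) powr (1 / \<gamma>)"
  have \<epsilon>: "0 < \<epsilon>" "16 * \<rho> * \<epsilon> powr \<gamma> \<le> \<delta> / 20"
    using c \<delta> by (auto simp: \<epsilon>_def powr_powr)
  define \<theta> where "\<theta> = (1 + \<gamma> - \<beta>) / 2"
  have \<theta>: "0 < \<theta>" using c by (simp add: \<theta>_def)
  obtain r where r: "1 < real r * \<theta>" using reals_Archimedean3[OF \<theta>] by blast
  obtain M0 where M0: "1 < real M0 * \<epsilon>" using reals_Archimedean3[OF \<epsilon>(1)] by blast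
  then have M: "1 < real (Suc M0) * \<epsilon>" using \<epsilon>(1) by (simp add: algebra_simps)
  define D where "D = M0 * (2 * r + 1)"
  show ?thesis
  proof (rule exI[of _ "2 * D + 2 * r + 3"], intro allI impI)
    fix k assume k: "odd k \<and> 2 * D + 2 * r + 3 \<le> k"
    define m where "m = 8 * Suc r + 2 * k"
    define \<epsilon>' where "\<epsilon>' = min (\<epsilon> / (8 * real (Suc r))) (\<delta> / (4 * \<rho> * real m))"
    have m: "0 < m" by (simp add: m_def)
    have \<epsilon>': "0 < \<epsilon>'" using \<epsilon>(1) \<delta> c m by (simp add: \<epsilon>'_def)
    have \<epsilon>'1: "8 * real (Suc r) * \<epsilon>' \<le> \<epsilon>"
    proof -
      have "\<epsilon>' \<le> \<epsilon> / (8 * real (Suc r))" by (simp add: \<epsilon>'_def)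
      then show ?thesis by (simp add: field_simps)
    qed
    have \<epsilon>'2: "4 * \<rho> * real m * \<epsilon>' \<le> \<delta>"
    proof -
      have "\<epsilon>' \<le> \<delta> / (4 * \<rho> * real m)" by (simp add: \<epsilon>'_def)
      then show ?thesis using c m by (simp add: field_simps)
    qed
    \<comment> \<open>\<open>e1\<close> and \<open>e2\<close> become \<open>room\<close> and
      \<open>gap\<close>. This is where \<beta> < 1 + \<gamma> makes errors and edges inside the
      sides negligible.\<close>
    have e1: "\<forall>\<^sub>F n in sequentially. (C + real (2 * D * k) + C1) * real n powr \<beta> < \<delta> / 2 * real n powr (1 + \<gamma>)"
      using c \<delta> by (intro eventually_powr_less) auto
    have e2: "\<forall>\<^sub>F n in sequentially. (C1 + real (2 * D * k) + 2 * C) * real n powr \<beta> < \<rho> * \<gamma> * \<epsilon>'\<^sup>2 * real n powr (1 + \<gamma>)"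
      using c \<epsilon>' by (intro eventually_powr_less) auto
    have e3: "\<forall>\<^sub>F n in sequentially. 40 * real n powr 0 < \<delta> * real n powr \<gamma>"
      using c \<delta> by (intro eventually_powr_less) auto
    have e4: "\<forall>\<^sub>F n in sequentially. 1 * real n powr \<theta> < \<delta> / 20 / (16 * C) * real n powr (\<gamma> + 1 - \<beta>)"
      using c \<delta> \<theta> by (intro eventually_powr_less) (auto simp: \<theta>_def)
    have e5: "\<forall>\<^sub>F n in sequentially. 1 * real n powr 0 < \<epsilon>' * real n powr 1"
      using \<epsilon>' by (intro eventually_powr_less) auto
    have e6: "\<forall>\<^sub>F n in sequentially. 2 * real n * (3/4) powr (\<delta> * real n powr \<gamma>) * 2 powr (\<delta> * real n powr \<gamma> / 10) < 1"
      using \<delta> c(4) by (rule eventually_split_small)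
    have "\<forall>\<^sub>F n in sequentially. \<forall>V E. is_graph (V, E) \<longrightarrow> card V = n \<longrightarrow>
      sparse \<rho> C \<gamma> \<beta> V E \<longrightarrow> \<not> contains (V, E) (cycle k) \<longrightarrow>
      \<rho> * (real n / 2) powr (1 + \<gamma>) - C1 * real n powr \<beta> \<le> real (card E) \<longrightarrow>
      (\<exists>S\<subseteq>V. real (card S) \<le> (C + C1) / \<delta> * real n powr (\<beta> - \<gamma>) \<and>
        real (card {e \<in> E. e \<inter> S \<noteq> {}}) \<le> (C + C1) * real n powr \<beta> \<and>
        bipartite (V - S, {e \<in> E. e \<inter> S = {}}))"
      using e1 e2 e3 e4 e5 e6 eventually_gt_at_top[of 1]
    proof eventually_elim
      case (elim n)
      let ?n = "real n"
      have n1: "1 < ?n" using elim(7) by simp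
      show ?case
      proof (intro allI impI)
        fix V E
        assume G: "is_graph (V, E)" and Vn: "card V = n" and sp: "sparse \<rho> C \<gamma> \<beta> V E"
          and free: "\<not> contains (V, E) (cycle k)"
          and lower: "\<rho> * (?n / 2) powr (1 + \<gamma>) - C1 * ?n powr \<beta> \<le> real (card E)"
        have fV: "finite V" and fE: "finite E" using G is_graph_finite_edges[OF G] by (auto simp: is_graph_iff)
        obtain S where S: "S \<subseteq> V" "real (card {e \<in> E. e \<inter> S \<noteq> {}}) \<le> \<delta> * ?n powr \<gamma> * real (card S)"
          "\<forall>v\<in>V - S. \<delta> * ?n powr \<gamma> \<le> real (card (nbrs E v - S))"
          using core_exists[OF G, of "\<delta> * ?n powr \<gamma>"] by (elim exE conjE)
        define V' where "V' = V - S"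
        define E' where "E' = {e \<in> E. e \<inter> S = {}}"
        have G': "is_graph (V', E')" using G by (auto simp: is_graph_iff V'_def E'_def)
        have sp': "sparse \<rho> C \<gamma> \<beta> V' E'" by (rule sparse_subset[OF G sp]) (auto simp: V'_def E'_def)
        have free': "\<not> contains (V', E') (cycle k)"
        proof
          assume "contains (V', E') (cycle k)"
          then have "contains (V, E) (cycle k)" by (rule contains_mono) (auto simp: V'_def E'_def)
          then show False using free by blast
        qed
        have deg: "\<delta> * ?n powr \<gamma> \<le> real (card (nbrs E' v))" if "v \<in> V'" for v
        proof -
          have "nbrs E' v = nbrs E v - S" using that by (auto simp: nbrs_def E'_def V'_def)
          then show ?thesis using S(3) that by (simp add: V'_def)
        qed
        let ?s = "real (card S)"
        have sn: "card S \<le> n" using card_mono[OF fV S(1)] Vn by simp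
        have V'n: "real (card V') = ?n - ?s"
          using card_Diff_subset[OF finite_subset[OF S(1) fV] S(1)] sn Vn by (simp add: V'_def of_nat_diff)
        have E'E: "real (card E) = real (card E') + real (card {e \<in> E. e \<inter> S \<noteq> {}})"
        proof -
          have "E = E' \<union> {e \<in> E. e \<inter> S \<noteq> {}}" "E' \<inter> {e \<in> E. e \<inter> S \<noteq> {}} = {}" by (auto simp: E'_def)
          then have "card E = card E' + card {e \<in> E. e \<inter> S \<noteq> {}}"
            using card_Un_disjoint[of E' "{e \<in> E. e \<inter> S \<noteq> {}}"] fE by (simp add: E'_def)
          then show ?thesis by simp
        qed
        \<comment> \<open>Only the factor under the power is enlarged to \<open>n\<close>; the
          linear factor must keep the loss of \<open>?s\<close>.\<close>
        have V'half: "\<rho> * (real (card V') / 2) powr (1 + \<gamma>) \<le> 2 * \<delta> * ((?n - ?s) * ?n powr \<gamma>)"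
        proof -
          have "real (card V') * real (card V') powr \<gamma> \<le> real (card V') * ?n powr \<gamma>"
            using c V'n by (intro mult_left_mono powr_mono2) auto
          then show ?thesis using half[of "real (card V')"] \<delta> V'n by (simp add: mult.assoc)
        qed
        have "2 * \<delta> * (?n * ?n powr \<gamma>) - C1 * ?n powr \<beta> - \<delta> * ?n powr \<gamma> * ?s \<le> real (card E')"
          using lower half[of ?n] E'E S(2) by simp
        \<comment> \<open>The upper bound for a bipartite graph on \<open>V'\<close> has the same
          first term, so \<open>\<delta> * ?n powr \<gamma> * ?s\<close> is the surplus that will
          bound \<open>S\<close>.\<close>
        then have low: "2 * \<delta> * ((?n - ?s) * ?n powr \<gamma>) + \<delta> * ?n powr \<gamma> * ?s - C1 * ?n powr \<beta> \<le> real (card E')"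
          by (simp add: algebra_simps)
        have pos: "0 \<le> \<delta> * ?n powr \<gamma> * ?s" using \<delta> by simp
        have big: "\<delta> * (?n * ?n powr \<gamma>) - C1 * ?n powr \<beta> \<le> real (card E')"
        proof -
          have "0 \<le> \<delta> * ((?n - ?s) * ?n powr \<gamma>)" using \<delta> sn by simp
          then show ?thesis using low by (simp add: algebra_simps)
        qed
        define z where "z = nat \<lceil>\<epsilon>' * ?n\<rceil>"
        have "1 < \<epsilon>' * ?n" using elim(5) n1 by simp
        then have z: "\<epsilon>' * ?n \<le> real z" "real z \<le> 2 * (\<epsilon>' * ?n)" "0 < z"
          unfolding z_def by linarith+
        have n\<beta>: "?n \<le> ?n powr \<beta>" using powr_mono[of 1 \<beta> ?n] c n1 by simp
        have Dk: "real (2 * D * k) * ?n \<le> real (2 * D * k) * ?n powr \<beta>" using n\<beta> by (rule mult_left_mono) simp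
        have npow: "?n powr (1 + \<gamma>) = ?n * ?n powr \<gamma>" using n1 by (simp add: powr_mult_base)
        have bip: "bipartite (V', E')"
        proof (rule min_degree_bipartite[OF G' sp' c(1,2,4) _ c(6) _ n1 deg \<epsilon> \<delta> _ r M D_def _ _ _ free' elim(6) _ z(3)])
          show "\<gamma> \<le> 1" using c by simp
          show "real (card V') \<le> ?n" using V'n by simp
          show "?n powr \<theta> \<le> \<delta> / 20 / (16 * C) * ?n powr (\<gamma> + 1 - \<beta>)" using elim(4) by simp
          show "odd k" "2 * D < k" "2 * r + 2 < k" using k by auto
          show "40 \<le> \<delta> * ?n powr \<gamma>" using elim(3) n1 by simp
          show "real (2 * Suc r * (2 * z)) \<le> \<epsilon> * ?n"
          proof -
            have "real (2 * Suc r * (2 * z)) = 4 * real (Suc r) * real z" by (simp add: algebra_simps)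
            also have "\<dots> \<le> 4 * real (Suc r) * (2 * (\<epsilon>' * ?n))" using z(2) by (intro mult_left_mono) auto
            also have "\<dots> = 8 * real (Suc r) * \<epsilon>' * ?n" by simp
            also have "\<dots> \<le> \<epsilon> * ?n" using \<epsilon>'1 by (rule mult_right_mono) simp
            finally show ?thesis .
          qed
          show "\<rho> * (real (card V') / 2) powr (1 + \<gamma>) - C1 * ?n powr \<beta> \<le> real (card E')"
            using V'half low pos by linarith
          show "C1 * ?n powr \<beta> + real (2 * D * k) * ?n + 2 * C * ?n powr \<beta> < \<rho> * \<gamma> * (real z)\<^sup>2 * ?n powr (\<gamma> - 1)"
          proof -
            have "(\<epsilon>' * ?n)\<^sup>2 \<le> (real z)\<^sup>2" using z(1) \<epsilon>' by (intro power_mono) auto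
            then have "\<rho> * \<gamma> * (\<epsilon>' * ?n)\<^sup>2 * ?n powr (\<gamma> - 1) \<le> \<rho> * \<gamma> * (real z)\<^sup>2 * ?n powr (\<gamma> - 1)"
              using c by (intro mult_right_mono mult_left_mono) auto
            moreover have "?n\<^sup>2 * ?n powr (\<gamma> - 1) = ?n powr (1 + \<gamma>)"
              using n1 by (simp add: powr_diff npow power2_eq_square)
            then have "\<rho> * \<gamma> * (\<epsilon>' * ?n)\<^sup>2 * ?n powr (\<gamma> - 1) = \<rho> * \<gamma> * \<epsilon>'\<^sup>2 * ?n powr (1 + \<gamma>)"
              by (simp add: power_mult_distrib mult.assoc)
            moreover have "(C1 + real (2 * D * k) + 2 * C) * ?n powr \<beta> =
                C1 * ?n powr \<beta> + real (2 * D * k) * ?n powr \<beta> + 2 * C * ?n powr \<beta>"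
              by (simp only: distrib_right)
            ultimately show ?thesis using elim(2) Dk by linarith
          qed
          show "\<rho> * real ((8 * Suc r + 2 * k) * z) * ?n powr \<gamma> + C * ?n powr \<beta> + real (2 * D * k) * ?n < real (card E')"
          proof -
            have "\<rho> * real ((8 * Suc r + 2 * k) * z) = \<rho> * real m * real z" unfolding m_def by (simp only: of_nat_mult mult.assoc)
            also have "\<dots> \<le> \<rho> * real m * (2 * (\<epsilon>' * ?n))" using z(2) c by (intro mult_left_mono) auto
            also have "\<dots> = (4 * \<rho> * real m * \<epsilon>') * ?n / 2" by simp
            also have "\<dots> \<le> \<delta> * ?n / 2" using mult_right_mono[OF \<epsilon>'2, of ?n] by linarith
            finally have "\<rho> * real ((8 * Suc r + 2 * k) * z) * ?n powr \<gamma> \<le> \<delta> * ?n / 2 * ?n powr \<gamma>"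
              by (rule mult_right_mono) simp
            moreover have "\<delta> * ?n / 2 * ?n powr \<gamma> = \<delta> / 2 * ?n powr (1 + \<gamma>)" by (simp add: npow)
            moreover have "\<delta> * (?n * ?n powr \<gamma>) = \<delta> / 2 * ?n powr (1 + \<gamma>) + \<delta> / 2 * ?n powr (1 + \<gamma>)" by (simp add: npow)
            moreover have "(C + real (2 * D * k) + C1) * ?n powr \<beta> =
                C * ?n powr \<beta> + real (2 * D * k) * ?n powr \<beta> + C1 * ?n powr \<beta>"
              by (simp only: distrib_right)
            ultimately show ?thesis using elim(1) Dk big by linarith
          qed
        qed
        have "real (card E') \<le> \<rho> * (real (card V') / 2) powr (1 + \<gamma>) + C * ?n powr \<beta>"
          by (rule bipartite_sparse_edges[OF G' sp' _ _ _ _ _ bip]) (use c V'n in auto)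
        \<comment> \<open>Bipartiteness of the core makes the upper bound available, and the surplus
          has to fit into the error terms.\<close>
        then have deficit: "\<delta> * ?n powr \<gamma> * ?s \<le> (C + C1) * ?n powr \<beta>"
          using V'half low by (simp add: distrib_right)
        have "?s = \<delta> * ?n powr \<gamma> * ?s / (\<delta> * ?n powr \<gamma>)" using \<delta> n1 by simp
        also have "\<dots> \<le> (C + C1) * ?n powr \<beta> / (\<delta> * ?n powr \<gamma>)"
          using deficit \<delta> by (intro divide_right_mono) auto
        also have "\<dots> = (C + C1) / \<delta> * ?n powr (\<beta> - \<gamma>)" by (simp add: powr_diff)
        finally have "?s \<le> (C + C1) / \<delta> * ?n powr (\<beta> - \<gamma>)" .
        moreover have "real (card {e \<in> E. e \<inter> S \<noteq> {}}) \<le> (C + C1) * ?n powr \<beta>" using S(2) deficit by linarith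
        ultimately show "\<exists>S\<subseteq>V. real (card S) \<le> (C + C1) / \<delta> * ?n powr (\<beta> - \<gamma>) \<and>
            real (card {e \<in> E. e \<inter> S \<noteq> {}}) \<le> (C + C1) * ?n powr \<beta> \<and>
            bipartite (V - S, {e \<in> E. e \<inter> S = {}})"
          using S(1) bip unfolding V'_def E'_def by (intro exI[of _ S] conjI)
      qed
    qed
    then show "\<exists>N. \<forall>n\<ge>N. \<forall>V E. is_graph (V, E) \<longrightarrow> card V = n \<longrightarrow>
      sparse \<rho> C \<gamma> \<beta> V E \<longrightarrow> \<not> contains (V, E) (cycle k) \<longrightarrow>
      \<rho> * (real n / 2) powr (1 + \<gamma>) - C1 * real n powr \<beta> \<le> real (card E) \<longrightarrow>
      (\<exists>S\<subseteq>V. real (card S) \<le> (C + C1) / \<delta> * real n powr (\<beta> - \<gamma>) \<and>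
        real (card {e \<in> E. e \<inter> S \<noteq> {}}) \<le> (C + C1) * real n powr \<beta> \<and>
        bipartite (V - S, {e \<in> E. e \<inter> S = {}}))"
      unfolding eventually_sequentially .
  qed
qed

section \<open>Extremal numbers\<close>

text \<open>A crude bound that serves to make the sets of edge counts finite, so that nonempty ones
  attain their suprema.\<close>

lemma card_edges_le:
  assumes "is_graph G"
  shows "card (edges G) \<le> 2 ^ card (verts G)"
proof -
  have "finite (verts G)" "edges G \<subseteq> Pow (verts G)" using assms by (auto simp: is_graph_def)
  then show ?thesis using card_mono[of "Pow (verts G)" "edges G"] by (simp add: card_Pow)
qed

lemma finite_edge_counts:
  assumes "\<And>G. P G \<Longrightarrow> is_graph G \<and> card (verts G) = n"
  shows "finite {card (edges G) | G. P G}"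
proof (rule finite_subset)
  show "{card (edges G) | G. P G} \<subseteq> {..2 ^ n}" using card_edges_le assms by fastforce
qed simp

lemma Sup_nat_mem: "finite X \<Longrightarrow> X \<noteq> {} \<Longrightarrow> Sup X \<in> (X :: nat set)"
  by (simp add: Sup_nat_def)

text \<open>The supremum of the empty set of naturals is 0, which gives the first alternative when
  no graph satisfies \<open>P\<close>.\<close>

lemma Sup_edge_counts_attained:
  assumes "\<And>G. P G \<Longrightarrow> is_graph G \<and> card (verts G) = n"
  shows "Sup {card (edges G) | G. P G} = 0 \<or> (\<exists>G. P G \<and> card (edges G) = Sup {card (edges G) | G. P G})"
proof (cases "{card (edges G) | G. P G} = {}")
  case True
  show ?thesis unfolding True by (simp add: Sup_nat_def)
next
  case False
  have "finite {card (edges G) | G. P G}" by (rule finite_edge_counts) (rule assms)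
  then have "Sup {card (edges G) | G. P G} \<in> {card (edges G) | G. P G}"
    using False by (rule Sup_nat_mem)
  then show ?thesis by fastforce
qed

lemma le_Sup_edge_counts:
  assumes "\<And>G. P G \<Longrightarrow> is_graph G \<and> card (verts G) = n" "P H"
  shows "card (edges H) \<le> Sup {card (edges G) | G. P G}"
proof (rule le_cSup_finite)
  show "finite {card (edges G) | G. P G}" by (rule finite_edge_counts) (rule assms(1))
  show "card (edges H) \<in> {card (edges G) | G. P G}" using assms(2) by blast
qed

lemma free_subgraph:
  assumes "free F (V, E)" "V' \<subseteq> V" "E' \<subseteq> E"
  shows "free F (V', E')"
  using assms contains_mono unfolding free_def by blast

text \<open>Names the class of graphs under the supremum in \<open>zmn\<close>, so that the general
  facts on edge counts apply to it.\<close>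

definition zmn_graph :: "nat \<Rightarrow> nat \<Rightarrow> graph set \<Rightarrow> graph \<Rightarrow> bool" where
  "zmn_graph m n F G \<longleftrightarrow> is_graph G \<and> free F G \<and>
      (\<exists>A B. verts G = A \<union> B \<and> A \<inter> B = {} \<and> card A = m \<and> card B = n \<and>
        (\<forall>e\<in>edges G. \<exists>a\<in>A. \<exists>b\<in>B. e = {a, b}))"

lemma zmn_eq: "zmn m n F = Sup {card (edges G) | G. zmn_graph m n F G}"
  unfolding zmn_def zmn_graph_def by (rule refl)

lemma zmn_graph_card: "zmn_graph m n F G \<Longrightarrow> is_graph G \<and> card (verts G) = m + n"
  by (auto simp: zmn_graph_def is_graph_def card_Un_disjoint)

lemma btw_le_zmn:
  assumes G: "is_graph (V, E)" and F: "free F (V, E)" and PQ: "P \<subseteq> V" "Q \<subseteq> V" "P \<inter> Q = {}"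
  shows "card (btw E P Q) \<le> zmn (card P) (card Q) F"
proof -
  let ?H = "(P \<union> Q, btw E P Q)"
  have "is_graph ?H"
    unfolding is_graph_iff
  proof (intro conjI ballI)
    show "finite (P \<union> Q)" using PQ G finite_subset by (auto simp: is_graph_iff)
    fix e assume "e \<in> btw E P Q"
    then show "e \<subseteq> P \<union> Q" "card e = 2" using G by (auto simp: is_graph_iff btw_def)
  qed
  moreover have "free F ?H" by (rule free_subgraph[OF F]) (use PQ in \<open>auto simp: btw_def\<close>)
  ultimately have "zmn_graph (card P) (card Q) F ?H"
    using PQ(3) unfolding zmn_graph_def verts_def edges_def by (auto simp: btw_def)
  with zmn_graph_card have "card (edges ?H) \<le> zmn (card P) (card Q) F"
    unfolding zmn_eq by (rule le_Sup_edge_counts)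
  then show ?thesis by (simp add: edges_def)
qed

lemma card_edges_le_zn:
  assumes "is_graph G \<and> card (verts G) = n \<and> bipartite G \<and> free F G"
  shows "card (edges G) \<le> zn n F"
  unfolding zn_def
  using le_Sup_edge_counts[of "\<lambda>G. is_graph G \<and> card (verts G) = n \<and> bipartite G \<and> free F G" n G, OF _ assms]
  by simp

lemma zn_attained:
  "zn n F = 0 \<or> (\<exists>G. (is_graph G \<and> card (verts G) = n \<and> bipartite G \<and> free F G) \<and> card (edges G) = zn n F)"
  unfolding zn_def
  using Sup_edge_counts_attained[of "\<lambda>G. is_graph G \<and> card (verts G) = n \<and> bipartite G \<and> free F G" n]
  by simp

lemma card_edges_le_ex:
  assumes "is_graph G \<and> card (verts G) = n \<and> free F G"
  shows "card (edges G) \<le> ex n F"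
  unfolding ex_def
  using le_Sup_edge_counts[of "\<lambda>G. is_graph G \<and> card (verts G) = n \<and> free F G" n G, OF _ assms]
  by simp

lemma ex_attained:
  "ex n F = 0 \<or> (\<exists>G. (is_graph G \<and> card (verts G) = n \<and> free F G) \<and> card (edges G) = ex n F)"
  unfolding ex_def
  using Sup_edge_counts_attained[of "\<lambda>G. is_graph G \<and> card (verts G) = n \<and> free F G" n]
  by simp

lemma zmn_le_zn: "zmn m n F \<le> zn (m + n) F"
proof -
  have "zmn m n F = 0 \<or> (\<exists>G. zmn_graph m n F G \<and> card (edges G) = zmn m n F)"
    unfolding zmn_eq by (rule Sup_edge_counts_attained) (rule zmn_graph_card)
  then consider "zmn m n F = 0" | G where "zmn_graph m n F G" "card (edges G) = zmn m n F"
    by metis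
  then show ?thesis
  proof cases
    case 2
    from 2(1) obtain A B where AB: "verts G = A \<union> B" "A \<inter> B = {}" "\<forall>e\<in>edges G. \<exists>a\<in>A. \<exists>b\<in>B. e = {a, b}"
      unfolding zmn_graph_def by blast
    have "card (e \<inter> A) = 1" if "e \<in> edges G" for e
    proof -
      from that AB(3) obtain a b where "a \<in> A" "b \<in> B" "e = {a, b}" by blast
      then have "e \<inter> A = {a}" using AB(2) by auto
      then show ?thesis by simp
    qed
    then have "bipartite G" unfolding bipartite_def by blast
    then have "is_graph G \<and> card (verts G) = m + n \<and> bipartite G \<and> free F G"
      using 2(1) zmn_graph_card[OF 2(1)] by (simp add: zmn_graph_def)
    then have "card (edges G) \<le> zn (m + n) F" by (rule card_edges_le_zn)
    then show ?thesis using 2(2) by simp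
  qed simp
qed

section \<open>Comparison with bipartite extremal numbers\<close>

text \<open>Membership in the class \<open>A\<close> alternates along the cycle, so positions 0 and
  \<open>k - 1\<close> lie on the same side for odd \<open>k\<close>, although they are
  adjacent.\<close>

lemma odd_cycle_not_in_bipartite:
  assumes bip: "bipartite G" and k: "odd k" "3 \<le> k"
  shows "\<not> contains G (cycle k)"
proof
  assume "contains G (cycle k)"
  then obtain f where f0: "inj_on f (verts (cycle k))" "\<forall>e\<in>edges (cycle k). f ` e \<in> edges G"
    unfolding contains_def by (elim exE conjE)
  have f: "inj_on f {0..<k}" using f0(1) by (simp add: cycle_def verts_def)
  have fe: "f ` {i, (i + 1) mod k} \<in> edges G" if "i < k" for i
  proof -
    have "{i, (i + 1) mod k} \<in> edges (cycle k)" using that unfolding cycle_def edges_def by auto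
    then show ?thesis using f0(2) by blast
  qed
  obtain A where A0: "\<forall>e\<in>edges G. card (e \<inter> A) = 1" using bip unfolding bipartite_def by (elim exE)
  then have A: "card (e \<inter> A) = 1" if "e \<in> edges G" for e using that by blast
  have alt: "(f i \<in> A) \<noteq> (f ((i + 1) mod k) \<in> A)" if i: "i < k" for i
  proof
    assume eq: "(f i \<in> A) = (f ((i + 1) mod k) \<in> A)"
    have ne: "i \<noteq> (i + 1) mod k" using i k by (cases "i + 1 = k") auto
    moreover have "(i + 1) mod k < k" using k by simp
    ultimately have fne: "f i \<noteq> f ((i + 1) mod k)" using f i by (auto simp: inj_on_def)
    have "card ({f i, f ((i + 1) mod k)} \<inter> A) = 1" using A[OF fe[OF i]] by simp
    then show False using eq fne by (cases "f i \<in> A") auto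
  qed
  have par: "(f i \<in> A) = ((f 0 \<in> A) = even i)" if "i < k" for i using that
  proof (induction i)
    case (Suc i)
    then show ?case using alt[of i] by auto
  qed simp
  have "k - 1 < k" "even (k - 1)" "(k - 1 + 1) mod k = 0" using k by auto
  then show False using par[of "k - 1"] alt[of "k - 1"] by simp
qed

lemma zn_le_ex:
  assumes "odd k" "3 \<le> k"
  shows "zn n F \<le> ex n (F \<union> {cycle k})"
proof -
  consider "zn n F = 0" | G where "is_graph G \<and> card (verts G) = n \<and> bipartite G \<and> free F G" "card (edges G) = zn n F"
    using zn_attained[of n F] by metis
  then show ?thesis
  proof cases
    case 2
    then have "\<not> contains G (cycle k)" using odd_cycle_not_in_bipartite[OF _ assms] by blast
    then have "is_graph G \<and> card (verts G) = n \<and> free (F \<union> {cycle k}) G"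
      using 2(1) by (auto simp: free_def)
    then have "card (edges G) \<le> ex n (F \<union> {cycle k})" by (rule card_edges_le_ex)
    then show ?thesis using 2(2) by simp
  qed simp
qed

text \<open>Parts \<open>n div 2\<close> and \<open>(n + 1) div 2\<close> nearly attain the balanced
  main term. Rounding costs at most \<open>\<rho> * (n / 2) powr \<gamma> / 2\<close>, which is
  below \<open>\<rho> * n powr \<beta>\<close> and accounts for the constant
  \<open>C + \<rho>\<close>.\<close>

lemma zn_lower_bound:
  fixes \<rho> C \<gamma> \<beta> :: real
  assumes z: "\<And>m n. m \<le> n \<Longrightarrow> 1 \<le> n \<Longrightarrow> \<rho> * real m * real n powr \<gamma> - C * real n powr \<beta> \<le> real (zmn m n F)"
    and c: "0 < \<rho>" "0 < C" "0 < \<gamma>" "\<gamma> < 1" "1 \<le> \<beta>" and n: "1 \<le> n"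
  shows "\<rho> * (real n / 2) powr (1 + \<gamma>) - (C + \<rho>) * real n powr \<beta> \<le> real (zn n F)"
proof -
  let ?a = "n div 2" and ?b = "(n + 1) div 2"
  have ab: "?a + ?b = n" "?a \<le> ?b" "1 \<le> ?b" "?b \<le> n" using n by presburger+
  have "n \<le> 2 * ?a + 1" "n \<le> 2 * ?b" by presburger+
  then have "real n \<le> real (2 * ?a + 1)" "real n \<le> real (2 * ?b)" by (simp_all only: of_nat_le_iff)
  then have ra: "(real n - 1) / 2 \<le> real ?a" and rb: "real n / 2 \<le> real ?b" by simp_all
  have "\<rho> * ((real n - 1) / 2 * (real n / 2) powr \<gamma>) \<le> \<rho> * (real ?a * real ?b powr \<gamma>)"
    using ra rb c n by (intro mult_left_mono mult_mono powr_mono2) auto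
  moreover have "C * real ?b powr \<beta> \<le> C * real n powr \<beta>"
    using ab c by (intro mult_left_mono powr_mono2) auto
  moreover have "\<rho> * real ?a * real ?b powr \<gamma> - C * real ?b powr \<beta> \<le> real (zn n F)"
    using z[OF ab(2,3)] zmn_le_zn[of ?a ?b F] ab(1) by simp
  moreover have "\<rho> * ((real n - 1) / 2 * (real n / 2) powr \<gamma>) =
      \<rho> * (real n / 2) powr (1 + \<gamma>) - \<rho> * (real n / 2) powr \<gamma> / 2"
  proof -
    have "(real n / 2) powr (1 + \<gamma>) = real n / 2 * (real n / 2) powr \<gamma>"
      using n by (simp add: powr_add)
    then show ?thesis by (simp add: field_simps)
  qed
  moreover have "\<rho> * (real n / 2) powr \<gamma> / 2 \<le> \<rho> * real n powr \<beta>"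
  proof -
    have "(real n / 2) powr \<gamma> \<le> real n powr \<gamma>" using c by (intro powr_mono2) auto
    also have "\<dots> \<le> real n powr \<beta>" using n c by (intro powr_mono) auto
    finally have "\<rho> * (real n / 2) powr \<gamma> \<le> \<rho> * real n powr \<beta>" using c by (intro mult_left_mono) auto
    moreover have "0 \<le> \<rho> * (real n / 2) powr \<gamma>" using c by simp
    ultimately show ?thesis by linarith
  qed
  ultimately show ?thesis unfolding distrib_right mult.assoc by linarith
qed

lemma sparse_of_free:
  assumes z: "\<And>m n. m \<le> n \<Longrightarrow> 1 \<le> n \<Longrightarrow> real (zmn m n F) \<le> \<rho> * real m * real n powr \<gamma> + C * real n powr \<beta>"
    and G: "is_graph (V, E)" and F: "free F (V, E)"
  shows "sparse \<rho> C \<gamma> \<beta> V E"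
  unfolding sparse_def
proof (intro allI impI)
  fix P Q assume PQ: "P \<subseteq> V" "Q \<subseteq> V" "P \<inter> Q = {}" "card P \<le> card Q" "Q \<noteq> {}"
  have "finite Q" using PQ(2) G finite_subset by (auto simp: is_graph_iff)
  then have "1 \<le> card Q" using PQ(5) by (simp add: Suc_leI card_gt_0_iff)
  then have "real (zmn (card P) (card Q) F) \<le> \<rho> * real (card P) * real (card Q) powr \<gamma> + C * real (card Q) powr \<beta>"
    by (rule z[OF PQ(4)])
  then show "real (card (btw E P Q)) \<le> \<rho> * real (card P) * real (card Q) powr \<gamma> + C * real (card Q) powr \<beta>"
    using btw_le_zmn[OF G F PQ(1-3)] by linarith
qed

theorem mainTheorem2:
  fixes \<alpha> \<beta> :: real and \<F> :: "graph set"
  assumes "2 > \<alpha>" "\<alpha> > \<beta>" "\<beta> \<ge> 1"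
    and "\<forall>H\<in>\<F>. is_graph H \<and> bipartite H"
    and "smooth \<alpha> \<beta> \<F>"
  shows "\<exists>k0::nat. \<forall>k. odd k \<and> k \<ge> k0 \<longrightarrow>
    (\<exists>c1 c2::real. c1 > 0 \<and> c2 > 0 \<and>
      (\<exists>N. \<forall>n\<ge>N. \<forall>G. is_graph G \<and> card (verts G) = n \<and> free (\<F> \<union> {cycle k}) G \<and>
           card (edges G) = ex n (\<F> \<union> {cycle k}) \<longrightarrow>
         (\<exists>S \<subseteq> verts G. real (card S) \<le> c1 * real n powr (1 + \<beta> - \<alpha>) \<and>
            real (card (incident_edges G S)) \<le> c2 * real n powr \<beta> \<and>
            bipartite (delete_verts G S)))) \<and>
    (\<exists>C N. \<forall>n\<ge>N. \<bar>real (ex n (\<F> \<union> {cycle k})) - real (zn n \<F>)\<bar> \<le> C * real n powr \<beta>)"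
proof -
  obtain \<rho> C0 where \<rho>: "0 < \<rho>" and C0: "\<And>m n. m \<le> n \<Longrightarrow> 1 \<le> n \<Longrightarrow>
      \<bar>real (zmn m n \<F>) - \<rho> * real m * real n powr (\<alpha> - 1)\<bar> \<le> C0 * real n powr \<beta>"
    using assms(5) unfolding smooth_def by metis
  define \<gamma> where "\<gamma> = \<alpha> - 1"
  \<comment> \<open>Smoothness says nothing about the sign of its constant; raising it to at least 1
    permits the division by \<open>C\<close> in the expansion estimate.\<close>
  define C where "C = max C0 1"
  define C1 where "C1 = C + \<rho>"
  define \<delta> where "\<delta> = \<rho> * (1/2) powr (1 + \<gamma>) / 2"
  have c: "0 < C" "0 \<le> C1" "0 < \<gamma>" "\<gamma> < 1" "\<beta> < 1 + \<gamma>" using assms \<rho> by (auto simp: C_def C1_def \<gamma>_def)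
  have \<delta>: "0 < \<delta>" using \<rho> by (simp add: \<delta>_def)
  have z: "\<bar>real (zmn m n \<F>) - \<rho> * real m * real n powr \<gamma>\<bar> \<le> C * real n powr \<beta>" if "m \<le> n" "1 \<le> n" for m n
  proof -
    have "C0 * real n powr \<beta> \<le> C * real n powr \<beta>" by (intro mult_right_mono) (auto simp: C_def)
    then show ?thesis using C0[OF that] by (simp add: \<gamma>_def)
  qed
  have zu: "real (zmn m n \<F>) \<le> \<rho> * real m * real n powr \<gamma> + C * real n powr \<beta>" if "m \<le> n" "1 \<le> n" for m n
    using z[OF that] by linarith
  have zl: "\<rho> * real m * real n powr \<gamma> - C * real n powr \<beta> \<le> real (zmn m n \<F>)" if "m \<le> n" "1 \<le> n" for m n
    using z[OF that] by linarith
  have "\<exists>k0. \<forall>k. odd k \<and> k0 \<le> k \<longrightarrow> (\<exists>N. \<forall>n\<ge>N. \<forall>V E. is_graph (V, E) \<longrightarrow> card V = n \<longrightarrow>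
      sparse \<rho> C \<gamma> \<beta> V E \<longrightarrow> \<not> contains (V, E) (cycle k) \<longrightarrow>
      \<rho> * (real n / 2) powr (1 + \<gamma>) - C1 * real n powr \<beta> \<le> real (card E) \<longrightarrow>
      (\<exists>S\<subseteq>V. real (card S) \<le> (C + C1) / \<delta> * real n powr (\<beta> - \<gamma>) \<and>
        real (card {e \<in> E. e \<inter> S \<noteq> {}}) \<le> (C + C1) * real n powr \<beta> \<and>
        bipartite (V - S, {e \<in> E. e \<inter> S = {}})))"
    by (rule dense_graph_near_bipartite[OF \<rho> c(1,2,3,4) assms(3) c(5) \<delta>_def])
  then obtain k0 where k0: "\<forall>k. odd k \<and> k0 \<le> k \<longrightarrow> (\<exists>N. \<forall>n\<ge>N. \<forall>V E. is_graph (V, E) \<longrightarrow> card V = n \<longrightarrow>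
      sparse \<rho> C \<gamma> \<beta> V E \<longrightarrow> \<not> contains (V, E) (cycle k) \<longrightarrow>
      \<rho> * (real n / 2) powr (1 + \<gamma>) - C1 * real n powr \<beta> \<le> real (card E) \<longrightarrow>
      (\<exists>S\<subseteq>V. real (card S) \<le> (C + C1) / \<delta> * real n powr (\<beta> - \<gamma>) \<and>
        real (card {e \<in> E. e \<inter> S \<noteq> {}}) \<le> (C + C1) * real n powr \<beta> \<and>
        bipartite (V - S, {e \<in> E. e \<inter> S = {}})))"
    by (rule exE)
  \<comment> \<open>The bound 3 makes \<open>cycle k\<close> a genuine odd cycle, which no bipartite
    graph contains.\<close>
  show ?thesis
  proof (rule exI[of _ "max k0 3"], intro allI impI)
    fix k assume k: "odd k \<and> max k0 3 \<le> k"
    let ?X = "\<F> \<union> {cycle k}"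
    have kk: "odd k \<and> k0 \<le> k" using k by simp
    from k0[THEN spec, THEN mp, OF kk] obtain N where N: "\<forall>n\<ge>N. \<forall>V E. is_graph (V, E) \<longrightarrow> card V = n \<longrightarrow>
      sparse \<rho> C \<gamma> \<beta> V E \<longrightarrow> \<not> contains (V, E) (cycle k) \<longrightarrow>
      \<rho> * (real n / 2) powr (1 + \<gamma>) - C1 * real n powr \<beta> \<le> real (card E) \<longrightarrow>
      (\<exists>S\<subseteq>V. real (card S) \<le> (C + C1) / \<delta> * real n powr (\<beta> - \<gamma>) \<and>
        real (card {e \<in> E. e \<inter> S \<noteq> {}}) \<le> (C + C1) * real n powr \<beta> \<and>
        bipartite (V - S, {e \<in> E. e \<inter> S = {}}))"
      by (rule exE)
    have zn_ex: "zn n \<F> \<le> ex n ?X" for n by (rule zn_le_ex) (use k in auto)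
    have extremal: "\<exists>S\<subseteq>verts G. real (card S) \<le> (C + C1) / \<delta> * real n powr (1 + \<beta> - \<alpha>) \<and>
            real (card (incident_edges G S)) \<le> (C + C1) * real n powr \<beta> \<and> bipartite (delete_verts G S)"
      if n: "max N 1 \<le> n" and G: "is_graph G" "card (verts G) = n" "free ?X G" "card (edges G) = ex n ?X" for n G
    proof -
      obtain V E where VE: "G = (V, E)" by fastforce
      have g: "is_graph (V, E)" "card V = n" "card E = ex n ?X" using G by (simp_all add: VE verts_def edges_def)
      have fr: "free \<F> (V, E)" "\<not> contains (V, E) (cycle k)" using G(3) unfolding VE free_def by auto
      \<comment> \<open>An extremal graph has at least as many edges as the best bipartite \<F>-free
        graph, which contains no odd cycle; so the lower bound for \<open>zn\<close> passes to
        it.\<close>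
      have "\<rho> * (real n / 2) powr (1 + \<gamma>) - C1 * real n powr \<beta> \<le> real (zn n \<F>)"
        unfolding C1_def by (rule zn_lower_bound[OF zl \<rho> c(1,3,4) assms(3)]) (use n in auto)
      then have low: "\<rho> * (real n / 2) powr (1 + \<gamma>) - C1 * real n powr \<beta> \<le> real (card E)"
        using zn_ex[of n] g(3) by simp
      have "\<exists>S\<subseteq>V. real (card S) \<le> (C + C1) / \<delta> * real n powr (\<beta> - \<gamma>) \<and>
        real (card {e \<in> E. e \<inter> S \<noteq> {}}) \<le> (C + C1) * real n powr \<beta> \<and>
        bipartite (V - S, {e \<in> E. e \<inter> S = {}})"
        using N[rule_format, OF _ g(1,2) sparse_of_free[OF zu g(1) fr(1)] fr(2) low] n by simp
      moreover have "\<beta> - \<gamma> = 1 + \<beta> - \<alpha>" by (simp add: \<gamma>_def)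
      ultimately show ?thesis
        by (simp add: VE verts_def edges_def delete_verts_def incident_edges_def)
    qed
    have pos: "0 < (C + C1) / \<delta>" "0 < C + C1" using c \<delta> by auto
    have "\<bar>real (ex n ?X) - real (zn n \<F>)\<bar> \<le> (C + C1) * real n powr \<beta>" if n: "max N 1 \<le> n" for n
    proof -
      consider "ex n ?X = 0" | G where "is_graph G" "card (verts G) = n" "free ?X G" "card (edges G) = ex n ?X"
        using ex_attained[of n ?X] by metis
      then show ?thesis
      proof cases
        case 1
        then show ?thesis using zn_ex[of n] pos by simp
      next
        case (2 G)
        then obtain S where S: "S \<subseteq> verts G" "real (card (incident_edges G S)) \<le> (C + C1) * real n powr \<beta>"
          "bipartite (delete_verts G S)" using extremal[OF n 2] by blast
        \<comment> \<open>Only the edges at \<open>S\<close> are removed and all vertices stay, so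
          the result still has \<open>n\<close> vertices and competes for
          \<open>zn n \<F>\<close>.\<close>
        let ?E = "{e \<in> edges G. e \<inter> S = {}}"
        let ?H = "(verts G, ?E)"
        have gG: "is_graph (verts G, edges G)" "free ?X (verts G, edges G)" using 2 by (simp_all add: verts_def edges_def)
        have fE: "finite (edges G)" by (rule is_graph_finite_edges[OF gG(1)])
        have "is_graph ?H" by (rule is_graph_subset[OF gG(1)]) simp
        moreover have "free ?X ?H" by (rule free_subgraph[OF gG(2)]) auto
        then have "free \<F> ?H" unfolding free_def by blast
        moreover have "bipartite ?H" using S(3) by (simp add: bipartite_def delete_verts_def edges_def)
        moreover have "card (verts ?H) = n" using 2(2) by (simp add: verts_def)
        ultimately have "is_graph ?H \<and> card (verts ?H) = n \<and> bipartite ?H \<and> free \<F> ?H" by blast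
        then have "card (edges ?H) \<le> zn n \<F>" by (rule card_edges_le_zn)
        then have H: "card ?E \<le> zn n \<F>" by (simp add: edges_def)
        have "edges G = ?E \<union> incident_edges G S" by (auto simp: incident_edges_def)
        then have "card (edges G) \<le> card ?E + card (incident_edges G S)" by (metis (no_types, lifting) card_Un_le)
        then have "real (ex n ?X) \<le> real (zn n \<F>) + (C + C1) * real n powr \<beta>"
          using H S(2) 2(4) by linarith
        then show ?thesis using zn_ex[of n] by simp
      qed
    qed
    then have second: "\<exists>C N. \<forall>n\<ge>N. \<bar>real (ex n ?X) - real (zn n \<F>)\<bar> \<le> C * real n powr \<beta>"
      by (intro exI[of _ "C + C1"] exI[of _ "max N 1"] allI impI)
    show "(\<exists>c1 c2::real. c1 > 0 \<and> c2 > 0 \<and>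
      (\<exists>N. \<forall>n\<ge>N. \<forall>G. is_graph G \<and> card (verts G) = n \<and> free ?X G \<and> card (edges G) = ex n ?X \<longrightarrow>
         (\<exists>S \<subseteq> verts G. real (card S) \<le> c1 * real n powr (1 + \<beta> - \<alpha>) \<and>
            real (card (incident_edges G S)) \<le> c2 * real n powr \<beta> \<and>
            bipartite (delete_verts G S)))) \<and>
      (\<exists>C N. \<forall>n\<ge>N. \<bar>real (ex n ?X) - real (zn n \<F>)\<bar> \<le> C * real n powr \<beta>)"
    proof (rule conjI[OF _ second], rule exI[of _ "(C + C1) / \<delta>"], rule exI[of _ "C + C1"],
        intro conjI pos, rule exI[of _ "max N 1"], intro allI impI)
      fix n G assume n: "max N 1 \<le> n" and G: "is_graph G \<and> card (verts G) = n \<and> free ?X G \<and> card (edges G) = ex n ?X"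
      show "\<exists>S\<subseteq>verts G. real (card S) \<le> (C + C1) / \<delta> * real n powr (1 + \<beta> - \<alpha>) \<and>
            real (card (incident_edges G S)) \<le> (C + C1) * real n powr \<beta> \<and> bipartite (delete_verts G S)"
        by (rule extremal[OF n]) (use G in auto)
    qed
  qed
qed

end
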